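(* Let $d\ge1$, and suppose that we have a measurable tiling $F\oplus A=_{\mathrm{a.e.}}\mathbb{T}^d$ of the $d$-torus by some finite subset $F=\{f_1,\dots,f_n\}$ of $\mathbb{R}^d$ (with $f_1,\dots,f_n$ distinct) and some measurable subset $A$ of $\mathbb{T}^d$. Then there exists a rational tiling $F^0\oplus A=_{\mathrm{a.e.}}\mathbb{T}^d$ of the $d$-torus by some finite subset $F^0=\{f_1^0,\dots,f_n^0\}$ of $\mathbb{Q}^d$, obeying the following additional properties: (i) If we define the velocities $v_i:=f_i-f_i^0$ for $i=1,\dots,n$ and the sets $F^t=\{f_1^0+tv_1,\dots,f_n^0+tv_n\}$ for all $t\in\mathbb{R}$, then $F^t\oplus A=_{\mathrm{a.e.}}\mathbb{T}^d$ for all $t\in\mathbb{R}$. (ii) If $d=2$ and $0\in F$, then all the velocities $v_i$ are scalar multiples $v_i=\alpha_iv$ of a single vector $v\in\mathbb{Z}^2$ for some real numbers $\alpha_1,\dots,\alpha_n$. Furthermore, we can partition $F$ into subsets $F_1,\dots,F_k$ such that for each $1\le j\le k$, the elements of $F_j$ have the same velocity (thus $\alpha_i=\alpha_{i'}$ whenever $f_i,f_{i'}\in F_j$), and the set $F_j\oplus A:=\{f_i+a: f_i\in F_j, a\in A\}$ is $\mathbb{R}v$-invariant in the sense that $tv+(F_j\oplus A)=_{\mathrm{a.e.}}F_j\oplus A$ for every $t\in\mathbb{R}$. (iii) If $d=2$ and $0\in F$, and furthermore the tile $A$ is open and connected, then the choices in (ii) can be made so that in addition either all the velocities $v_i$ vanish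 (so in particular $F=F^0$ is rational), or else for each $1\le j\le k$ the set $F_j\bmod\mathbb{Z}^2$ lies in a coset of $\mathbb{R}v\bmod\mathbb{Z}^2$, and all the $F_j$ have the same cardinality. (iv) If $d=1$, then $F$ is rational; in other words, we have $F=F^0+v$ for some $v\in\mathbb{R}$.
   Context: $\mathbb{T}^d=\mathbb{R}^d/\mathbb{Z}^d$ is equipped with Lebesgue (Haar) probability measure, and $\mathbb{R}^d$ acts on it by translation. For a finite set $F\subset\mathbb{R}^d$ and a measurable $A\subset\mathbb{T}^d$, the measurable tiling $F\oplus A=_{\mathrm{a.e.}}\mathbb{T}^d$ means that the translates $f+A$, $f\in F$, partition $\mathbb{T}^d$ up to null sets (distinct elements of $F$ give translates with null intersection, and the union of the translates is conull). Such a tiling (or the set $F$) is called rational if $F-F=\{f'-f: f,f'\in F\}\subset\mathbb{Q}^d$. For sets, $B=_{\mathrm{a.e.}}C$ means equality up to a null set. *)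

theory Defs
  imports "HOL-Analysis.Analysis" "HOL-Library.Disjoint_Sets"
begin

definition int_vecs :: "(real ^ 'n) set"
  where "int_vecs = {x. \<forall>i. x $ i \<in> \<int>}"

definition rat_vecs :: "(real ^ 'n) set"
  where "rat_vecs = {x. \<forall>i. x $ i \<in> \<rat>}"

lemma int_vecs_0: "0 \<in> int_vecs"
  and int_vecs_add: "x \<in> int_vecs \<Longrightarrow> y \<in> int_vecs \<Longrightarrow> x + y \<in> int_vecs"
  and int_vecs_minus: "x \<in> int_vecs \<Longrightarrow> - x \<in> int_vecs"
  by (auto simp: int_vecs_def)


subsection \<open>The torus as a topological group\<close>

definition torus_rel :: "real ^ 'n \<Rightarrow> real ^ 'n \<Rightarrow> bool"
  where "torus_rel x y \<longleftrightarrow> x - y \<in> int_vecs"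

lemma equivp_torus_rel: "equivp torus_rel"
proof (rule equivpI)
  show "reflp torus_rel"
    by (auto intro!: reflpI simp: torus_rel_def int_vecs_0)
  show "symp torus_rel"
    using int_vecs_minus by (fastforce intro!: sympI simp: torus_rel_def)
  show "transp torus_rel"
    using int_vecs_add by (fastforce intro!: transpI simp: torus_rel_def)
qed

quotient_type 'n torus = "real ^ 'n" / torus_rel
  by (rule equivp_torus_rel)

lift_definition to_torus :: "real ^ 'n \<Rightarrow> 'n torus" is "\<lambda>x. x" .

instantiation torus :: (finite) ab_group_add
begin

lift_definition zero_torus :: "'a torus" is 0 .

lift_definition plus_torus :: "'a torus \<Rightarrow> 'a torus \<Rightarrow> 'a torus" is "(+)"
  unfolding torus_rel_def using int_vecs_add by (metis add_diff_add)

lift_definition uminus_torus :: "'a torus \<Rightarrow> 'a torus" is uminus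
  unfolding torus_rel_def using int_vecs_minus by (metis minus_diff_minus)

lift_definition minus_torus :: "'a torus \<Rightarrow> 'a torus \<Rightarrow> 'a torus" is "(-)"
  unfolding torus_rel_def
  using int_vecs_add int_vecs_minus
  by (metis (no_types, opaque_lifting) add_diff_add diff_conv_add_uminus minus_diff_minus)

instance
proof
  fix a b c :: "'a torus"
  show "a + b + c = a + (b + c)"
    by (transfer, simp add: torus_rel_def int_vecs_def)
  show "a + b = b + a"
    by (transfer, simp add: torus_rel_def int_vecs_def)
  show "0 + a = a"
    by (transfer, simp add: torus_rel_def int_vecs_def)
  show "- a + a = 0"
    by (transfer, simp add: torus_rel_def int_vecs_def)
  show "a - b = a + - b"
    by (transfer, simp add: torus_rel_def int_vecs_def)
qed

end

lemma to_torus_add: "to_torus (x + y) = to_torus x + to_torus y"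
  by transfer (simp add: torus_rel_def int_vecs_def)

lemma to_torus_eq_iff: "to_torus x = to_torus y \<longleftrightarrow> x - y \<in> int_vecs"
  by transfer (simp add: torus_rel_def)

lemma surj_to_torus: "surj to_torus"
  by (metis Quotient3_def Quotient3_torus surjI to_torus.abs_eq)

instantiation torus :: (finite) topological_space
begin

definition open_torus :: "'a torus set \<Rightarrow> bool"
  where "open_torus U \<longleftrightarrow> open (to_torus -` U)"

instance
  by standard (auto simp: open_torus_def vimage_Union)

end


subsection \<open>Lebesgue measure on the torus\<close>

definition unit_cube :: "(real ^ 'n) set"
  where "unit_cube = {x. \<forall>i. 0 \<le> x $ i \<and> x $ i < 1}"

text \<open>
  A set is measurable iff its periodic lift to \<open>\<real>\<^sup>d\<close> is Lebesgue (not only Borel) measurable, and its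
  measure is that of the part of the lift in the fundamental domain.
\<close>

definition torus_lebesgue :: "('n :: finite) torus measure"
  where "torus_lebesgue =
    distr (lebesgue_on unit_cube) (sigma UNIV {A. to_torus -` A \<in> sets lebesgue}) to_torus"

lemma sigma_algebra_torus:
  "sigma_algebra UNIV {A :: ('n :: finite) torus set. to_torus -` A \<in> sets lebesgue}"
proof -
  have "- X \<in> sets lebesgue" if "X \<in> sets lebesgue" for X :: "(real ^ 'n) set"
    using sets.compl_sets[OF that] by (simp add: Compl_eq_Diff_UNIV)
  then show ?thesis
    by (auto simp: sigma_algebra_iff2 vimage_Compl vimage_UN Compl_eq_Diff_UNIV[symmetric])
qed

lemma space_torus_lebesgue [simp]: "space torus_lebesgue = UNIV"
  by (simp add: torus_lebesgue_def)

lemma sets_torus_lebesgue: "A \<in> sets torus_lebesgue \<longleftrightarrow> to_torus -` A \<in> sets lebesgue"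
  by (simp add: torus_lebesgue_def sigma_algebra.sets_measure_of_eq[OF sigma_algebra_torus])

lemma unit_cube_between:
  "box 0 1 \<subseteq> (unit_cube :: (real ^ 'n) set)" "unit_cube \<subseteq> cbox 0 (1 :: real ^ 'n)"
  by (auto simp: unit_cube_def mem_box_cart less_imp_le)

lemma unit_cube_sets: "(unit_cube :: (real ^ 'n) set) \<in> sets lebesgue"
proof -
  have "(unit_cube :: (real ^ 'n) set) = (\<Inter>i. {x. 0 \<le> x $ i} \<inter> {x. x $ i < 1})"
    by (auto simp: unit_cube_def)
  also have "\<dots> \<in> sets borel"
  proof (intro sets.countable_INT'' sets.Int)
    fix i :: 'n
    show "{x :: real ^ 'n. 0 \<le> x $ i} \<in> sets borel"
      by (intro borel_closed closed_Collect_le continuous_intros)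
    show "{x :: real ^ 'n. x $ i < 1} \<in> sets borel"
      by (intro borel_open open_Collect_less continuous_intros)
  qed auto
  finally show ?thesis by auto
qed

lemma emeasure_unit_cube: "emeasure lebesgue (unit_cube :: (real ^ 'n) set) = 1"
proof (rule antisym)
  have inner_1: "(1 :: real ^ 'n) \<bullet> b = 1" if "b \<in> Basis" for b
    using that by (auto simp: Basis_vec_def inner_axis)
  have le: "(0 :: real ^ 'n) \<bullet> b \<le> 1 \<bullet> b" if "b \<in> Basis" for b
    using inner_1[OF that] by simp
  have prod: "(\<Prod>b\<in>Basis. (1 - 0 :: real ^ 'n) \<bullet> b) = 1"
    by (intro prod.neutral) (auto simp: inner_1)
  have c: "emeasure lebesgue (cbox 0 (1 :: real ^ 'n)) = 1"
    using emeasure_lborel_cbox[OF le] prod by simp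
  have b: "emeasure lebesgue (box 0 (1 :: real ^ 'n)) = 1"
    using emeasure_lborel_box[OF le] prod by simp
  show "emeasure lebesgue (unit_cube :: (real ^ 'n) set) \<le> 1"
    using emeasure_mono[OF unit_cube_between(2)] c by (metis lmeasurable_cbox fmeasurableD)
  show "1 \<le> emeasure lebesgue (unit_cube :: (real ^ 'n) set)"
    using b by (metis emeasure_mono unit_cube_between(1) unit_cube_sets)
qed

lemma emeasure_torus_lebesgue:
  fixes A :: "('n :: finite) torus set"
  assumes "A \<in> sets torus_lebesgue"
  shows "emeasure torus_lebesgue A = emeasure lebesgue (to_torus -` A \<inter> unit_cube)"
proof -
  let ?N = "sigma UNIV {A :: 'n torus set. to_torus -` A \<in> sets lebesgue}"
  have meas: "to_torus \<in> measurable (lebesgue_on unit_cube) ?N"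
    using unit_cube_sets
    by (intro measurable_measure_of) (auto simp: sets_restrict_space)
  have "A \<in> sets ?N"
    using assms by (simp add: torus_lebesgue_def)
  then have "emeasure torus_lebesgue A =
      emeasure (lebesgue_on unit_cube) (to_torus -` A \<inter> space (lebesgue_on unit_cube))"
    unfolding torus_lebesgue_def by (intro emeasure_distr meas)
  also have "\<dots> = emeasure lebesgue (to_torus -` A \<inter> unit_cube)"
    using unit_cube_sets by (subst emeasure_restrict_space) auto
  finally show ?thesis .
qed

lemma emeasure_torus_UNIV: "emeasure torus_lebesgue UNIV = 1"
  by (simp add: emeasure_torus_lebesgue sets_torus_lebesgue emeasure_unit_cube)


subsection \<open>Tilings\<close>

definition ae_eq :: "('n :: finite) torus set \<Rightarrow> 'n torus set \<Rightarrow> bool"  (infix "=\<^sub>a\<^sub>e" 50)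
  where "B =\<^sub>a\<^sub>e C \<longleftrightarrow> (AE x in torus_lebesgue. x \<in> B \<longleftrightarrow> x \<in> C)"

definition translate :: "real ^ 'n \<Rightarrow> ('n :: finite) torus set \<Rightarrow> 'n torus set"
  where "translate f A = (\<lambda>a. to_torus f + a) ` A"

definition sumset :: "(real ^ 'n) set \<Rightarrow> ('n :: finite) torus set \<Rightarrow> 'n torus set"
  where "sumset F A = {to_torus f + a |f a. f \<in> F \<and> a \<in> A}"

text \<open>Distinctness of elements of \<open>F\<close> is in \<open>\<real>\<^sup>d\<close>, not modulo \<open>\<int>\<^sup>d\<close>.\<close>

definition tiling :: "(real ^ 'n) set \<Rightarrow> ('n :: finite) torus set \<Rightarrow> bool"
  where "tiling F A \<longleftrightarrow>
    finite F \<and> A \<in> sets torus_lebesgue \<and>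
    (\<forall>f\<in>F. \<forall>g\<in>F. f \<noteq> g \<longrightarrow> translate f A \<inter> translate g A =\<^sub>a\<^sub>e {}) \<and>
    (\<Union>f\<in>F. translate f A) =\<^sub>a\<^sub>e UNIV"

definition rational_set :: "(real ^ 'n) set \<Rightarrow> bool"
  where "rational_set F \<longleftrightarrow> (\<forall>f\<in>F. \<forall>f'\<in>F. f' - f \<in> rat_vecs)"

definition line_coset :: "real ^ 'n \<Rightarrow> real ^ 'n \<Rightarrow> ('n :: finite) torus set"
  where "line_coset x v = {to_torus x + to_torus (t *\<^sub>R v) |t. True}"

end

(*
  The indicator of A has a nonzero Fourier coefficient at a frequency xi \<noteq> 0 only if the phases
  e(xi . f_i) sum to zero.  By the dilation lemma the same holds for every dilate (1 + k n!) F, so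
  these vanishing sums split over the classes of indices on which xi . f_i is constant modulo the
  rationals.  If f_i^0 is the image of f_i under a Q-linear retraction of R onto Q applied
  coordinatewise, then xi . v_i is constant on each class; hence moving the i-th tile along v_i
  preserves all the vanishing sums, and therefore the tiling.  In dimension one, tiles of different
  velocities would collide.

  In dimension two, the static tiles avoid at all times everything that moves.  The frequencies of
  their union B are orthogonal to some velocity, which writes 1_B as a constant plus a sum over the
  directions d of multiples c_d 1_{W_d}, with W_d the saturation of B along d.  Reducing modulo 1
  forces c_d = 1 and B = W_d for every d, so that there is only one direction v.

  If A is open and connected, the coordinate transversal to v lifts from the circle to a real
  coordinate Y on a class of equal velocity.  Weighting the vanishing sums with exp(-l Y) for several
  l separates the tiles according to their position, so each position gives a v-invariant set.
*)
theory Submission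
  imports Defs "HOL-Probability.Conditional_Expectation"
begin

subsection \<open>Translation invariance\<close>

text \<open>All statements hold almost everywhere, while the argument moves sets along whole lines.
  Saturations and invariant sigma-algebras therefore use rational multiples of a direction only:
  countably many null sets do no harm, measurability survives, and integer frequencies not
  orthogonal to the direction are still annihilated. The factor c_d in the plane is the measure of
  the union of all tiles whose velocity is a multiple of d, static ones included: averaged along d,
  the indicator of this union is constant, and multiplied by 1_{W_d} it is 1_B. Modulo 1 the
  decomposition makes c_d 1_{W_d} constant although both its values 0 and c_d occur, and 0 < c_d
  \<le> 1. For connected tiles, the cut that lifts Y exists because, once something moves, a single
  velocity class never fills the torus. The exponential is chosen since a displacement of Y becomes
  a factor, so that one integral depending on l, common to the class, splits off; it is nonzero for
  small l, its value at l = 0 being a nonzero Fourier coefficient of the tile, and multiples of one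
  small l lead back to power sums.\<close>

lemma to_torus_minus: "to_torus (- x) = - to_torus x"
  by transfer (simp add: torus_rel_def int_vecs_def)

lemma to_torus_diff: "to_torus (x - y) = to_torus x - to_torus y"
  by transfer (simp add: torus_rel_def int_vecs_def)

lemma to_torus_0 [simp]: "to_torus 0 = 0"
  by transfer (simp add: torus_rel_def int_vecs_def)

lemma to_torus_int [simp]: "k \<in> int_vecs \<Longrightarrow> to_torus k = 0"
  using to_torus_eq_iff[of k 0] by simp

lemma torus_cases [case_names to_torus]:
  obtains x where "a = to_torus x"
  using surj_to_torus by (metis surjE)

lemma countable_int_vecs: "countable (int_vecs :: (real ^ 'n::finite) set)"
proof -
  have "(int_vecs :: (real ^ 'n) set) \<subseteq> range (\<lambda>g :: int ^ 'n. \<chi> i. of_int (g $ i))"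
  proof
    fix x :: "real ^ 'n" assume x: "x \<in> int_vecs"
    have "x = (\<chi> i. of_int ((\<chi> i. \<lfloor>x $ i\<rfloor>) $ i))"
      using x by (simp add: int_vecs_def vec_eq_iff)
    then show "x \<in> range (\<lambda>g :: int ^ 'n. \<chi> i. of_int (g $ i))" by blast
  qed
  moreover have "countable (UNIV :: (int ^ 'n) set)"
  proof -
    have "countable (UNIV \<rightarrow>\<^sub>E UNIV :: ('n \<Rightarrow> int) set)" by (rule countable_PiE) auto
    then have "countable (UNIV :: ('n \<Rightarrow> int) set)" by (simp add: PiE_UNIV_domain)
    then have "countable (range (vec_lambda :: ('n \<Rightarrow> int) \<Rightarrow> int ^ 'n))" by (rule countable_image)
    moreover have "range (vec_lambda :: ('n \<Rightarrow> int) \<Rightarrow> int ^ 'n) = UNIV"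
      by (metis surjI vec_nth_inverse)
    ultimately show ?thesis by simp
  qed
  ultimately show ?thesis by (meson countable_image countable_subset)
qed

definition floor_vec :: "real ^ 'n \<Rightarrow> real ^ 'n"
  where "floor_vec x = (\<chi> i. of_int \<lfloor>x $ i\<rfloor>)"

lemma floor_vec_int: "floor_vec x \<in> int_vecs"
  by (simp add: floor_vec_def int_vecs_def)

lemma diff_floor_vec_cube: "x - floor_vec x \<in> unit_cube"
  by (auto simp: floor_vec_def unit_cube_def) linarith+

lemma int_vecs_diff: "x \<in> int_vecs \<Longrightarrow> y \<in> int_vecs \<Longrightarrow> x - y \<in> int_vecs"
  using int_vecs_add[of x "- y"] int_vecs_minus[of y] by simp

lemma unit_cube_unique:
  assumes "x \<in> unit_cube" "y \<in> unit_cube" "x - y \<in> int_vecs"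
  shows "x = y"
proof -
  have "x $ i = y $ i" for i
  proof -
    from assms(3) obtain m :: int where m: "x $ i - y $ i = of_int m"
      by (auto simp: int_vecs_def elim: Ints_cases)
    have "\<bar>x $ i - y $ i\<bar> < 1" using assms(1,2) by (auto simp: unit_cube_def abs_less_iff)
        (smt (verit))+
    then have "m = 0" using m by linarith
    then show ?thesis using m by simp
  qed
  then show ?thesis by (simp add: vec_eq_iff)
qed

lemma emeasure_lebesgue_translate:
  fixes S :: "'a::euclidean_space set"
  shows "emeasure lebesgue ((+) a ` S) = emeasure lebesgue S"
proof -
  have "(\<lambda>x. a + 1 *\<^sub>R x) ` S = (+) a ` S" by simp
  then show ?thesis using emeasure_lebesgue_affine[of 1 a S] by (simp add: image_def add.commute)
qed

lemma vimage_plus_sets_lebesgue: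
  fixes S :: "'a::euclidean_space set"
  assumes "S \<in> sets lebesgue"
  shows "(\<lambda>x. x + a) -` S \<in> sets lebesgue"
    and "emeasure lebesgue ((\<lambda>x. x + a) -` S) = emeasure lebesgue S"
proof -
  have "(\<lambda>x. x + a) -` S = (+) (-a) ` S"
    by (force simp: image_iff)
  then show "(\<lambda>x. x + a) -` S \<in> sets lebesgue"
    "emeasure lebesgue ((\<lambda>x. x + a) -` S) = emeasure lebesgue S"
    using lebesgue_sets_translation[OF assms, of "-a"] emeasure_lebesgue_translate[of "-a" S] by metis+
qed

text \<open>Both sides are cut along the lattice translates of the other domain; the pieces match up to integer shifts.\<close>

lemma emeasure_periodic_shift_cube:
  fixes S :: "(real ^ 'n) set"
  assumes S: "S \<in> sets lebesgue" and per: "\<And>k x. k \<in> int_vecs \<Longrightarrow> x + k \<in> S \<longleftrightarrow> x \<in> S"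
  shows "emeasure lebesgue (S \<inter> (\<lambda>x. x + a) -` unit_cube) = emeasure lebesgue (S \<inter> unit_cube)"
proof -
  let ?Z = "int_vecs :: (real ^ 'n) set"
  let ?V = "(\<lambda>x. x + a) -` unit_cube :: (real ^ 'n) set"
  note c = unit_cube_sets
  have V: "?V \<in> sets lebesgue" by (rule vimage_plus_sets_lebesgue[OF c])
  have sh: "(\<lambda>x. x + k) -` X \<in> sets lebesgue" if "X \<in> sets lebesgue" for X and k :: "real ^ 'n"
    by (rule vimage_plus_sets_lebesgue[OF that])
  have 1: "S \<inter> ?V = (\<Union>k\<in>?Z. S \<inter> ?V \<inter> (\<lambda>x. x + k) -` unit_cube)"
  proof -
    have "\<exists>k\<in>?Z. x + k \<in> unit_cube" for x
      using diff_floor_vec_cube[of x] floor_vec_int[of x] by (intro bexI[of _ "- floor_vec x"]) (auto simp: int_vecs_minus)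
    then show ?thesis by auto
  qed
  have 2: "S \<inter> unit_cube = (\<Union>k\<in>?Z. S \<inter> unit_cube \<inter> (\<lambda>x. x - k) -` ?V)"
  proof -
    have "\<exists>k\<in>?Z. x - k + a \<in> unit_cube" for x
      using diff_floor_vec_cube[of "x + a"] floor_vec_int[of "x + a"] by (intro bexI[of _ "floor_vec (x + a)"]) (auto simp: algebra_simps)
    then show ?thesis by auto
  qed
  have "emeasure lebesgue (S \<inter> ?V) = (\<integral>\<^sup>+k. emeasure lebesgue (S \<inter> ?V \<inter> (\<lambda>x. x + k) -` unit_cube) \<partial>count_space ?Z)"
  proof (subst 1, rule emeasure_UN_countable)
    show "disjoint_family_on (\<lambda>k. S \<inter> ?V \<inter> (\<lambda>x. x + k) -` unit_cube) ?Z"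
    proof (clarsimp simp: disjoint_family_on_def set_eq_iff)
      fix m n x :: "real ^ 'n" assume "m \<in> ?Z" "n \<in> ?Z" "m \<noteq> n" "x + m \<in> unit_cube" "x + n \<in> unit_cube"
      then show False using unit_cube_unique[of "x + m" "x + n"] int_vecs_diff[of m n] by simp
    qed
  qed (use S V sh c countable_int_vecs in auto)
  also have "\<dots> = (\<integral>\<^sup>+k. emeasure lebesgue (S \<inter> unit_cube \<inter> (\<lambda>x. x - k) -` ?V) \<partial>count_space ?Z)"
  proof (rule nn_integral_cong)
    fix k assume "k \<in> space (count_space ?Z)"
    then have k: "k \<in> ?Z" by simp
    have "S \<inter> ?V \<inter> (\<lambda>x. x + k) -` unit_cube = (\<lambda>x. x + k) -` (S \<inter> unit_cube \<inter> (\<lambda>x. x - k) -` ?V)"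
      using per[OF k] by auto
    moreover have "S \<inter> unit_cube \<inter> (\<lambda>x. x - k) -` ?V \<in> sets lebesgue"
      using sh[OF V, of "- k"] S c by auto
    ultimately show "emeasure lebesgue (S \<inter> ?V \<inter> (\<lambda>x. x + k) -` unit_cube) =
        emeasure lebesgue (S \<inter> unit_cube \<inter> (\<lambda>x. x - k) -` ?V)"
      using vimage_plus_sets_lebesgue(2) by metis
  qed
  also have "\<dots> = emeasure lebesgue (S \<inter> unit_cube)"
  proof (subst (2) 2, rule emeasure_UN_countable[symmetric])
    show "disjoint_family_on (\<lambda>k. S \<inter> unit_cube \<inter> (\<lambda>x. x - k) -` ?V) ?Z"
    proof (clarsimp simp: disjoint_family_on_def set_eq_iff)
      fix m n x :: "real ^ 'n" assume "m \<in> ?Z" "n \<in> ?Z" "m \<noteq> n" "x - m + a \<in> unit_cube" "x - n + a \<in> unit_cube"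
      then show False using unit_cube_unique[of "x - m + a" "x - n + a"] int_vecs_diff[of n m] by simp
    qed
    show "S \<inter> unit_cube \<inter> (\<lambda>x. x - k) -` ?V \<in> sets lebesgue" for k
      using sh[OF V, of "- k"] S c by auto
  qed (use countable_int_vecs in auto)
  finally show ?thesis .
qed

text \<open>A representative of the shift moves the unit cube to another fundamental domain, and for
  the periodic lift of \<open>A\<close> all translates of the cube give the same measure.\<close>

lemma
  fixes A :: "('n::finite) torus set"
  assumes "A \<in> sets torus_lebesgue"
  shows sets_torus_shift: "(\<lambda>x. x + a) -` A \<in> sets torus_lebesgue"
    and emeasure_torus_shift: "emeasure torus_lebesgue ((\<lambda>x. x + a) -` A) = emeasure torus_lebesgue A"
proof -
  obtain v where v: "a = to_torus v" by (rule torus_cases)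
  let ?S = "to_torus -` A"
  have S: "?S \<in> sets lebesgue" using assms by (simp add: sets_torus_lebesgue)
  have eq: "to_torus -` (\<lambda>x. x + a) -` A = (\<lambda>x. x + v) -` ?S"
    by (auto simp: v to_torus_add)
  show sets: "(\<lambda>x. x + a) -` A \<in> sets torus_lebesgue"
    using vimage_plus_sets_lebesgue(1)[OF S] by (simp add: sets_torus_lebesgue eq)
  have "emeasure torus_lebesgue ((\<lambda>x. x + a) -` A) = emeasure lebesgue ((\<lambda>x. x + v) -` ?S \<inter> unit_cube)"
    using emeasure_torus_lebesgue[OF sets] eq by simp
  also have "(\<lambda>x. x + v) -` ?S \<inter> unit_cube = (\<lambda>x. x + v) -` (?S \<inter> (\<lambda>x. x + -v) -` unit_cube)"
    by auto
  also have "emeasure lebesgue \<dots> = emeasure lebesgue (?S \<inter> (\<lambda>x. x + -v) -` unit_cube)"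
    by (intro vimage_plus_sets_lebesgue(2) sets.Int S vimage_plus_sets_lebesgue(1) unit_cube_sets)
  also have "\<dots> = emeasure lebesgue (?S \<inter> unit_cube)"
    by (intro emeasure_periodic_shift_cube S) (simp add: to_torus_add)
  also have "\<dots> = emeasure torus_lebesgue A" using emeasure_torus_lebesgue[OF assms] by simp
  finally show "emeasure torus_lebesgue ((\<lambda>x. x + a) -` A) = emeasure torus_lebesgue A" .
qed

lemma measurable_torus_shift [measurable]: "(\<lambda>x. x + a) \<in> measurable torus_lebesgue torus_lebesgue"
  by (rule measurableI) (auto simp: sets_torus_shift)

lemma measurable_torus_shift_diff [measurable]: "(\<lambda>x. x - a) \<in> measurable torus_lebesgue torus_lebesgue"
  using measurable_torus_shift[of "- a"] by simp

lemma distr_torus_shift: "distr torus_lebesgue torus_lebesgue (\<lambda>x. x + a) = torus_lebesgue"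
  by (rule measure_eqI) (auto simp: emeasure_distr emeasure_torus_shift)

lemma prob_space_torus: "prob_space torus_lebesgue"
  by standard (simp add: emeasure_torus_UNIV)

interpretation torus: prob_space torus_lebesgue by (rule prob_space_torus)

lemma AE_torus_shift:
  assumes "AE x in torus_lebesgue. P x"
  shows "AE x in torus_lebesgue. P (x + a)"
proof -
  have "AE x in distr torus_lebesgue torus_lebesgue (\<lambda>x. x + a). P x"
    using assms unfolding distr_torus_shift .
  then show ?thesis by (rule AE_distrD[OF measurable_torus_shift])
qed

lemma AE_torus_shift_diff:
  assumes "AE x in torus_lebesgue. P x"
  shows "AE x in torus_lebesgue. P (x - a)"
  using AE_torus_shift[OF assms, of "- a"] by simp

lemma integral_torus_shift:
  fixes g :: "('n::finite) torus \<Rightarrow> 'b::{banach, second_countable_topology}"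
  assumes "g \<in> borel_measurable torus_lebesgue"
  shows "(\<integral>x. g (x + a) \<partial>torus_lebesgue) = integral\<^sup>L torus_lebesgue g"
  using integral_distr[OF measurable_torus_shift[of a] assms] by (simp add: distr_torus_shift)

lemma integral_torus_shift_diff:
  fixes g :: "('n::finite) torus \<Rightarrow> 'b::{banach, second_countable_topology}"
  assumes "g \<in> borel_measurable torus_lebesgue"
  shows "(\<integral>x. g (x - a) \<partial>torus_lebesgue) = integral\<^sup>L torus_lebesgue g"
  using integral_torus_shift[OF assms, of "- a"] by simp

subsection \<open>Fourier coefficients and their uniqueness\<close>

lemma to_torus_rep_torus [simp]: "to_torus (rep_torus x) = x"
  by (metis Quotient3_abs_rep Quotient3_torus to_torus.abs_eq)

lemma rep_to_torus_diff: "rep_torus (to_torus p) - p \<in> int_vecs"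
  using to_torus_eq_iff[of "rep_torus (to_torus p)" p] by simp

lemma inner_int_vecs: "x \<in> int_vecs \<Longrightarrow> y \<in> int_vecs \<Longrightarrow> x \<bullet> y \<in> \<int>"
  by (auto simp: int_vecs_def inner_vec_def intro!: Ints_sum Ints_mult)

lemma cis_2pi_eq_1_iff: "cis (2 * pi * r) = 1 \<longleftrightarrow> r \<in> \<int>"
proof
  assume "cis (2 * pi * r) = 1"
  then have "exp (\<i> * complex_of_real (2 * pi * r)) = 1" by (simp add: cis_conv_exp)
  then obtain n :: int where "2 * pi * r = of_int (2 * n) * pi" unfolding exp_eq_1 by auto
  then have "r = of_int n" by (simp add: field_simps)
  then show "r \<in> \<int>" by simp
next
  assume "r \<in> \<int>"
  then obtain n where "r = of_int n" by (auto elim: Ints_cases)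
  then show "cis (2 * pi * r) = 1" using cis_multiple_2pi[of r] by simp
qed

lemma cis_2pi_eq_iff: "cis (2 * pi * r) = cis (2 * pi * s) \<longleftrightarrow> r - s \<in> \<int>"
  using cis_2pi_eq_1_iff[of "r - s"] by (simp add: right_diff_distrib flip: cis_divide)

text \<open>A character only for integer \<xi>; at other frequencies the value depends on the chosen
  representatives, so most rules carry the hypothesis \<open>\<xi> \<in> int_vecs\<close>.\<close>

definition torus_char :: "real ^ 'n \<Rightarrow> ('n::finite) torus \<Rightarrow> complex"
  where "torus_char \<xi> x = cis (2 * pi * (\<xi> \<bullet> rep_torus x))"

lemma torus_char_to_torus:
  assumes "\<xi> \<in> int_vecs"
  shows "torus_char \<xi> (to_torus p) = cis (2 * pi * (\<xi> \<bullet> p))"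
  using inner_int_vecs[OF assms rep_to_torus_diff[of p]]
  by (simp add: torus_char_def cis_2pi_eq_iff inner_diff_right)

lemma norm_torus_char [simp]: "norm (torus_char \<xi> x) = 1"
  by (simp add: torus_char_def)

lemma torus_char_add: "\<xi> \<in> int_vecs \<Longrightarrow> torus_char \<xi> (x + y) = torus_char \<xi> x * torus_char \<xi> y"
  by (cases x rule: torus_cases, cases y rule: torus_cases)
     (simp add: torus_char_to_torus to_torus_add[symmetric] cis_mult inner_add_right distrib_left)

lemma torus_char_add_freq: "torus_char (\<xi> + \<eta>) x = torus_char \<xi> x * torus_char \<eta> x"
  by (simp add: torus_char_def cis_mult inner_add_left distrib_left)

lemma torus_char_0 [simp]: "torus_char 0 = (\<lambda>x. 1)"
  by (auto simp: torus_char_def)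

lemma borel_measurable_torusI:
  fixes g :: "('n::finite) torus \<Rightarrow> 'b::topological_space"
  assumes "(\<lambda>p. g (to_torus p)) \<in> borel_measurable lebesgue"
  shows "g \<in> borel_measurable torus_lebesgue"
proof (rule measurableI)
  fix B :: "'b set" assume "B \<in> sets borel"
  with assms have "(\<lambda>p. g (to_torus p)) -` B \<inter> space lebesgue \<in> sets lebesgue"
    by (rule measurable_sets)
  then show "g -` B \<inter> space torus_lebesgue \<in> sets torus_lebesgue"
    by (simp add: sets_torus_lebesgue vimage_def)
qed auto

lemma borel_measurable_torus_continuous:
  fixes g :: "('n::finite) torus \<Rightarrow> 'b::topological_space"
  assumes "continuous_on UNIV (\<lambda>p. g (to_torus p))"
  shows "g \<in> borel_measurable torus_lebesgue"
  using borel_measurable_continuous_onI[OF assms] by (intro borel_measurable_torusI measurable_completion) simp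

lemma torus_char_measurable [measurable]:
  assumes "\<xi> \<in> int_vecs"
  shows "torus_char \<xi> \<in> borel_measurable torus_lebesgue"
  using assms by (intro borel_measurable_torus_continuous) (simp add: torus_char_to_torus, intro continuous_intros)

lemma integrable_torus_bounded:
  fixes g :: "('n::finite) torus \<Rightarrow> 'b::{banach, second_countable_topology}"
  assumes "g \<in> borel_measurable torus_lebesgue" "\<And>x. norm (g x) \<le> B"
  shows "integrable torus_lebesgue g"
  using assms by (intro torus.integrable_const_bound[where B = B]) auto

lemma integrable_mult_bounded:
  fixes g f :: "('n::finite) torus \<Rightarrow> complex"
  assumes "integrable torus_lebesgue g" "f \<in> borel_measurable torus_lebesgue" "\<And>x. norm (f x) \<le> B"
  shows "integrable torus_lebesgue (\<lambda>x. g x * f x)"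
proof (rule Bochner_Integration.integrable_bound)
  show "integrable torus_lebesgue (\<lambda>x. B * norm (g x))" using assms(1) by simp
  show "(\<lambda>x. g x * f x) \<in> borel_measurable torus_lebesgue" using assms by measurable
  have "norm (g x * f x) \<le> norm (B * norm (g x))" for x
    using mult_left_mono[OF assms(3)[of x], of "norm (g x)"] by (simp add: norm_mult mult.commute)
  then show "AE x in torus_lebesgue. norm (g x * f x) \<le> norm (B * norm (g x))" by simp
qed

text \<open>The linear span of the characters. Closure under products is derived from additivity in
  the frequency and supplies the algebra for Stone-Weierstrass.\<close>

inductive trig_poly :: "(('n::finite) torus \<Rightarrow> complex) \<Rightarrow> bool" where
  char: "\<xi> \<in> int_vecs \<Longrightarrow> trig_poly (torus_char \<xi>)"
| scale: "trig_poly f \<Longrightarrow> trig_poly (\<lambda>x. c * f x)"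
| add: "trig_poly f \<Longrightarrow> trig_poly g \<Longrightarrow> trig_poly (\<lambda>x. f x + g x)"

lemma trig_poly_const: "trig_poly (\<lambda>x. c)"
  using trig_poly.scale[OF trig_poly.char[OF int_vecs_0], of c] by simp

lemma trig_poly_mult:
  assumes "trig_poly f" "trig_poly g"
  shows "trig_poly (\<lambda>x. f x * g x)"
  using assms(1)
proof induction
  case (char \<xi>)
  show ?case using assms(2)
  proof induction
    case (char \<eta>)
    then show ?case using trig_poly.char[OF int_vecs_add[OF \<open>\<xi> \<in> int_vecs\<close> char]]
      by (simp add: torus_char_add_freq[abs_def])
  next
    case (scale f c)
    then show ?case using trig_poly.scale[OF scale.IH, of c] by (simp add: ac_simps)
  next
    case (add f g)
    then show ?case using trig_poly.add[OF add.IH] by (simp add: algebra_simps)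
  qed
next
  case (scale f c)
  then show ?case using trig_poly.scale[OF scale.IH, of c] by (simp add: ac_simps)
next
  case (add f g)
  then show ?case using trig_poly.add[OF add.IH] by (simp add: algebra_simps)
qed

lemma trig_poly_bounded_measurable:
  assumes "trig_poly f"
  shows "f \<in> borel_measurable torus_lebesgue \<and> (\<exists>B. \<forall>x. norm (f x) \<le> B)"
  using assms
proof induction
  case (char \<xi>)
  then show ?case using torus_char_measurable by (auto intro!: exI[of _ 1])
next
  case (scale f c)
  then obtain B where "\<forall>x. norm (f x) \<le> B" by auto
  then have "\<forall>x. norm (c * f x) \<le> norm c * B" by (simp add: norm_mult mult_left_mono)
  then show ?case using scale by auto
next
  case (add f g)
  then obtain B B' where "\<forall>x. norm (f x) \<le> B" "\<forall>x. norm (g x) \<le> B'" by auto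
  then have "\<forall>x. norm (f x + g x) \<le> B + B'" by (meson add_mono norm_triangle_le)
  then show ?case using add by auto
qed

text \<open>Paired with the character itself, not its conjugate, so this is the usual coefficient at
  -\<xi>; a shift by \<open>a\<close> then contributes the factor
  \<open>torus_char \<xi> a\<close>.\<close>

definition fourier :: "(('n::finite) torus \<Rightarrow> complex) \<Rightarrow> real ^ 'n \<Rightarrow> complex"
  where "fourier g \<xi> = (\<integral>x. g x * torus_char \<xi> x \<partial>torus_lebesgue)"

lemma integral_trig_poly_eq_0:
  fixes g :: "('n::finite) torus \<Rightarrow> complex"
  assumes "trig_poly f" and g: "integrable torus_lebesgue g" and 0: "\<And>\<xi>. \<xi> \<in> int_vecs \<Longrightarrow> fourier g \<xi> = 0"
  shows "(\<integral>x. g x * f x \<partial>torus_lebesgue) = 0"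
  using assms(1)
proof induction
  case (char \<xi>)
  then show ?case using 0 by (simp add: fourier_def)
next
  case (scale f c)
  have "(\<integral>x. g x * (c * f x) \<partial>torus_lebesgue) = (\<integral>x. c * (g x * f x) \<partial>torus_lebesgue)"
    by (simp add: ac_simps)
  then show ?case using scale by simp
next
  case (add f h)
  have i: "integrable torus_lebesgue (\<lambda>x. g x * k x)" if "trig_poly k" for k
    using trig_poly_bounded_measurable[OF that] integrable_mult_bounded[OF g, of k] by blast
  show ?case using i[OF add.hyps(1)] i[OF add.hyps(2)] add.IH by (simp add: distrib_left)
qed

text \<open>The embedding of the torus as a product of circles makes Stone-Weierstrass applicable.\<close>

definition circles :: "real ^ 'n \<Rightarrow> complex ^ 'n"
  where "circles p = (\<chi> i. cis (2 * pi * p $ i))"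

lemma continuous_on_circles: "continuous_on A circles"
  unfolding circles_def by (intro continuous_intros)

lemma circles_eq_iff: "circles p = circles q \<longleftrightarrow> p - q \<in> int_vecs"
  by (simp add: circles_def vec_eq_iff cis_2pi_eq_iff int_vecs_def)

lemma circles_in_compact: "circles p \<in> circles ` cbox 0 1"
proof -
  have "circles p = circles (p - floor_vec p)" by (simp add: circles_eq_iff floor_vec_int)
  then show ?thesis using diff_floor_vec_cube[of p] unit_cube_between(2) by blast
qed

lemma circles_rep_torus: "circles (rep_torus (to_torus p)) = circles p"
  by (simp add: circles_eq_iff rep_to_torus_diff)

text \<open>Euler's formulas. These coordinate functions separate the points of the product of
  circles.\<close>

lemma trig_poly_circles:
  fixes i :: "'n::finite"
  shows "trig_poly (\<lambda>x. complex_of_real (Re (circles (rep_torus x) $ i)))"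
    and "trig_poly (\<lambda>x. complex_of_real (Im (circles (rep_torus x) $ i)))"
proof -
  let ?a = "axis i 1 :: real ^ 'n"
  have a: "?a \<in> int_vecs" by (simp add: int_vecs_def axis_def)
  note b = int_vecs_minus[OF a]
  have 1: "complex_of_real (Re (circles (rep_torus x) $ i)) = (1/2) * torus_char ?a x + (1/2) * torus_char (- ?a) x"
    and 2: "complex_of_real (Im (circles (rep_torus x) $ i)) = (1/(2*\<i>)) * torus_char ?a x + (-1/(2*\<i>)) * torus_char (- ?a) x" for x :: "'n torus"
    by (auto simp: torus_char_def circles_def inner_axis complex_eq_iff inner_commute[of "axis _ _"] Re_divide Im_divide)
  show "trig_poly (\<lambda>x. complex_of_real (Re (circles (rep_torus x) $ i)))"
    unfolding 1 by (intro trig_poly.intros a b)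
  show "trig_poly (\<lambda>x. complex_of_real (Im (circles (rep_torus x) $ i)))"
    unfolding 2 by (intro trig_poly.intros a b)
qed

text \<open>Trigonometric polynomials approximate \<phi> uniformly on the compact image of the
  torus, and the error is controlled by the integral of \<open>norm (g x)\<close>.\<close>

lemma fourier_zero_continuous:
  fixes g :: "('n::finite) torus \<Rightarrow> complex" and \<phi> :: "complex ^ 'n \<Rightarrow> real"
  assumes g: "integrable torus_lebesgue g" and 0: "\<And>\<xi>. \<xi> \<in> int_vecs \<Longrightarrow> fourier g \<xi> = 0"
    and \<phi>: "continuous_on UNIV \<phi>"
  shows "(\<integral>x. g x * complex_of_real (\<phi> (circles (rep_torus x))) \<partial>torus_lebesgue) = 0"
proof -
  let ?S = "circles ` cbox 0 1 :: (complex ^ 'n) set"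
  let ?C = "\<lambda>x :: 'n torus. circles (rep_torus x)"
  let ?P = "\<lambda>f. continuous_on ?S f \<and> trig_poly (\<lambda>x :: 'n torus. complex_of_real (f (?C x)))"
  have cS: "compact ?S" by (intro compact_continuous_image continuous_on_circles compact_cbox)
  have meas: "(\<lambda>x. complex_of_real (f (?C x))) \<in> borel_measurable torus_lebesgue" if "continuous_on ?S f" for f
  proof (rule borel_measurable_torus_continuous)
    show "continuous_on UNIV (\<lambda>p. complex_of_real (f (circles (rep_torus (to_torus p)))))"
      unfolding circles_rep_torus
      by (intro continuous_on_of_real continuous_on_compose2[OF that] continuous_on_circles) (use circles_in_compact in auto)
  qed
  have S\<phi>: "continuous_on ?S \<phi>" using \<phi> continuous_on_subset by blast
  have approx: "\<exists>f. ?P f \<and> (\<forall>z\<in>?S. \<bar>\<phi> z - f z\<bar> < e)" if "e > 0" for e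
  proof (rule Stone_Weierstrass_HOL[where P = ?P])
    show "\<exists>f. ?P f \<and> f x \<noteq> f y" if xy: "x \<in> ?S \<and> y \<in> ?S \<and> x \<noteq> y" for x y
    proof -
      obtain i where "x $ i \<noteq> y $ i" using xy unfolding vec_eq_iff by blast
      then consider "Re (x $ i) \<noteq> Re (y $ i)" | "Im (x $ i) \<noteq> Im (y $ i)" by (auto simp: complex_eq_iff)
      then show ?thesis
      proof cases
        case 1
        then show ?thesis by (intro exI[of _ "\<lambda>z. Re (z $ i)"]) (auto intro!: trig_poly_circles continuous_intros)
      next
        case 2
        then show ?thesis by (intro exI[of _ "\<lambda>z. Im (z $ i)"]) (auto intro!: trig_poly_circles continuous_intros)
      qed
    qed
  qed (use cS S\<phi> that in \<open>auto intro: trig_poly_const continuous_intros trig_poly.add trig_poly_mult\<close>)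
  define I where "I = (\<integral>x. g x * complex_of_real (\<phi> (?C x)) \<partial>torus_lebesgue)"
  define N where "N = (\<integral>x. norm (g x) \<partial>torus_lebesgue)"
  have N: "N \<ge> 0" unfolding N_def by simp
  obtain B where B: "\<And>z. z \<in> ?S \<Longrightarrow> norm (\<phi> z) \<le> B"
    using compact_imp_bounded[OF compact_continuous_image[OF S\<phi> cS]] by (auto simp: bounded_iff)
  have "norm I \<le> 0 + e" if "e > 0" for e
  proof -
    \<comment> \<open>Adding 1 keeps the tolerance positive when N = 0.\<close>
    have "e / (N + 1) > 0" using that N by simp
    from approx[OF this] obtain f where f: "continuous_on ?S f" "trig_poly (\<lambda>x. complex_of_real (f (?C x)))"
      and fe: "\<And>z. z \<in> ?S \<Longrightarrow> \<bar>\<phi> z - f z\<bar> < e / (N + 1)" by blast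
    have i1: "integrable torus_lebesgue (\<lambda>x. g x * complex_of_real (\<phi> (?C x)))"
      by (intro integrable_mult_bounded[OF g meas[OF S\<phi>], of B]) (simp add: B[unfolded real_norm_def] circles_in_compact)
    have i2: "integrable torus_lebesgue (\<lambda>x. g x * complex_of_real (f (?C x)))"
      using trig_poly_bounded_measurable[OF f(2)] integrable_mult_bounded[OF g] by blast
    have "I = (\<integral>x. g x * complex_of_real (\<phi> (?C x)) - g x * complex_of_real (f (?C x)) \<partial>torus_lebesgue)"
      unfolding I_def using i1 i2 integral_trig_poly_eq_0[OF f(2) g 0] by simp
    also have "norm \<dots> \<le> (\<integral>x. norm (g x * complex_of_real (\<phi> (?C x)) - g x * complex_of_real (f (?C x))) \<partial>torus_lebesgue)"
      by (rule integral_norm_bound)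
    also have "\<dots> \<le> (\<integral>x. norm (g x) * (e / (N + 1)) \<partial>torus_lebesgue)"
    proof (rule integral_mono)
      fix x :: "'n torus"
      have "norm (g x * complex_of_real (\<phi> (?C x)) - g x * complex_of_real (f (?C x))) = norm (g x) * \<bar>\<phi> (?C x) - f (?C x)\<bar>"
        by (simp flip: of_real_diff right_diff_distrib add: norm_mult)
      also have "\<dots> \<le> norm (g x) * (e / (N + 1))" using fe[OF circles_in_compact] by (intro mult_left_mono) (auto simp: less_imp_le)
      finally show "norm (g x * complex_of_real (\<phi> (?C x)) - g x * complex_of_real (f (?C x))) \<le> norm (g x) * (e / (N + 1))" .
    qed (use i1 i2 g in auto)
    also have "\<dots> = N * (e / (N + 1))" by (simp add: N_def)
    also have "\<dots> \<le> e" using N that by (simp add: field_simps)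
    finally show ?thesis by simp
  qed
  then have "norm I \<le> 0" by (rule field_le_epsilon)
  then show ?thesis by (simp add: I_def)
qed

text \<open>Piecewise linear cutoffs of the distance to C decrease to its indicator, and dominated
  convergence passes to the limit. Nonemptiness of C matters because \<open>infdist\<close> to the
  empty set is 0.\<close>

lemma fourier_zero_closed:
  fixes g :: "('n::finite) torus \<Rightarrow> complex" and C :: "(complex ^ 'n) set"
  assumes g: "integrable torus_lebesgue g" and 0: "\<And>\<xi>. \<xi> \<in> int_vecs \<Longrightarrow> fourier g \<xi> = 0"
    and C: "closed C" "C \<noteq> {}"
  shows "(\<integral>x. g x * indicator {x. circles (rep_torus x) \<in> C} x \<partial>torus_lebesgue) = 0"
proof -
  define \<phi> where "\<phi> m z = max 0 (1 - real m * infdist z C)" for m z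
  have c\<phi>: "continuous_on A (\<phi> m)" for A m
    unfolding \<phi>_def by (intro continuous_intros)
  have meas: "(\<lambda>x. complex_of_real (\<phi> m (circles (rep_torus x)))) \<in> borel_measurable torus_lebesgue" for m
    by (intro borel_measurable_torus_continuous, unfold circles_rep_torus)
      (intro continuous_on_of_real continuous_on_compose2[OF c\<phi>[of UNIV]] continuous_on_circles subset_UNIV)
  have lim: "(\<lambda>m. complex_of_real (\<phi> m z)) \<longlonglongrightarrow> indicator C z" for z
  proof (cases "z \<in> C")
    case True
    then show ?thesis by (simp add: \<phi>_def)
  next
    case False
    then have pos: "infdist z C > 0" using C in_closed_iff_infdist_zero infdist_pos_not_in_closed by blast
    then obtain m0 :: nat where m0: "1 < real m0 * infdist z C" using reals_Archimedean3 by blast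
    have "\<phi> m z = 0" if "m \<ge> m0" for m
    proof -
      have "real m0 * infdist z C \<le> real m * infdist z C" using that pos by simp
      then show ?thesis using m0 by (simp add: \<phi>_def)
    qed
    then have "eventually (\<lambda>m. complex_of_real (\<phi> m z) = 0) sequentially"
      by (intro eventually_sequentiallyI[of m0]) simp
    then show ?thesis using False by (simp add: tendsto_eventually)
  qed
  have meas2: "(\<lambda>x. complex_of_real (indicator {x. circles (rep_torus x) \<in> C} x)) \<in> borel_measurable torus_lebesgue"
  proof (rule borel_measurable_LIMSEQ_metric[OF meas])
    show "(\<lambda>m. complex_of_real (\<phi> m (circles (rep_torus x)))) \<longlonglongrightarrow> complex_of_real (indicator {x. circles (rep_torus x) \<in> C} x)" for x :: "'n torus"
      using lim[of "circles (rep_torus x)"] by (cases "circles (rep_torus x) \<in> C") simp_all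
  qed
  then have meas2: "(indicator {x. circles (rep_torus x) \<in> C} :: 'n torus \<Rightarrow> complex) \<in> borel_measurable torus_lebesgue"
    by (simp add: of_real_indicator)
  have "(\<lambda>m. \<integral>x. g x * complex_of_real (\<phi> m (circles (rep_torus x))) \<partial>torus_lebesgue)
     \<longlonglongrightarrow> (\<integral>x. g x * indicator {x. circles (rep_torus x) \<in> C} x \<partial>torus_lebesgue)"
  proof (rule integral_dominated_convergence[where w = "\<lambda>x. norm (g x)"])
    show "AE x in torus_lebesgue. (\<lambda>m. g x * complex_of_real (\<phi> m (circles (rep_torus x)))) \<longlonglongrightarrow> g x * indicator {x. circles (rep_torus x) \<in> C} x"
      using tendsto_mult[OF tendsto_const lim] by (auto simp: indicator_def)
    have "\<bar>\<phi> m z\<bar> \<le> 1" for m z by (auto simp: \<phi>_def infdist_nonneg)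
    then show "AE x in torus_lebesgue. norm (g x * complex_of_real (\<phi> m (circles (rep_torus x)))) \<le> norm (g x)" for m
      by (simp add: norm_mult mult_left_le)
  qed (use g meas meas2 in \<open>auto intro!: borel_measurable_times\<close>)
  moreover have "(\<integral>x. g x * complex_of_real (\<phi> m (circles (rep_torus x))) \<partial>torus_lebesgue) = 0" for m
    by (rule fourier_zero_continuous[OF g 0 c\<phi>])
  ultimately show ?thesis by (simp add: LIMSEQ_const_iff)
qed

text \<open>If h were positive on a set of positive measure, inner regularity would give a closed
  set of positive measure there; its image under \<open>circles\<close> is an admissible C for which
  the integral is positive.\<close>

lemma AE_nonpos_if_closed_integrals_zero:
  fixes h :: "('n::finite) torus \<Rightarrow> real"
  assumes h: "integrable torus_lebesgue h"
    and 0: "\<And>C. closed C \<Longrightarrow> C \<noteq> {} \<Longrightarrow> (\<integral>x. h x * indicator {x. circles (rep_torus x) \<in> C} x \<partial>torus_lebesgue) = 0"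
  shows "AE x in torus_lebesgue. h x \<le> 0"
proof (rule ccontr)
  assume neg: "\<not> ?thesis"
  define D where "D = {x. h x > 0}"
  have [measurable]: "h \<in> borel_measurable torus_lebesgue"
    using h by (rule borel_measurable_integrable)
  have "{x \<in> space torus_lebesgue. 0 < h x} \<in> sets torus_lebesgue" by measurable
  then have D: "D \<in> sets torus_lebesgue" by (simp add: D_def)
  define L where "L = to_torus -` D \<inter> unit_cube"
  have L: "L \<in> sets lebesgue" using D unit_cube_sets by (auto simp: L_def sets_torus_lebesgue)
  have "L \<subseteq> unit_cube" by (simp add: L_def)
  from emeasure_mono[OF this unit_cube_sets] have Lb: "emeasure lebesgue L \<le> 1"
    by (simp only: emeasure_unit_cube)
  have "emeasure torus_lebesgue D \<noteq> 0"
  proof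
    assume "emeasure torus_lebesgue D = 0"
    then have "D \<in> null_sets torus_lebesgue" using D by auto
    then have "AE x in torus_lebesgue. x \<notin> D" by (rule AE_not_in)
    then show False using neg by (simp add: D_def not_less)
  qed
  then have Lpos: "emeasure lebesgue L > 0" using emeasure_torus_lebesgue[OF D] by (simp add: L_def zero_less_iff_neq_zero)
  have Lfin: "emeasure lebesgue L = ennreal (measure lebesgue L)"
    using Lb by (intro emeasure_eq_ennreal_measure) (auto simp: top_unique)
  then have "measure lebesgue L > 0" using Lpos by simp
  \<comment> \<open>The permitted loss is the whole measure of L, which is enough to keep T from
    being null.\<close>
  from sets_lebesgue_inner_closed[OF L this] obtain T where T: "closed T" "T \<subseteq> L" "L - T \<in> lmeasurable"
    "emeasure lebesgue (L - T) < ennreal (measure lebesgue L)" by blast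
  have Ts: "T \<in> sets lebesgue" using T(1) by simp
  have Tpos: "emeasure lebesgue T \<noteq> 0"
  proof
    assume "emeasure lebesgue T = 0"
    then have "emeasure lebesgue (L - T) = emeasure lebesgue L"
      by (intro emeasure_Diff_null_set) (use Ts L in auto)
    then show False using T(4) Lfin by simp
  qed
  then have Tne: "T \<noteq> {}" by auto
  have Tc: "T \<subseteq> unit_cube" using T(2) by (auto simp: L_def)
  have "compact T" using T(1) Tc unit_cube_between(2) bounded_cbox
    by (metis bounded_subset compact_eq_bounded_closed)
  then have cC: "closed (circles ` T)"
    by (intro compact_imp_closed compact_continuous_image continuous_on_circles)
  define X where "X = {x. circles (rep_torus x) \<in> circles ` T}"
  have X_iff: "x \<in> X \<longleftrightarrow> x \<in> to_torus ` T" for x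
  proof -
    have "x \<in> X \<longleftrightarrow> (\<exists>q\<in>T. rep_torus x - q \<in> int_vecs)"
      by (auto simp: X_def circles_eq_iff image_iff)
    also have "\<dots> \<longleftrightarrow> x \<in> to_torus ` T"
      by (auto simp: image_iff simp flip: to_torus_eq_iff)
    finally show ?thesis .
  qed
  \<comment> \<open>T lies in the half-open cube, so passing to the torus and back adds no point of
    the cube.\<close>
  have Xc: "to_torus -` X \<inter> unit_cube = T"
  proof -
    have "x \<in> T" if "x \<in> unit_cube" "y \<in> T" "x - y \<in> int_vecs" for x y
      using unit_cube_unique[OF that(1) subsetD[OF Tc that(2)] that(3)] that(2) by simp
    then show ?thesis using Tc by (auto simp: X_iff to_torus_eq_iff)
  qed
  have Xs: "X \<in> sets torus_lebesgue"
    unfolding sets_torus_lebesgue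
  proof -
    have "to_torus -` X = circles -` (circles ` T)"
      by (auto simp: X_def circles_rep_torus)
    also have "closed \<dots>" by (rule closed_vimage[OF cC continuous_on_circles])
    finally show "to_torus -` X \<in> sets lebesgue" by simp
  qed
  have hp: "h x > 0" if "x \<in> X" for x
    using that T(2) by (auto simp: X_iff L_def D_def)
  have i: "integrable torus_lebesgue (\<lambda>x. h x * indicator X x)"
    using h Xs by (rule integrable_real_mult_indicator[rotated])
  have "(\<integral>x. h x * indicator X x \<partial>torus_lebesgue) = 0"
    unfolding X_def using cC Tne by (intro 0) auto
  then have "AE x in torus_lebesgue. h x * indicator X x = 0"
    using integral_nonneg_eq_0_iff_AE[OF i] hp by (auto simp: indicator_def less_imp_le)
  then have "AE x in torus_lebesgue. x \<notin> X"
    by eventually_elim (use hp in \<open>force simp: indicator_def\<close>)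
  then have "emeasure torus_lebesgue X = 0"
    using Xs by (simp add: AE_iff_measurable[OF Xs])
  then show False using emeasure_torus_lebesgue[OF Xs] Xc Tpos by simp
qed

theorem fourier_unique:
  fixes g :: "('n::finite) torus \<Rightarrow> complex"
  assumes g: "integrable torus_lebesgue g" and 0: "\<And>\<xi>. \<xi> \<in> int_vecs \<Longrightarrow> fourier g \<xi> = 0"
  shows "AE x in torus_lebesgue. g x = 0"
proof -
  have real: "AE x in torus_lebesgue. h x \<le> 0"
    if h: "h = (\<lambda>x. Re (c * g x))" for h and c :: complex
  proof (rule AE_nonpos_if_closed_integrals_zero)
    show "integrable torus_lebesgue h" using g unfolding h by simp
    fix C :: "(complex ^ 'n) set" assume "closed C" "C \<noteq> {}"
    let ?X = "{x. circles (rep_torus x) \<in> C} :: 'n torus set"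
    note z = fourier_zero_closed[OF g 0 \<open>closed C\<close> \<open>C \<noteq> {}\<close>]
    have "closed (circles -` C :: (real ^ 'n) set)"
      by (rule closed_vimage[OF \<open>closed C\<close> continuous_on_circles])
    moreover have "to_torus -` ?X = circles -` C" by (auto simp: circles_rep_torus)
    ultimately have "?X \<in> sets torus_lebesgue" by (simp add: sets_torus_lebesgue)
    then have i: "integrable torus_lebesgue (\<lambda>x. g x * indicator ?X x)"
    proof -
      have "(\<lambda>x. g x * indicator ?X x) = (\<lambda>x. indicator ?X x *\<^sub>R g x)" by (auto simp: indicator_def)
      then show ?thesis using integrable_mult_indicator[OF \<open>?X \<in> _\<close> g] by simp
    qed
    have "(\<integral>x. h x * indicator ?X x \<partial>torus_lebesgue) = (\<integral>x. Re (c * (g x * indicator ?X x)) \<partial>torus_lebesgue)"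
      unfolding h by (intro Bochner_Integration.integral_cong) (auto simp: indicator_def)
    also have "\<dots> = Re (c * (\<integral>x. g x * indicator ?X x \<partial>torus_lebesgue))"
      using i by (subst integral_Re) auto
    finally show "(\<integral>x. h x * indicator ?X x \<partial>torus_lebesgue) = 0" using z by simp
  qed
  \<comment> \<open>The four rotations bound the real and the imaginary part from both
    sides.\<close>
  have "AE x in torus_lebesgue. Re (1 * g x) \<le> 0 \<and> Re (- 1 * g x) \<le> 0 \<and> Re (\<i> * g x) \<le> 0 \<and> Re (- \<i> * g x) \<le> 0"
    by (intro AE_conjI real[OF refl])
  then show ?thesis by eventually_elim (simp add: complex_eq_iff)
qed

section \<open>Calculus of Fourier coefficients and invariance under shifts\<close>

lemma integrable_fourier:
  fixes g :: "('n::finite) torus \<Rightarrow> complex"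
  assumes "integrable torus_lebesgue g" "\<xi> \<in> int_vecs"
  shows "integrable torus_lebesgue (\<lambda>x. g x * torus_char \<xi> x)"
  using assms by (intro integrable_mult_bounded[where B = 1] torus_char_measurable) auto

lemma fourier_diff:
  assumes "integrable torus_lebesgue g" "integrable torus_lebesgue h" "\<xi> \<in> int_vecs"
  shows "fourier (\<lambda>x. g x - h x) \<xi> = fourier g \<xi> - fourier h \<xi>"
  using assms by (simp add: fourier_def left_diff_distrib integrable_fourier)

lemma fourier_cmult: "fourier (\<lambda>x. c * g x) \<xi> = c * fourier g \<xi>"
  by (simp add: fourier_def mult.assoc)

lemma fourier_sum:
  assumes "\<And>i. i \<in> I \<Longrightarrow> integrable torus_lebesgue (g i)" "\<xi> \<in> int_vecs"
  shows "fourier (\<lambda>x. \<Sum>i\<in>I. g i x) \<xi> = (\<Sum>i\<in>I. fourier (g i) \<xi>)"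
  using assms by (simp add: fourier_def sum_distrib_right integrable_fourier)

lemma fourier_0: "fourier g 0 = integral\<^sup>L torus_lebesgue g"
  by (simp add: fourier_def)

lemma fourier_cong_AE:
  assumes "integrable torus_lebesgue g" "integrable torus_lebesgue h" "\<xi> \<in> int_vecs"
    and "AE x in torus_lebesgue. g x = h x"
  shows "fourier g \<xi> = fourier h \<xi>"
  unfolding fourier_def using assms
  by (intro integral_cong_AE borel_measurable_integrable integrable_fourier) auto

lemma integrable_torus_shift_diff:
  fixes g :: "('n::finite) torus \<Rightarrow> 'b::{banach, second_countable_topology}"
  assumes "integrable torus_lebesgue g"
  shows "integrable torus_lebesgue (\<lambda>x. g (x - a))"
proof (rule integrable_distr[OF measurable_torus_shift_diff])
  show "integrable (distr torus_lebesgue torus_lebesgue (\<lambda>x. x - a)) g"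
    using assms distr_torus_shift[of "- a"] by simp
qed

lemma fourier_shift:
  assumes "integrable torus_lebesgue g" "\<xi> \<in> int_vecs"
  shows "fourier (\<lambda>x. g (x - a)) \<xi> = torus_char \<xi> a * fourier g \<xi>"
proof -
  let ?h = "\<lambda>x. g x * torus_char \<xi> (x + a)"
  have h: "?h = (\<lambda>x. torus_char \<xi> a * (g x * torus_char \<xi> x))"
    by (simp add: torus_char_add assms ac_simps)
  have "?h \<in> borel_measurable torus_lebesgue"
    unfolding h by (intro borel_measurable_const borel_measurable_times borel_measurable_integrable[OF assms(1)] torus_char_measurable assms(2))
  from integral_torus_shift_diff[OF this, of a] show ?thesis
    by (simp add: fourier_def h[unfolded fun_eq_iff])
qed

lemma fourier_const:
  fixes \<xi> :: "real ^ 'n::finite"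
  assumes "\<xi> \<in> int_vecs" "\<xi> \<noteq> 0"
  shows "fourier (\<lambda>x. c) \<xi> = 0"
proof -
  \<comment> \<open>This shift is a half turn for \<xi>, so the coefficient equals its own
    negative.\<close>
  have "torus_char \<xi> (to_torus ((1 / (2 * (\<xi> \<bullet> \<xi>))) *\<^sub>R \<xi>)) = -1"
    using assms by (simp add: torus_char_to_torus)
  from fourier_shift[of "\<lambda>x. c" \<xi> "to_torus ((1 / (2 * (\<xi> \<bullet> \<xi>))) *\<^sub>R \<xi>)", unfolded this]
  show ?thesis using assms by simp
qed

lemma AE_eq_if_fourier_eq:
  assumes "integrable torus_lebesgue g" "integrable torus_lebesgue h"
    and "\<And>\<xi>. \<xi> \<in> int_vecs \<Longrightarrow> fourier g \<xi> = fourier h \<xi>"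
  shows "AE x in torus_lebesgue. g x = h x"
  using fourier_unique[of "\<lambda>x. g x - h x"] assms by (simp add: fourier_diff)

lemma AE_const_if_fourier_0:
  assumes "integrable torus_lebesgue g"
    and "\<And>\<xi>. \<xi> \<in> int_vecs \<Longrightarrow> \<xi> \<noteq> 0 \<Longrightarrow> fourier g \<xi> = 0"
  shows "AE x in torus_lebesgue. g x = integral\<^sup>L torus_lebesgue g"
proof (rule AE_eq_if_fourier_eq)
  fix \<xi> :: "real ^ 'a" assume "\<xi> \<in> int_vecs"
  then show "fourier g \<xi> = fourier (\<lambda>x. integral\<^sup>L torus_lebesgue g) \<xi>"
    using assms fourier_const by (cases "\<xi> = 0") (auto simp: fourier_0 torus.prob_space[simplified])
qed (use assms in auto)

lemma fourier_0_if_shift_invariant: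
  assumes "integrable torus_lebesgue g" "\<xi> \<in> int_vecs"
    and "AE x in torus_lebesgue. g (x - a) = g x" "torus_char \<xi> a \<noteq> 1"
  shows "fourier g \<xi> = 0"
  using fourier_cong_AE[OF _ assms(1,2,3)] fourier_shift[OF assms(1,2), of a] assms
  by (simp add: integrable_torus_shift_diff)

lemma shift_invariant_if_fourier:
  assumes "integrable torus_lebesgue g"
    and "\<And>\<xi>. \<xi> \<in> int_vecs \<Longrightarrow> fourier g \<xi> \<noteq> 0 \<Longrightarrow> torus_char \<xi> a = 1"
  shows "AE x in torus_lebesgue. g (x - a) = g x"
  using assms by (intro AE_eq_if_fourier_eq integrable_torus_shift_diff) (auto simp: fourier_shift)

lemma exists_rat_mult_not_int:
  assumes "r \<noteq> (0::real)"
  obtains q where "q \<in> \<rat>" "q * r \<notin> \<int>"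
proof -
  obtain q where q: "q \<in> \<rat>" "0 < q" "q < 1 / \<bar>r\<bar>"
    using Rats_dense_in_real[of 0 "1 / \<bar>r\<bar>"] assms by auto
  then have "0 < \<bar>q * r\<bar>" "\<bar>q * r\<bar> < 1" using assms by (auto simp: abs_mult field_simps)
  then have "q * r \<notin> \<int>" using Ints_nonzero_abs_less1 by force
  with q that show thesis by blast
qed

text \<open>Rational shifts suffice: some rational multiple of the nonzero number
  \<open>\<xi> \<bullet> v\<close> is not an integer, and that shift multiplies the coefficient by a
  number other than 1.\<close>

lemma fourier_0_if_rat_line_invariant:
  fixes g :: "('n::finite) torus \<Rightarrow> complex"
  assumes "integrable torus_lebesgue g" "\<xi> \<in> int_vecs"
    and inv: "\<And>q. q \<in> \<rat> \<Longrightarrow> AE x in torus_lebesgue. g (x - to_torus (q *\<^sub>R v)) = g x"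
    and "\<xi> \<bullet> v \<noteq> 0"
  shows "fourier g \<xi> = 0"
proof -
  obtain q where "q \<in> \<rat>" "q * (\<xi> \<bullet> v) \<notin> \<int>" using exists_rat_mult_not_int assms(4) by blast
  then show ?thesis using assms
    by (intro fourier_0_if_shift_invariant[OF assms(1,2) inv]) (auto simp: torus_char_to_torus cis_2pi_eq_1_iff)
qed

lemma AE_const_if_shift_invariant:
  fixes g :: "('n::finite) torus \<Rightarrow> complex"
  assumes "integrable torus_lebesgue g"
    and inv: "\<And>h. AE x in torus_lebesgue. g (x - to_torus h) = g x"
  shows "AE x in torus_lebesgue. g x = integral\<^sup>L torus_lebesgue g"
proof (rule AE_const_if_fourier_0[OF assms(1)])
  show "fourier g \<xi> = 0" if "\<xi> \<in> int_vecs" "\<xi> \<noteq> 0" for \<xi>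
    by (rule fourier_0_if_rat_line_invariant[OF assms(1) that(1) inv, of \<xi>]) (use that in simp)
qed

subsection \<open>Dilation of tilings\<close>

text \<open>Convolution with the sum of the point masses at the \<open>c i\<close>. Integer values
  are kept so that congruences modulo a prime make sense pointwise.\<close>

definition shift_sum :: "('i \<Rightarrow> real ^ 'n) \<Rightarrow> 'i set \<Rightarrow> (('n::finite) torus \<Rightarrow> int) \<Rightarrow> 'n torus \<Rightarrow> int"
  where "shift_sum c I u = (\<lambda>x. \<Sum>i\<in>I. u (x - to_torus (c i)))"

text \<open>Pascal's rule, summed over the diagonal on which the two exponents add up to m +
  1.\<close>

lemma binomial_step:
  fixes T :: "nat \<Rightarrow> nat \<Rightarrow> int"
  shows "(\<Sum>k\<le>m. int (m choose k) * (T (Suc k) (m - k) + T k (Suc m - k))) =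
    (\<Sum>k\<le>Suc m. int (Suc m choose k) * T k (Suc m - k))"
proof -
  have "(\<Sum>k\<le>Suc m. int (Suc m choose k) * T k (Suc m - k)) =
      T 0 (Suc m) + (\<Sum>k\<le>m. int (m choose Suc k) * T (Suc k) (m - k)) + (\<Sum>k\<le>m. int (m choose k) * T (Suc k) (m - k))"
    by (subst sum.atMost_Suc_shift) (simp add: sum.distrib[symmetric] algebra_simps)
  also have "T 0 (Suc m) + (\<Sum>k\<le>m. int (m choose Suc k) * T (Suc k) (m - k)) =
      (\<Sum>k\<le>Suc m. int (m choose k) * T k (Suc m - k))"
    by (subst sum.atMost_Suc_shift) simp
  also have "\<dots> = (\<Sum>k\<le>m. int (m choose k) * T k (Suc m - k))" by simp
  finally show ?thesis by (simp add: sum.distrib distrib_left)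
qed

text \<open>The binomial theorem for two commuting operators, the translation by \<open>c j\<close>
  and \<open>shift_sum c I\<close>.\<close>

lemma shift_sum_insert_funpow:
  assumes "finite I" "j \<notin> I"
  shows "(shift_sum c (insert j I) ^^ m) u x =
    (\<Sum>k\<le>m. int (m choose k) * (shift_sum c I ^^ k) u (x - to_torus (real (m - k) *\<^sub>R c j)))"
proof (induction m arbitrary: x)
  case 0
  then show ?case by simp
next
  case (Suc m)
  let ?T = "\<lambda>k l. (shift_sum c I ^^ k) u (x - to_torus (real l *\<^sub>R c j))"
  have "(shift_sum c (insert j I) ^^ Suc m) u x =
      (\<Sum>i\<in>I. (shift_sum c (insert j I) ^^ m) u (x - to_torus (c i))) + (shift_sum c (insert j I) ^^ m) u (x - to_torus (c j))"
    using assms by (simp add: shift_sum_def)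
  also have "(\<Sum>i\<in>I. (shift_sum c (insert j I) ^^ m) u (x - to_torus (c i))) =
      (\<Sum>k\<le>m. int (m choose k) * ?T (Suc k) (m - k))"
    unfolding Suc.IH
    by (subst sum.swap) (simp add: sum_distrib_left[symmetric] shift_sum_def algebra_simps)
  also have "(shift_sum c (insert j I) ^^ m) u (x - to_torus (c j)) = (\<Sum>k\<le>m. int (m choose k) * ?T k (Suc m - k))"
    unfolding Suc.IH
  proof (intro sum.cong refl)
    fix k assume "k \<in> {..m}"
    then have "real (Suc m - k) *\<^sub>R c j = c j + real (m - k) *\<^sub>R c j"
      by (simp add: Suc_diff_le scaleR_add_left)
    then show "int (m choose k) * (shift_sum c I ^^ k) u (x - to_torus (c j) - to_torus (real (m - k) *\<^sub>R c j)) = int (m choose k) * ?T k (Suc m - k)"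
      by (simp add: to_torus_add diff_diff_eq)
  qed
  finally show ?case
    using binomial_step[of m ?T] by (simp add: sum.distrib distrib_left)
qed

text \<open>Induction on the number of translations; the inner binomial coefficients
  \<open>p choose k\<close> are divisible by p.\<close>

lemma shift_sum_funpow_prime:
  assumes p: "prime (p::nat)" and "finite I"
  shows "int p dvd (shift_sum c I ^^ p) u x - (\<Sum>i\<in>I. u (x - to_torus (real p *\<^sub>R c i)))"
  using assms(2)
proof (induction arbitrary: x)
  case empty
  obtain q where "p = Suc q" using p not0_implies_Suc prime_gt_0_nat by blast
  then show ?case by (simp add: shift_sum_def)
next
  case (insert j I)
  let ?t = "\<lambda>k. int (p choose k) * (shift_sum c I ^^ k) u (x - to_torus (real (p - k) *\<^sub>R c j))"
  have p0: "p > 0" using p prime_gt_0_nat by blast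
  have dvd: "int p dvd (\<Sum>k\<in>{..p} - {0, p}. ?t k)"
  proof (rule dvd_sum)
    fix k assume "k \<in> {..p} - {0, p}"
    then have "p dvd p choose k" using p by (intro dvd_choose_prime) auto
    then show "int p dvd ?t k" by (simp add: dvd_mult2)
  qed
  have "(shift_sum c (insert j I) ^^ p) u x = (\<Sum>k\<le>p. ?t k)"
    by (rule shift_sum_insert_funpow) (use insert in auto)
  also have "\<dots> = ?t 0 + ?t p + (\<Sum>k\<in>{..p} - {0, p}. ?t k)"
    using p0 by (subst sum.subset_diff[of "{0, p}"]) auto
  finally have "(shift_sum c (insert j I) ^^ p) u x - (\<Sum>i\<in>insert j I. u (x - to_torus (real p *\<^sub>R c i))) =
      ((shift_sum c I ^^ p) u x - (\<Sum>i\<in>I. u (x - to_torus (real p *\<^sub>R c i)))) + (\<Sum>k\<in>{..p} - {0, p}. ?t k)"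
    using insert by simp
  then show ?case using insert.IH[of x] dvd by simp
qed

lemma shift_sum_const_funpow:
  "(shift_sum c I ^^ m) (\<lambda>x. a) x = int (card I) ^ m * a"
  by (induction m arbitrary: x) (auto simp: shift_sum_def)

text \<open>Disjointness and covering in one identity. Counting is by index, so coinciding
  translates would count twice; that they are distinct becomes a consequence.\<close>

definition tile_family :: "('i \<Rightarrow> real ^ 'n) \<Rightarrow> 'i set \<Rightarrow> ('n::finite) torus set \<Rightarrow> bool"
  where "tile_family c I A \<longleftrightarrow> (AE x in torus_lebesgue. (\<Sum>i\<in>I. indicator A (x - to_torus (c i))) = (1 :: int))"

text \<open>The first convolution yields the constant 1, and each further one multiplies by the
  number of tiles.\<close>

lemma shift_sum_funpow_AE:
  assumes "tile_family c I A"
  shows "AE x in torus_lebesgue. (shift_sum c I ^^ Suc m) (indicator A) x = int (card I) ^ m"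
proof (induction m)
  case 0
  then show ?case using assms by (simp add: tile_family_def shift_sum_def)
next
  case (Suc m)
  have "AE x in torus_lebesgue. \<forall>i\<in>I. (shift_sum c I ^^ Suc m) (indicator A) (x - to_torus (c i)) = int (card I) ^ m"
    if "finite I" by (intro AE_finite_allI that AE_torus_shift_diff Suc)
  moreover have "finite I"
    using assms by (rule_tac ccontr) (simp add: tile_family_def)
  ultimately have "AE x in torus_lebesgue. \<forall>i\<in>I. (shift_sum c I ^^ Suc m) (indicator A) (x - to_torus (c i)) = int (card I) ^ m"
    by simp
  then show ?case
  proof eventually_elim
    case (elim x)
    have "(shift_sum c I ^^ Suc (Suc m)) (indicator A) x = (\<Sum>i\<in>I. (shift_sum c I ^^ Suc m) (indicator A) (x - to_torus (c i)))"
      by (subst funpow.simps(2)) (simp only: o_apply shift_sum_def)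
    then show ?case using elim by (simp del: funpow.simps)
  qed
qed

lemma tile_family_finite: "tile_family c I A \<Longrightarrow> finite I \<and> I \<noteq> {}"
  by (rule ccontr) (auto simp: tile_family_def)

text \<open>Dilation lemma: modulo a prime, the \<open>p\<close>-th power of a sum of translations is the sum of
  their \<open>p\<close>-th powers.\<close>

lemma tile_family_dilate_prime:
  assumes A: "tile_family c I A" and p: "prime p" "p > card I"
  shows "tile_family (\<lambda>i. real p *\<^sub>R c i) I A"
proof -
  have I: "finite I" "I \<noteq> {}" using tile_family_finite[OF A] by auto
  obtain q where q: "p = Suc q" using p by (cases p) auto
  let ?n = "card I"
  have n: "0 < ?n" using I by (simp add: card_gt_0_iff)
  \<comment> \<open>Fermat's little theorem, read off from the congruence for the constant function
    1.\<close>
  have "int p dvd int ?n ^ p - int ?n"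
    using shift_sum_funpow_prime[OF p(1) I(1), where c = c and u = "\<lambda>x. 1" and x = 0]
    by (simp add: shift_sum_const_funpow)
  then have "int p dvd int ?n * (int ?n ^ q - 1)" by (simp add: q algebra_simps)
  moreover have "\<not> int p dvd int ?n" using nat_dvd_not_less[OF n p(2)] by simp
  ultimately have pn: "int p dvd int ?n ^ q - 1" using p(1) prime_dvd_mult_iff[of "int p"] by simp
  show ?thesis
    unfolding tile_family_def using shift_sum_funpow_AE[OF A, of q]
  proof eventually_elim
    case (elim x)
    let ?s = "\<Sum>i\<in>I. indicator A (x - to_torus (real p *\<^sub>R c i)) :: int"
    have "int p dvd int ?n ^ q - ?s"
      using shift_sum_funpow_prime[OF p(1) I(1), where c = c and u = "indicator A" and x = x] elim by (simp add: q)
    have arith: "X - 1 - (X - s) = s - 1" for X s :: int by simp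
    \<comment> \<open>The sum counts at most \<open>card I\<close> < p indices, so being 1 modulo p
      it can only be 1.\<close>
    have sp: "int p dvd ?s - 1"
      using dvd_diff[OF pn \<open>int p dvd int ?n ^ q - ?s\<close>] unfolding arith .
    moreover have "0 \<le> ?s" by (intro sum_nonneg) (simp add: indicator_def)
    moreover have "?s \<le> int ?n"
      using sum_bounded_above[of I "\<lambda>i. indicator A (x - to_torus (real p *\<^sub>R c i)) :: int" 1] by (simp add: indicator_def)
    moreover have "p \<ge> 2" using p(1) prime_ge_2_nat by blast
    ultimately show ?case
    proof (cases "?s = 0")
      case True
      then have "p dvd 1" using sp unfolding True diff_0 dvd_minus_iff by simp
      then show ?thesis using p(1) by simp
    next
      case False
      then have "?s - 1 < int p" "0 \<le> ?s - 1" using \<open>0 \<le> ?s\<close> \<open>?s \<le> int ?n\<close> p(2) by linarith+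
      then have "?s - 1 = 0" using sp zdvd_not_zless[of "?s - 1" "int p"] by linarith
      then show ?thesis by simp
    qed
  qed
qed

lemma tile_family_dilate:
  assumes A: "tile_family c I A" and "r > 0" "\<And>p. prime p \<Longrightarrow> p dvd r \<Longrightarrow> p > card I"
  shows "tile_family (\<lambda>i. real r *\<^sub>R c i) I A"
  using assms(2,3)
proof (induction r rule: less_induct)
  case (less r)
  show ?case
  proof (cases "r = 1")
    case True
    then show ?thesis using A by simp
  next
    case False
    then obtain p where p: "prime p" "p dvd r" using prime_factor_nat by blast
    then obtain s where s: "r = p * s" by (auto elim: dvdE)
    have "s > 0" "s < r" using s less.prems prime_gt_1_nat[OF p(1)] by auto
    then have "tile_family (\<lambda>i. real s *\<^sub>R c i) I A" using s less by auto
    from tile_family_dilate_prime[OF this p(1)] less.prems(2)[OF p] s show ?thesis by simp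
  qed
qed

text \<open>No prime up to \<open>card I\<close> divides one of these factors. They are chosen in
  arithmetic progression because the phases then enter as consecutive powers.\<close>

lemma tile_family_dilate_fact:
  assumes "tile_family c I A"
  shows "tile_family (\<lambda>i. (1 + real k * fact (card I)) *\<^sub>R c i) I A"
proof -
  have "tile_family (\<lambda>i. real (1 + k * fact (card I)) *\<^sub>R c i) I A"
  proof (rule tile_family_dilate[OF assms])
    fix p :: nat assume p: "prime p" "p dvd 1 + k * fact (card I)"
    show "p > card I"
    proof (rule ccontr)
      assume "\<not> ?thesis"
      then have "p dvd fact (card I)" using p(1) by (simp add: prime_dvd_fact_iff)
      then have "p dvd k * fact (card I)" by simp
      then have "p dvd 1" using p(2) dvd_add_left_iff by blast
      then show False using p(1) by simp
    qed
  qed simp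
  then show ?thesis by simp
qed

subsection \<open>Vanishing power sums and the rational tiling\<close>

text \<open>Testing against the polynomial that vanishes at every value of w except c isolates this
  level set; its degree is below the number of available power sums.\<close>

lemma power_sums_zero_class:
  fixes z w :: "'i \<Rightarrow> complex"
  assumes "finite I" and 0: "\<And>k. k < card I \<Longrightarrow> (\<Sum>i\<in>I. z i * w i ^ k) = 0"
  shows "(\<Sum>i | i \<in> I \<and> w i = c. z i) = 0"
proof (cases "c \<in> w ` I")
  case False
  then have e: "{i. i \<in> I \<and> w i = c} = {}" by auto
  show ?thesis by (simp only: e sum.empty)
next
  case True
  let ?W = "w ` I - {c}"
  define p where "p = (\<Prod>a\<in>?W. [:- a, 1:])"
  have p_poly: "poly p b = (\<Prod>a\<in>?W. b - a)" for b by (simp add: p_def poly_prod)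
  have fin: "finite ?W" using assms(1) by simp
  have "degree p \<le> card ?W"
    unfolding p_def using degree_prod_sum_le[OF fin, of "\<lambda>a. [:- a, 1:]"] by simp
  also have "card ?W < card (w ` I)" using True assms(1) by (intro psubset_card_mono) auto
  also have "\<dots> \<le> card I" using assms(1) by (rule card_image_le)
  finally have deg: "degree p < card I" .
  have "(\<Sum>i\<in>I. z i * poly p (w i)) = (\<Sum>i\<in>I. \<Sum>k\<le>degree p. coeff p k * (z i * w i ^ k))"
    by (simp add: poly_altdef sum_distrib_left ac_simps)
  also have "\<dots> = (\<Sum>k\<le>degree p. coeff p k * (\<Sum>i\<in>I. z i * w i ^ k))"
    by (subst sum.swap) (simp add: sum_distrib_left)
  also have "\<dots> = 0" using deg 0 by simp
  finally have "0 = (\<Sum>i\<in>I. z i * poly p (w i))" by simp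
  also have "\<dots> = (\<Sum>i | i \<in> I \<and> w i = c. z i * poly p (w i))"
    using assms(1) fin by (intro sum.mono_neutral_right) (auto simp: p_poly)
  also have "\<dots> = (\<Sum>i | i \<in> I \<and> w i = c. z i) * poly p c"
    by (simp add: sum_distrib_right)
  finally show ?thesis using fin by (simp add: p_poly)
qed

text \<open>A weight that depends on \<open>w i\<close> only is a combination of indicators of level
  sets of w.\<close>

lemma power_sums_zero_weighted:
  fixes z w g :: "'i \<Rightarrow> complex"
  assumes "finite I" and 0: "\<And>k. k < card I \<Longrightarrow> (\<Sum>i\<in>I. z i * w i ^ k) = 0"
    and g: "\<And>i j. i \<in> I \<Longrightarrow> j \<in> I \<Longrightarrow> w i = w j \<Longrightarrow> g i = g j"
  shows "(\<Sum>i\<in>I. z i * g i) = 0"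
proof -
  have "(\<Sum>i\<in>I. z i * g i) = (\<Sum>c\<in>w ` I. \<Sum>i | i \<in> I \<and> w i = c. z i * g i)"
    using assms(1) by (rule sum.image_gen)
  also have "\<dots> = 0"
  proof (rule sum.neutral, rule ballI)
    fix c assume "c \<in> w ` I"
    then obtain j where j: "j \<in> I" "c = w j" by auto
    then have "z i * g i = z i * g j" if "i \<in> {i. i \<in> I \<and> w i = c}" for i
      using g[of i j] that by simp
    then have "(\<Sum>i | i \<in> I \<and> w i = c. z i * g i) = (\<Sum>i | i \<in> I \<and> w i = c. z i * g j)"
      by (rule sum.cong[OF refl])
    also have "\<dots> = (\<Sum>i | i \<in> I \<and> w i = c. z i) * g j" by (rule sum_distrib_right[symmetric])
    also have "\<dots> = 0" using power_sums_zero_class[OF assms(1,2), of c] by simp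
    finally show "(\<Sum>i | i \<in> I \<and> w i = c. z i * g i) = 0" .
  qed
  finally show ?thesis .
qed

text \<open>A Hamel basis argument: over the rationals, {1} is independent in the reals, so there is
  a rational-valued linear functional with value 1 at 1.\<close>

lemma exists_rat_linear_retraction:
  "\<exists>\<pi> :: real \<Rightarrow> real. (\<forall>x y. \<pi> (x + y) = \<pi> x + \<pi> y) \<and> (\<forall>q\<in>\<rat>. \<forall>x. \<pi> (q * x) = q * \<pi> x) \<and>
     range \<pi> \<subseteq> \<rat> \<and> \<pi> 1 = 1"
proof -
  interpret V: vector_space_pair "\<lambda>(q::rat) (x::real). of_rat q * x" "\<lambda>(q::rat) (x::rat). q * x"
    by unfold_locales (auto simp: algebra_simps of_rat_add of_rat_mult)
  have "V.vs1.independent {1}" by (simp add: V.vs1.dependent_single)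
  from V.linear_independent_extend[OF this, of "\<lambda>_. 1"] obtain g
    where g: "Vector_Spaces.linear (\<lambda>(q::rat) (x::real). of_rat q * x) (\<lambda>(q::rat) (x::rat). q * x) g" "g 1 = 1"
    by auto
  interpret g: Vector_Spaces.linear "\<lambda>(q::rat) (x::real). of_rat q * x" "\<lambda>(q::rat) (x::rat). q * x" g by fact
  show ?thesis
  proof (intro exI[of _ "\<lambda>x. of_rat (g x)"] conjI allI ballI)
    fix q x :: real assume "q \<in> \<rat>"
    then obtain r where "q = of_rat r" by (auto elim: Rats_cases)
    then show "of_rat (g (q * x)) = q * of_rat (g x)" using g.scale[of r x] by (simp add: of_rat_mult)
  qed (auto simp: g.add of_rat_add g(2))
qed

lemma mem_translate: "x \<in> translate f A \<longleftrightarrow> x - to_torus f \<in> A"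
  by (force simp: translate_def image_iff)

lemma sets_translate: "A \<in> sets torus_lebesgue \<Longrightarrow> {x. x - a \<in> A} \<in> sets torus_lebesgue"
  using sets_torus_shift[of A "- a"] by (simp add: vimage_def)

lemma integrable_indicator_torus [simp]:
  "A \<in> sets torus_lebesgue \<Longrightarrow> integrable torus_lebesgue (indicator A :: _ \<Rightarrow> complex)"
  by (intro integrable_torus_bounded[where B = 1]) (auto simp: indicator_def)

lemma integrable_indicator_torus_shift [simp]:
  "A \<in> sets torus_lebesgue \<Longrightarrow> integrable torus_lebesgue (\<lambda>x. indicator A (x - a) :: complex)"
  by (rule integrable_torus_shift_diff) simp

lemma fourier_indicator_0:
  assumes "A \<in> sets torus_lebesgue"
  shows "fourier (indicator A) 0 = of_real (measure torus_lebesgue A)"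
proof -
  have "(indicator A :: 'a torus \<Rightarrow> complex) = (\<lambda>x. of_real (indicator A x))"
    by (auto simp: indicator_def fun_eq_iff)
  then show ?thesis using assms by (simp add: fourier_0)
qed

lemma fourier_shift_family:
  assumes "A \<in> sets torus_lebesgue" "\<xi> \<in> int_vecs"
  shows "fourier (\<lambda>x. \<Sum>i\<in>I. indicator A (x - to_torus (c i))) \<xi> =
    (\<Sum>i\<in>I. torus_char \<xi> (to_torus (c i))) * fourier (indicator A) \<xi>"
  using assms by (simp add: fourier_sum fourier_shift sum_distrib_right)

lemma tile_family_complex:
  "tile_family c I A \<longleftrightarrow> (AE x in torus_lebesgue. (\<Sum>i\<in>I. indicator A (x - to_torus (c i))) = (1 :: complex))"
proof -
  have eq: "(\<Sum>i\<in>I. indicator A (x - to_torus (c i))) = complex_of_int (\<Sum>i\<in>I. indicator A (x - to_torus (c i)))" for x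
    unfolding of_int_sum by (intro sum.cong refl) (simp add: indicator_def)
  have "(\<Sum>i\<in>I. indicator A (x - to_torus (c i))) = (1 :: int) \<longleftrightarrow>
    (\<Sum>i\<in>I. indicator A (x - to_torus (c i))) = (1 :: complex)" for x
    by (simp only: eq[of x] of_int_eq_1_iff)
  then show ?thesis by (simp add: tile_family_def)
qed

text \<open>Compare the coefficients of the counting function with those of 1: frequency 0 records
  the measure, every other frequency asks for a vanishing product.\<close>

lemma tile_family_iff_fourier:
  fixes A :: "('n::finite) torus set"
  assumes A: "A \<in> sets torus_lebesgue"
  shows "tile_family c I A \<longleftrightarrow> real (card I) * measure torus_lebesgue A = 1 \<and>
    (\<forall>\<xi>\<in>int_vecs. \<xi> \<noteq> 0 \<longrightarrow> (\<Sum>i\<in>I. torus_char \<xi> (to_torus (c i))) * fourier (indicator A) \<xi> = 0)"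
    (is "_ = ?R")
proof -
  let ?g = "\<lambda>x. \<Sum>i\<in>I. indicator A (x - to_torus (c i)) :: complex"
  have g: "integrable torus_lebesgue ?g" using A by auto
  have F: "fourier ?g \<xi> = (\<Sum>i\<in>I. torus_char \<xi> (to_torus (c i))) * fourier (indicator A) \<xi>" if "\<xi> \<in> int_vecs" for \<xi>
    by (rule fourier_shift_family[OF A that])
  have F0: "fourier ?g 0 = of_real (real (card I) * measure torus_lebesgue A)"
    using F[OF int_vecs_0] by (simp add: fourier_indicator_0[OF A])
  have F1: "fourier (\<lambda>x :: 'n torus. 1) 0 = 1" by (simp add: fourier_0 torus.prob_space[simplified])
  have "tile_family c I A \<longleftrightarrow> (\<forall>\<xi>\<in>int_vecs. fourier ?g \<xi> = fourier (\<lambda>x. 1) \<xi>)"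
    unfolding tile_family_complex
    using AE_eq_if_fourier_eq[OF g, of "\<lambda>x. 1"] fourier_cong_AE[OF g, of "\<lambda>x. 1"] by auto
  also have "\<dots> \<longleftrightarrow> fourier ?g 0 = 1 \<and> (\<forall>\<xi>\<in>int_vecs. \<xi> \<noteq> 0 \<longrightarrow> fourier ?g \<xi> = 0)" (is "?L \<longleftrightarrow> ?M")
  proof
    assume L: ?L
    show ?M
      using bspec[OF L int_vecs_0] bspec[OF L] by (simp add: fourier_const F1)
  next
    assume M: ?M
    show ?L
    proof
      fix \<xi> :: "real ^ 'n" assume "\<xi> \<in> int_vecs"
      then show "fourier ?g \<xi> = fourier (\<lambda>x. 1) \<xi>"
        using M by (cases "\<xi> = 0") (auto simp: F1 fourier_const)
    qed
  qed
  also have "fourier ?g 0 = 1 \<longleftrightarrow> real (card I) * measure torus_lebesgue A = 1"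
    unfolding F0 by (simp only: of_real_eq_1_iff)
  also have "(\<forall>\<xi>\<in>int_vecs. \<xi> \<noteq> 0 \<longrightarrow> fourier ?g \<xi> = 0) \<longleftrightarrow>
      (\<forall>\<xi>\<in>int_vecs. \<xi> \<noteq> 0 \<longrightarrow> (\<Sum>i\<in>I. torus_char \<xi> (to_torus (c i))) * fourier (indicator A) \<xi> = 0)"
    by (intro ball_cong imp_cong refl) (simp only: F)
  finally show ?thesis .
qed

lemma tile_family_disjoint:
  assumes "tile_family c I A" "i \<in> I" "j \<in> I" "i \<noteq> j"
  shows "AE x in torus_lebesgue. \<not> (x - to_torus (c i) \<in> A \<and> x - to_torus (c j) \<in> A)"
  using assms(1)[unfolded tile_family_def]
proof eventually_elim
  case (elim x)
  have fin: "finite I" using tile_family_finite[OF assms(1)] by simp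
  have "(\<Sum>k\<in>{i, j}. indicator A (x - to_torus (c k)) :: int) \<le> (\<Sum>k\<in>I. indicator A (x - to_torus (c k)))"
    using assms fin by (intro sum_mono2) auto
  then show ?case using elim assms(4) by (auto simp: indicator_def split: if_splits)
qed

lemma tile_family_measure_pos:
  assumes "tile_family c I A" "A \<in> sets torus_lebesgue"
  shows "measure torus_lebesgue A > 0"
proof -
  have "real (card I) * measure torus_lebesgue A = 1"
    using assms(1) unfolding tile_family_iff_fourier[OF assms(2)] by (rule conjunct1)
  then have "measure torus_lebesgue A \<noteq> 0" by auto
  then show ?thesis using measure_nonneg[of torus_lebesgue A] by linarith
qed

text \<open>Two tiles at the same place would be almost disjoint, making \<open>A\<close> null,
  against \<open>tile_family_measure_pos\<close>.\<close>

lemma tile_family_distinct: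
  assumes T: "tile_family c I A" "A \<in> sets torus_lebesgue" and "i \<in> I" "j \<in> I" "i \<noteq> j"
  shows "to_torus (c i) \<noteq> to_torus (c j)"
proof
  assume eq: "to_torus (c i) = to_torus (c j)"
  have "AE x in torus_lebesgue. x - to_torus (c i) \<notin> A"
    using tile_family_disjoint[OF T(1) assms(3-5)] by (simp add: eq)
  from AE_torus_shift[OF this, of "to_torus (c i)"] have "AE x in torus_lebesgue. x \<notin> A" by simp
  then have "measure torus_lebesgue A = 0"
    using T(2) by (simp add: AE_iff_measurable[OF T(2)] measure_def)
  with tile_family_measure_pos[OF T] show False by simp
qed

lemma tile_family_if_tiling:
  assumes "tiling (c ` I) A" "inj_on c I" "finite I"
  shows "A \<in> sets torus_lebesgue" "tile_family c I A"
proof -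
  show "A \<in> sets torus_lebesgue" using assms(1) by (simp add: tiling_def)
  have d: "AE x in torus_lebesgue. \<forall>i\<in>I. \<forall>j\<in>I. i \<noteq> j \<longrightarrow> \<not> (x - to_torus (c i) \<in> A \<and> x - to_torus (c j) \<in> A)"
  proof (intro AE_finite_allI assms(3))
    fix i j assume ij: "i \<in> I" "j \<in> I"
    show "AE x in torus_lebesgue. i \<noteq> j \<longrightarrow> \<not> (x - to_torus (c i) \<in> A \<and> x - to_torus (c j) \<in> A)"
    proof (cases "i = j")
      case False
      then have "c i \<noteq> c j" using assms(2) ij by (auto simp: inj_on_def)
      then have "translate (c i) A \<inter> translate (c j) A =\<^sub>a\<^sub>e {}"
        using assms(1) ij by (simp add: tiling_def)
      then show ?thesis by (simp add: ae_eq_def mem_translate)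
    qed simp
  qed
  have u: "AE x in torus_lebesgue. \<exists>i\<in>I. x - to_torus (c i) \<in> A"
    using assms(1) by (simp add: tiling_def ae_eq_def mem_translate)
  show "tile_family c I A"
    unfolding tile_family_def using d u
  proof eventually_elim
    case (elim x)
    then obtain i where i: "i \<in> I" "x - to_torus (c i) \<in> A" by auto
    then have "\<And>j. j \<in> I - {i} \<Longrightarrow> x - to_torus (c j) \<notin> A" using elim by auto
    then have "(\<Sum>j\<in>I - {i}. indicator A (x - to_torus (c j))) = (0::int)" by (intro sum.neutral) auto
    then show ?case using i assms(3) by (simp add: sum.remove[of I i])
  qed
qed

lemma tiling_if_tile_family:
  assumes T: "tile_family c I A" and A: "A \<in> sets torus_lebesgue"
  shows "tiling (c ` I) A"
  unfolding tiling_def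
proof (intro conjI ballI impI A)
  have fin: "finite I" using tile_family_finite[OF T] by simp
  then show "finite (c ` I)" by simp
  show "translate a A \<inter> translate b A =\<^sub>a\<^sub>e {}" if "a \<in> c ` I" "b \<in> c ` I" "a \<noteq> b" for a b
    using that tile_family_disjoint[OF T] by (auto simp: ae_eq_def mem_translate)
  show "(\<Union>a\<in>c ` I. translate a A) =\<^sub>a\<^sub>e UNIV"
    unfolding ae_eq_def using T[unfolded tile_family_def]
  proof eventually_elim
    case (elim x)
    then have "(\<Sum>i\<in>I. indicator A (x - to_torus (c i))) \<noteq> (0::int)" by simp
    then obtain i where "i \<in> I" "indicator A (x - to_torus (c i)) \<noteq> (0::int)" by (meson sum.neutral)
    then show ?case by (auto simp: mem_translate indicator_def split: if_splits)
  qed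
qed

section \<open>Motion of the tiles along their velocities\<close>

locale torus_tiling =
  fixes f :: "nat \<Rightarrow> real ^ ('n :: finite)" and n :: nat and A :: "'n torus set" and \<pi> :: "real \<Rightarrow> real"
  assumes tile: "tile_family f {1..n} A" and sets_A: "A \<in> sets torus_lebesgue"
    and \<pi>_add: "\<pi> (x + y) = \<pi> x + \<pi> y" and \<pi>_scale: "q \<in> \<rat> \<Longrightarrow> \<pi> (q * x) = q * \<pi> x"
    and \<pi>_rat: "\<pi> x \<in> \<rat>" and \<pi>_1: "\<pi> 1 = 1"
begin

definition f0 :: "nat \<Rightarrow> real ^ 'n"
  where "f0 i = (\<chi> k. \<pi> (f i $ k))"

definition vel :: "nat \<Rightarrow> real ^ 'n"
  where "vel i = f i - f0 i"

abbreviation "I \<equiv> {1..n}"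

lemma \<pi>_of_rat: "q \<in> \<rat> \<Longrightarrow> \<pi> q = q"
  using \<pi>_scale[of q 1] \<pi>_1 by simp

lemma \<pi>_0: "\<pi> 0 = 0"
  by (rule \<pi>_of_rat) simp

lemma \<pi>_diff: "\<pi> (x - y) = \<pi> x - \<pi> y"
  using \<pi>_add[of "x - y" y] by simp

lemma \<pi>_sum: "\<pi> (sum g S) = (\<Sum>s\<in>S. \<pi> (g s))"
  by (induction S rule: infinite_finite_induct) (auto simp: \<pi>_0 \<pi>_add)

lemma inner_f0:
  assumes "\<xi> \<in> int_vecs"
  shows "\<xi> \<bullet> f0 i = \<pi> (\<xi> \<bullet> f i)"
proof -
  have "\<xi> $ k \<in> \<rat>" for k using assms by (auto simp: int_vecs_def intro: subsetD[OF Ints_subset_Rats])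
  then show ?thesis by (simp add: inner_vec_def f0_def \<pi>_sum \<pi>_scale)
qed

text \<open>The map x - \<pi> x is additive and kills the rationals, so it cannot see a rational
  difference of phases.\<close>

lemma vel_inner_eq:
  assumes "\<xi> \<in> int_vecs" "q \<in> \<rat>" "\<xi> \<bullet> f i - \<xi> \<bullet> f j = q"
  shows "\<xi> \<bullet> vel i = \<xi> \<bullet> vel j"
proof -
  have "\<pi> (\<xi> \<bullet> f i) - \<pi> (\<xi> \<bullet> f j) = q" using \<pi>_of_rat[OF assms(2)] assms(3) \<pi>_diff by metis
  then show ?thesis using assms by (simp add: vel_def inner_diff_right inner_f0)
qed

text \<open>Dilating by \<open>1 + k n!\<close> multiplies the phases by powers of \<open>w\<^sub>i = e(n! \<xi> \<cdot> f\<^sub>i)\<close>; indices with equal \<open>w\<^sub>i\<close> have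
  equal \<open>\<xi> \<cdot> v\<^sub>i\<close>, so the vanishing power sums localize to the level sets of \<open>\<xi> \<cdot> v\<^sub>i\<close>.\<close>

lemma weighted_sum_zero:
  assumes \<xi>: "\<xi> \<in> int_vecs" "\<xi> \<noteq> 0" "fourier (indicator A) \<xi> \<noteq> 0"
  shows "(\<Sum>i\<in>I. torus_char \<xi> (to_torus (f i)) * g (\<xi> \<bullet> vel i)) = 0"
proof (rule power_sums_zero_weighted)
  let ?w = "\<lambda>i. cis (2 * pi * (fact n * (\<xi> \<bullet> f i)))"
  fix k :: nat
  have "tile_family (\<lambda>i. (1 + real k * fact n) *\<^sub>R f i) I A"
    using tile_family_dilate_fact[OF tile, of k] by simp
  then have "0 = (\<Sum>i\<in>I. torus_char \<xi> (to_torus ((1 + real k * fact n) *\<^sub>R f i)))"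
    unfolding tile_family_iff_fourier[OF sets_A] using \<xi> by auto
  also have "\<dots> = (\<Sum>i\<in>I. torus_char \<xi> (to_torus (f i)) * ?w i ^ k)"
  proof (intro sum.cong refl)
    fix i
    have "?w i ^ k = cis (real k * (2 * pi * (fact n * (\<xi> \<bullet> f i))))" by (rule Complex.DeMoivre)
    then show "torus_char \<xi> (to_torus ((1 + real k * fact n) *\<^sub>R f i)) = torus_char \<xi> (to_torus (f i)) * ?w i ^ k"
      using \<xi>(1) by (simp add: torus_char_to_torus cis_mult algebra_simps)
  qed
  finally show "(\<Sum>i\<in>I. torus_char \<xi> (to_torus (f i)) * ?w i ^ k) = 0" by simp
next
  fix i j assume "cis (2 * pi * (fact n * (\<xi> \<bullet> f i))) = cis (2 * pi * (fact n * (\<xi> \<bullet> f j)))"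
  then have "fact n * (\<xi> \<bullet> f i - \<xi> \<bullet> f j) \<in> \<int>" by (simp add: cis_2pi_eq_iff right_diff_distrib)
  \<comment> \<open>Dividing by n! turns equality of the w into a rational difference of
    phases.\<close>
  then have "fact n * (\<xi> \<bullet> f i - \<xi> \<bullet> f j) / real (fact n) \<in> \<rat>"
    by (intro Rats_divide subsetD[OF Ints_subset_Rats] Rats_of_nat)
  then have "\<xi> \<bullet> f i - \<xi> \<bullet> f j \<in> \<rat>" by simp
  then show "g (\<xi> \<bullet> vel i) = g (\<xi> \<bullet> vel j)" using vel_inner_eq[OF \<xi>(1)] by simp
qed simp

lemma tile_motion: "tile_family (\<lambda>i. f i + t *\<^sub>R vel i) I A"
  unfolding tile_family_iff_fourier[OF sets_A]
proof (intro conjI ballI impI)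
  show "real (card I) * measure torus_lebesgue A = 1"
    using tile tile_family_iff_fourier[OF sets_A] by blast
  fix \<xi> :: "real ^ 'n" assume \<xi>: "\<xi> \<in> int_vecs" "\<xi> \<noteq> 0"
  show "(\<Sum>i\<in>I. torus_char \<xi> (to_torus (f i + t *\<^sub>R vel i))) * fourier (indicator A) \<xi> = 0"
  proof (cases "fourier (indicator A) \<xi> = 0")
    case False
    from weighted_sum_zero[OF \<xi> False, of "\<lambda>r. cis (2 * pi * (t * r))"] \<xi>(1) show ?thesis
      by (simp add: torus_char_to_torus cis_mult inner_add_right distrib_left)
  qed simp
qed

lemma tile_motion_f0: "tile_family (\<lambda>i. f0 i + t *\<^sub>R (f i - f0 i)) I A"
  \<comment> \<open>The clock of \<open>tile_motion\<close> starts at \<open>f\<close>, whereas here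
    \<open>f\<close> is reached at time 1.\<close>
  using tile_motion[of "t - 1"] by (simp add: vel_def algebra_simps)

lemma f0_rat: "f0 i \<in> rat_vecs"
  by (simp add: f0_def rat_vecs_def \<pi>_rat)

lemma f0_diff_rat: "f0 i - f0 j \<in> rat_vecs"
  by (simp add: f0_def rat_vecs_def \<pi>_rat)

lemma vel_eq_if_dim_1:
  assumes "CARD('n) = 1" "i \<in> I" "j \<in> I"
  shows "vel i = vel j"
proof (rule ccontr)
  assume ne: "vel i \<noteq> vel j"
  obtain a :: 'n where a: "UNIV = {a}" using assms(1) by (auto simp: card_1_singleton_iff)
  have eq_iff: "x = y \<longleftrightarrow> x $ a = y $ a" for x y :: "real ^ 'n"
    using a by (auto simp: vec_eq_iff)
  have d: "vel i $ a - vel j $ a \<noteq> 0" using ne eq_iff by auto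
  \<comment> \<open>The time at which the two tiles would occupy the same point of the real
    line.\<close>
  define t where "t = - (f i $ a - f j $ a) / (vel i $ a - vel j $ a)"
  have "t * (vel i $ a - vel j $ a) = - (f i $ a - f j $ a)" using d by (simp add: t_def)
  then have "f i + t *\<^sub>R vel i = f j + t *\<^sub>R vel j"
    by (simp add: eq_iff algebra_simps)
  moreover have "i \<noteq> j" using ne by auto
  ultimately show False
    using tile_family_distinct[OF tile_motion sets_A assms(2,3), of t] by simp
qed

end

subsection \<open>Functions invariant along a direction\<close>

text \<open>Invariance is exact, and under rational multiples only. Functions measurable for this
  sigma-algebra are then invariant at every point, without exceptional sets.\<close>

definition rat_line_algebra :: "real ^ 'n \<Rightarrow> ('n::finite) torus measure"
  where "rat_line_algebra d = sigma UNIV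
    {B \<in> sets torus_lebesgue. \<forall>q\<in>\<rat>. \<forall>x. x - to_torus (q *\<^sub>R d) \<in> B \<longleftrightarrow> x \<in> B}"

lemma space_rat_line_algebra [simp]: "space (rat_line_algebra d) = UNIV"
  by (simp add: rat_line_algebra_def)

lemma sets_rat_line_algebra:
  "B \<in> sets (rat_line_algebra d) \<longleftrightarrow>
    B \<in> sets torus_lebesgue \<and> (\<forall>q\<in>\<rat>. \<forall>x. x - to_torus (q *\<^sub>R d) \<in> B \<longleftrightarrow> x \<in> B)"
proof -
  let ?S = "{B \<in> sets torus_lebesgue. \<forall>q\<in>\<rat>. \<forall>x. x - to_torus (q *\<^sub>R d) \<in> B \<longleftrightarrow> x \<in> B}"
  have "UNIV - X \<in> sets torus_lebesgue" if "X \<in> sets torus_lebesgue" for X :: "'a torus set"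
    using sets.compl_sets[OF that] by simp
  then have "sigma_algebra UNIV ?S"
    unfolding sigma_algebra_iff2 using sets.top[of "torus_lebesgue :: 'a torus measure"] by (auto simp del: sets.top)
  then show ?thesis
    unfolding rat_line_algebra_def by (simp add: sigma_algebra.sigma_sets_eq)
qed

lemma subalgebra_rat_line: "subalgebra torus_lebesgue (rat_line_algebra d)"
  by (auto simp: subalgebra_def sets_rat_line_algebra)

text \<open>Points are closed in a T1 space, so the level set of g through x is measurable and hence
  invariant.\<close>

lemma measurable_rat_line_algebra_iff:
  fixes g :: "('n::finite) torus \<Rightarrow> 'b::t1_space"
  shows "g \<in> borel_measurable (rat_line_algebra d) \<longleftrightarrow>
    g \<in> borel_measurable torus_lebesgue \<and> (\<forall>q\<in>\<rat>. \<forall>x. g (x - to_torus (q *\<^sub>R d)) = g x)" (is "?L \<longleftrightarrow> ?R")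
proof
  assume L: ?L
  have "g (x - to_torus (q *\<^sub>R d)) = g x" if "q \<in> \<rat>" for q x
  proof -
    have "g -` {g x} \<inter> space (rat_line_algebra d) \<in> sets (rat_line_algebra d)"
      by (rule measurable_sets[OF L]) simp
    then have "x - to_torus (q *\<^sub>R d) \<in> g -` {g x} \<longleftrightarrow> x \<in> g -` {g x}"
      using that unfolding sets_rat_line_algebra by simp
    then show ?thesis by simp
  qed
  then show ?R using measurable_from_subalg[OF subalgebra_rat_line L] by simp
next
  assume R: ?R
  show ?L
  proof (rule measurableI)
    fix B :: "'b set" assume "B \<in> sets borel"
    then have "g -` B \<inter> space torus_lebesgue \<in> sets torus_lebesgue" using R by (blast intro: measurable_sets)
    then show "g -` B \<inter> space (rat_line_algebra d) \<in> sets (rat_line_algebra d)"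
      using R by (simp add: sets_rat_line_algebra)
  qed simp
qed

lemma torus_char_rat_line_invariant:
  assumes "\<xi> \<in> int_vecs" "\<xi> \<bullet> d = 0"
  shows "torus_char \<xi> (x - to_torus (t *\<^sub>R d)) = torus_char \<xi> x"
  using torus_char_add[OF assms(1), of "x - to_torus (t *\<^sub>R d)" "to_torus (t *\<^sub>R d)"] assms
  by (simp add: torus_char_to_torus)

lemma integrable_real_mult_bounded:
  fixes g f :: "('n::finite) torus \<Rightarrow> real"
  assumes "integrable torus_lebesgue g" "f \<in> borel_measurable torus_lebesgue" "\<And>x. \<bar>f x\<bar> \<le> B"
  shows "integrable torus_lebesgue (\<lambda>x. f x * g x)"
proof -
  have "integrable torus_lebesgue (\<lambda>x. complex_of_real (g x) * complex_of_real (f x))"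
    using assms by (intro integrable_mult_bounded[where B = B]) auto
  then have "integrable torus_lebesgue (\<lambda>x. complex_of_real (f x * g x))" by (simp add: mult.commute)
  then show ?thesis by (simp only: complex_of_real_integrable_eq)
qed

text \<open>The conditional expectation of \<open>u\<close> on the sets invariant along \<open>d\<close> retains exactly the frequencies
  orthogonal to \<open>d\<close>, so it is constant here.\<close>

lemma integral_mult_rat_line_invariant:
  fixes u :: "('n::finite) torus \<Rightarrow> real" and g :: "'n torus \<Rightarrow> complex"
  assumes u: "integrable torus_lebesgue u"
    and u0: "\<And>\<xi>. \<xi> \<in> int_vecs \<Longrightarrow> \<xi> \<noteq> 0 \<Longrightarrow> \<xi> \<bullet> d = 0 \<Longrightarrow> fourier (\<lambda>x. complex_of_real (u x)) \<xi> = 0"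
    and g: "g \<in> borel_measurable torus_lebesgue" "\<And>x. norm (g x) \<le> B"
    and inv: "\<And>q x. q \<in> \<rat> \<Longrightarrow> g (x - to_torus (q *\<^sub>R d)) = g x"
  shows "(\<integral>x. complex_of_real (u x) * g x \<partial>torus_lebesgue) =
    complex_of_real (integral\<^sup>L torus_lebesgue u) * integral\<^sup>L torus_lebesgue g"
proof -
  let ?M = "torus_lebesgue :: 'n torus measure" and ?F = "rat_line_algebra d"
  interpret F: finite_measure_subalgebra ?M ?F
    by unfold_locales (rule subalgebra_rat_line)
  define U where "U = real_cond_exp ?M ?F u"
  note um = borel_measurable_integrable[OF u]
  have U: "integrable ?M U" using F.real_cond_exp_int(1)[OF u] by (simp add: U_def)
  have Uinv: "U (x - to_torus (q *\<^sub>R d)) = U x" if "q \<in> \<rat>" for q x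
    using borel_measurable_cond_exp[of ?M ?F u] that unfolding U_def measurable_rat_line_algebra_iff by blast
  have real: "integrable ?M (\<lambda>x. h x * u x)" "integrable ?M (\<lambda>x. h x * U x)"
      "(\<integral>x. h x * U x \<partial>?M) = (\<integral>x. h x * u x \<partial>?M)"
    if h: "h \<in> borel_measurable ?M" "\<And>x. \<bar>h x\<bar> \<le> C" "\<And>q x. q \<in> \<rat> \<Longrightarrow> h (x - to_torus (q *\<^sub>R d)) = h x"
    for h C
  proof -
    show i: "integrable ?M (\<lambda>x. h x * u x)" by (rule integrable_real_mult_bounded[OF u h(1,2)])
    show "integrable ?M (\<lambda>x. h x * U x)" by (rule integrable_real_mult_bounded[OF U h(1,2)])
    have "h \<in> borel_measurable ?F" using h by (simp add: measurable_rat_line_algebra_iff)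
    from F.real_cond_exp_intg(2)[OF i this um] show "(\<integral>x. h x * U x \<partial>?M) = (\<integral>x. h x * u x \<partial>?M)"
      by (simp add: U_def)
  qed
  \<comment> \<open>Complex test functions are treated through their real and imaginary
    parts.\<close>
  have cplx: "(\<integral>x. complex_of_real (u x) * h x \<partial>?M) = (\<integral>x. complex_of_real (U x) * h x \<partial>?M)"
    if h: "h \<in> borel_measurable ?M" "\<And>x. norm (h x) \<le> C" "\<And>q x. q \<in> \<rat> \<Longrightarrow> h (x - to_torus (q *\<^sub>R d)) = h x"
    for h C
  proof -
    have "\<bar>Re (h x)\<bar> \<le> C" "\<bar>Im (h x)\<bar> \<le> C" for x
      using h(2)[of x] abs_Re_le_cmod[of "h x"] abs_Im_le_cmod[of "h x"] by linarith+
    then have re: "integrable ?M (\<lambda>x. Re (h x) * u x)" "integrable ?M (\<lambda>x. Re (h x) * U x)"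
        "(\<integral>x. Re (h x) * U x \<partial>?M) = (\<integral>x. Re (h x) * u x \<partial>?M)"
      and im: "integrable ?M (\<lambda>x. Im (h x) * u x)" "integrable ?M (\<lambda>x. Im (h x) * U x)"
        "(\<integral>x. Im (h x) * U x \<partial>?M) = (\<integral>x. Im (h x) * u x \<partial>?M)"
      using h(1,3) real[of "\<lambda>x. Re (h x)" C] real[of "\<lambda>x. Im (h x)" C] by auto
    have split: "complex_of_real a * h x = complex_of_real (Re (h x) * a) + \<i> * complex_of_real (Im (h x) * a)" for a x
      by (simp add: complex_eq_iff)
    show ?thesis
      unfolding split using re im by (simp del: of_real_mult)
  qed
  \<comment> \<open>At nonzero frequencies orthogonal to d the coefficient is that of u; at the
    others it vanishes because U is invariant along d.\<close>
  have "AE x in ?M. complex_of_real (U x) = integral\<^sup>L ?M (\<lambda>x. complex_of_real (U x))"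
  proof (rule AE_const_if_fourier_0)
    fix \<xi> :: "real ^ 'n" assume \<xi>: "\<xi> \<in> int_vecs" "\<xi> \<noteq> 0"
    show "fourier (\<lambda>x. complex_of_real (U x)) \<xi> = 0"
    proof (cases "\<xi> \<bullet> d = 0")
      case True
      then show ?thesis
        using cplx[OF torus_char_measurable[OF \<xi>(1)], of 1] u0[OF \<xi> True] torus_char_rat_line_invariant[OF \<xi>(1) True]
        by (simp add: fourier_def)
    next
      case False
      then show ?thesis using \<xi>(1) U Uinv by (intro fourier_0_if_rat_line_invariant[where v = d]) auto
    qed
  qed (use U in simp)
  then have "AE x in ?M. U x = integral\<^sup>L ?M U"
    by (simp add: integral_complex_of_real)
  then have "AE x in ?M. complex_of_real (U x) * g x = complex_of_real (integral\<^sup>L ?M U) * g x"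
    by eventually_elim simp
  then have "(\<integral>x. complex_of_real (U x) * g x \<partial>?M) = (\<integral>x. complex_of_real (integral\<^sup>L ?M U) * g x \<partial>?M)"
    using U g(1) by (intro integral_cong_AE) auto
  also have "\<dots> = complex_of_real (integral\<^sup>L ?M u) * integral\<^sup>L ?M g"
    using F.real_cond_exp_int(2)[OF u] by (simp add: U_def)
  finally show ?thesis using cplx[OF g inv] by simp
qed

text \<open>By pigeonhole, among \<open>card V\<close> + 1 multiples of b two agree modulo 1 under
  \<kappa>, so the order of \<kappa> b modulo 1 divides (card V)!. Every s is (card V)! times some
  b.\<close>

lemma additive_mod_Ints_finite:
  fixes \<kappa> :: "real \<Rightarrow> real"
  assumes add: "\<And>s t. \<kappa> (s + t) - \<kappa> s - \<kappa> t \<in> \<int>"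
    and V: "finite V" "\<And>s. \<exists>v\<in>V. \<kappa> s - v \<in> \<int>"
  shows "\<kappa> s \<in> \<int>"
proof -
  have mult: "\<kappa> (real k * b) - real k * \<kappa> b \<in> \<int>" for k b
  proof (induction k)
    case 0
    show ?case using add[of 0 0] by simp
  next
    case (Suc k)
    have "\<kappa> (b + real k * b) - \<kappa> b - \<kappa> (real k * b) + (\<kappa> (real k * b) - real k * \<kappa> b) \<in> \<int>"
      by (rule Ints_add[OF add Suc.IH])
    then show ?case by (simp add: algebra_simps)
  qed
  define N where "N = real (fact (card V))"
  define b where "b = s / N"
  have "\<forall>k. \<exists>v. v \<in> V \<and> \<kappa> (real k * b) - v \<in> \<int>" using V(2) by blast
  then obtain v where v: "\<And>k. v k \<in> V \<and> \<kappa> (real k * b) - v k \<in> \<int>" by metis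
  have "\<not> inj_on v {..card V}"
  proof
    assume "inj_on v {..card V}"
    then have "card {..card V} \<le> card V" using v V(1) by (intro card_inj_on_le[of v]) auto
    then show False by simp
  qed
  then obtain k l where kl: "k < l" "l \<le> card V" "v k = v l"
    unfolding inj_on_def by (metis atMost_iff linorder_neqE_nat)
  have "real l * \<kappa> b - v l \<in> \<int>" "real k * \<kappa> b - v l \<in> \<int>"
    using Ints_diff[OF conjunct2[OF v[of l]] mult[of l b]] Ints_diff[OF conjunct2[OF v[of k]] mult[of k b]] kl(3)
    by simp_all
  from Ints_diff[OF this] have d: "real (l - k) * \<kappa> b \<in> \<int>" using kl(1) by (simp add: of_nat_diff algebra_simps)
  have "l - k dvd fact (card V)" using kl by (intro dvd_fact) auto
  then obtain m where m: "fact (card V) = (l - k) * m" by (auto elim: dvdE)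
  have "N * \<kappa> b = real m * (real (l - k) * \<kappa> b)" unfolding N_def m by simp
  then have "N * \<kappa> b \<in> \<int>" using d by (metis Ints_mult Ints_of_nat)
  then have "\<kappa> (N * b) \<in> \<int>"
    using Ints_add[OF mult[of "fact (card V)" b], of "N * \<kappa> b"] by (simp add: N_def)
  then show ?thesis by (simp add: b_def N_def)
qed

text \<open>The exceptional null set may depend on t.\<close>

definition line_invariant :: "real ^ 'n \<Rightarrow> (('n::finite) torus \<Rightarrow> 'b) \<Rightarrow> bool"
  where "line_invariant d g \<longleftrightarrow> (\<forall>t. AE x in torus_lebesgue. g (x - to_torus (t *\<^sub>R d)) = g x)"

lemma line_invariantD:
  "line_invariant d g \<Longrightarrow> AE x in torus_lebesgue. g (x - to_torus (t *\<^sub>R d)) = g x"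
  by (simp add: line_invariant_def)

lemma AE_torus_ex:
  fixes P :: "('n::finite) torus \<Rightarrow> bool"
  assumes "AE x in torus_lebesgue. P x"
  shows "\<exists>x. P x"
proof (rule ccontr)
  assume "\<not> ?thesis"
  then have "AE x in (torus_lebesgue :: 'n torus measure). False" using assms by simp
  then show False by simp
qed

lemma line_invariant_shift_difference:
  assumes "line_invariant d (g :: _ \<Rightarrow> real)"
  shows "line_invariant d (\<lambda>x. g (x - a) - g x)"
  unfolding line_invariant_def
proof
  fix t
  note 1 = line_invariantD[OF assms, of t]
  from 1 AE_torus_shift_diff[OF 1, of a]
  show "AE x in torus_lebesgue. g (x - to_torus (t *\<^sub>R d) - a) - g (x - to_torus (t *\<^sub>R d)) = g (x - a) - g x"
    by eventually_elim (simp add: algebra_simps)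
qed

lemma AE_const_if_two_line_invariant:
  fixes g :: "('n::finite) torus \<Rightarrow> complex"
  assumes g: "integrable torus_lebesgue g" and inv: "line_invariant d g" "line_invariant e g"
    and span: "\<And>h. \<exists>a b. h = a *\<^sub>R d + b *\<^sub>R e"
  shows "AE x in torus_lebesgue. g x = integral\<^sup>L torus_lebesgue g"
proof (rule AE_const_if_shift_invariant[OF g])
  fix h :: "real ^ 'n"
  obtain a b where h: "h = a *\<^sub>R d + b *\<^sub>R e" using span by blast
  from line_invariantD[OF inv(1), of a] AE_torus_shift_diff[OF line_invariantD[OF inv(2), of b], of "to_torus (a *\<^sub>R d)"]
  show "AE x in torus_lebesgue. g (x - to_torus h) = g x"
    by eventually_elim (simp add: h to_torus_add diff_diff_eq)
qed

text \<open>Functions invariant along different directions whose sum is constant modulo \<open>1\<close>: differencing along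
  \<open>e\<close> removes the \<open>e\<close>-invariant summand, and the resulting constants \<open>\<kappa> s\<close> form a finite image of a divisible
  group, hence vanish modulo \<open>1\<close>.\<close>

lemma const_mod_1_of_sum:
  fixes K :: "('n::finite) torus \<Rightarrow> real"
  assumes "finite D" and "K \<in> borel_measurable torus_lebesgue" "line_invariant d K"
    and "finite R" "AE x in torus_lebesgue. K x \<in> R"
    and "\<And>e h. e \<in> D \<Longrightarrow> \<exists>a b. h = a *\<^sub>R d + b *\<^sub>R e"
    and "\<And>e. e \<in> D \<Longrightarrow> line_invariant e (H e)"
    and "AE x in torus_lebesgue. K x + (\<Sum>e\<in>D. H e x) - c \<in> \<int>"
  shows "\<exists>\<kappa>. AE x in torus_lebesgue. K x - \<kappa> \<in> \<int>"
  using assms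
proof (induction arbitrary: K H R c)
  case empty
  then show ?case by auto
next
  case (insert e D)
  have "\<exists>\<kappa>. AE x in torus_lebesgue. K (x - to_torus (s *\<^sub>R e)) - K x - \<kappa> \<in> \<int>" for s
  proof -
    let ?a = "to_torus (s *\<^sub>R e)"
    let ?\<Delta> = "\<lambda>g x. g (x - ?a) - g x :: real"
    show ?thesis
    \<comment> \<open>The differences lose the summand along e, keep finitely many values and remain
      constant modulo 1, now with constant 0.\<close>
    proof (rule insert.IH[of "?\<Delta> K" "(\<lambda>(r, r'). r - r') ` (R \<times> R)" "\<lambda>e. ?\<Delta> (H e)" 0])
      show "?\<Delta> K \<in> borel_measurable torus_lebesgue" using insert.prems(1) by measurable
      show "line_invariant d (?\<Delta> K)" by (rule line_invariant_shift_difference[OF insert.prems(2)])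
      show "finite ((\<lambda>(r, r'). r - r') ` (R \<times> R))" using insert.prems(3) by auto
      show "AE x in torus_lebesgue. ?\<Delta> K x \<in> (\<lambda>(r, r'). r - r') ` (R \<times> R)"
        using insert.prems(4) AE_torus_shift_diff[OF insert.prems(4), of ?a]
        by eventually_elim (auto simp: image_iff)
      show "\<exists>a b. h = a *\<^sub>R d + b *\<^sub>R e'" if "e' \<in> D" for e' h using insert.prems(5) that by auto
      show "line_invariant e' (?\<Delta> (H e'))" if "e' \<in> D" for e'
        using insert.prems(6) that by (intro line_invariant_shift_difference) auto
      show "AE x in torus_lebesgue. ?\<Delta> K x + (\<Sum>e\<in>D. ?\<Delta> (H e) x) - 0 \<in> \<int>"
        using insert.prems(7) AE_torus_shift_diff[OF insert.prems(7), of ?a] line_invariantD[OF insert.prems(6)[of e], of s, simplified]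
      proof eventually_elim
        case (elim x)
        from Ints_diff[OF elim(2,1)] show ?case
          using insert.hyps elim(3) by (simp add: sum_subtractf algebra_simps)
      qed
    qed
  qed
  then obtain \<kappa> where \<kappa>: "\<And>s. AE x in torus_lebesgue. K (x - to_torus (s *\<^sub>R e)) - K x - \<kappa> s \<in> \<int>" by metis
  have \<kappa>_int: "\<kappa> s \<in> \<int>" for s
  proof (rule additive_mod_Ints_finite[where \<kappa> = \<kappa>])
    fix s t
    from AE_torus_ex[OF AE_conjI[OF \<kappa>[of "s + t"] AE_conjI[OF \<kappa>[of s] AE_torus_shift_diff[OF \<kappa>[of t], of "to_torus (s *\<^sub>R e)"]]]]
    obtain x where x: "K (x - to_torus ((s + t) *\<^sub>R e)) - K x - \<kappa> (s + t) \<in> \<int>"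
      "K (x - to_torus (s *\<^sub>R e)) - K x - \<kappa> s \<in> \<int>"
      "K (x - to_torus (s *\<^sub>R e) - to_torus (t *\<^sub>R e)) - K (x - to_torus (s *\<^sub>R e)) - \<kappa> t \<in> \<int>" by blast
    from Ints_diff[OF Ints_add[OF x(2,3)] x(1)] show "\<kappa> (s + t) - \<kappa> s - \<kappa> t \<in> \<int>"
      by (simp add: scaleR_add_left to_torus_add diff_diff_eq)
  next
    show "finite ((\<lambda>(r, r'). r - r') ` (R \<times> R))" using insert.prems(3) by auto
    fix s
    from AE_torus_ex[OF AE_conjI[OF insert.prems(4) AE_conjI[OF AE_torus_shift_diff[OF insert.prems(4), of "to_torus (s *\<^sub>R e)"] \<kappa>[of s]]]]
    obtain x where "K x \<in> R" "K (x - to_torus (s *\<^sub>R e)) \<in> R"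
      and x: "K (x - to_torus (s *\<^sub>R e)) - K x - \<kappa> s \<in> \<int>" by blast
    then show "\<exists>v\<in>(\<lambda>(r, r'). r - r') ` (R \<times> R). \<kappa> s - v \<in> \<int>"
      using Ints_minus[OF x] by (intro bexI[of _ "K (x - to_torus (s *\<^sub>R e)) - K x"]) (auto simp: image_iff)
  qed
  \<comment> \<open>Exponentiating turns invariance modulo 1 along e into genuine invariance; K is
    already invariant along d, and the two directions span.\<close>
  define g where "g = (\<lambda>x. cis (2 * pi * K x))"
  have [measurable]: "K \<in> borel_measurable torus_lebesgue" by (rule insert.prems(1))
  have "g \<in> borel_measurable torus_lebesgue" unfolding g_def cis_conv_exp by measurable
  then have g: "integrable torus_lebesgue g" by (rule integrable_torus_bounded[where B = 1]) (simp add: g_def)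
  have inv_e: "line_invariant e g"
    unfolding line_invariant_def
  proof
    fix s
    show "AE x in torus_lebesgue. g (x - to_torus (s *\<^sub>R e)) = g x"
      using \<kappa>[of s]
    proof eventually_elim
      case (elim x)
      from Ints_add[OF elim \<kappa>_int[of s]] show ?case by (simp add: g_def cis_2pi_eq_iff)
    qed
  qed
  have inv_d: "line_invariant d g"
    unfolding line_invariant_def
  proof
    show "AE x in torus_lebesgue. g (x - to_torus (t *\<^sub>R d)) = g x" for t
      using line_invariantD[OF insert.prems(2), of t] by eventually_elim (simp add: g_def)
  qed
  have "AE x in torus_lebesgue. g x = integral\<^sup>L torus_lebesgue g"
    using insert.prems(5)[of e] by (intro AE_const_if_two_line_invariant[OF g inv_d inv_e]) auto
  moreover from AE_torus_ex[OF this] obtain x0 where "g x0 = integral\<^sup>L torus_lebesgue g" by blast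
  ultimately have "AE x in torus_lebesgue. g x = g x0" by simp
  then have "AE x in torus_lebesgue. K x - K x0 \<in> \<int>" by (simp add: g_def cis_2pi_eq_iff)
  then show ?case by blast
qed

subsection \<open>Velocities in dimension two\<close>

lemma two_dim_cases:
  fixes d e :: "real ^ 'n::finite"
  assumes "CARD('n) = 2" "d \<noteq> 0"
  shows "(\<exists>\<beta>. e = \<beta> *\<^sub>R d) \<or> (\<forall>h. \<exists>a b. h = a *\<^sub>R d + b *\<^sub>R e)"
proof -
  obtain i j :: 'n where ij: "UNIV = {i, j}" "i \<noteq> j" using assms(1) by (auto simp: card_2_iff)
  have eq_iff: "x = y \<longleftrightarrow> x $ i = y $ i \<and> x $ j = y $ j" for x y :: "real ^ 'n"
    unfolding vec_eq_iff using ij(1) by (metis UNIV_I insertE singletonD)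
  define D where "D = d $ i * e $ j - d $ j * e $ i"
  show ?thesis
  proof (cases "D = 0")
    case True
    define s where "s = d $ i * d $ i + d $ j * d $ j"
    have s: "s \<noteq> 0" using assms(2) by (auto simp: eq_iff s_def sum_squares_eq_zero_iff)
    have "e = ((e $ i * d $ i + e $ j * d $ j) / s) *\<^sub>R d"
      using True s by (simp add: eq_iff D_def field_simps) (simp add: s_def algebra_simps)
    then show ?thesis by blast
  next
    case False
    \<comment> \<open>Cramer's rule in the basis d, e.\<close>
    have "h = ((h $ i * e $ j - h $ j * e $ i) / D) *\<^sub>R d + ((d $ i * h $ j - d $ j * h $ i) / D) *\<^sub>R e" for h
      using False by (simp add: eq_iff field_simps) (simp add: D_def algebra_simps)
    then show ?thesis by blast
  qed
qed

lemma two_dim_orthogonal_parallel: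
  fixes d e \<xi> :: "real ^ 'n::finite"
  assumes "CARD('n) = 2" "d \<noteq> 0" "\<xi> \<noteq> 0" "\<xi> \<bullet> d = 0" "\<xi> \<bullet> e = 0"
  shows "\<exists>\<beta>. e = \<beta> *\<^sub>R d"
proof (rule ccontr)
  assume "\<not> ?thesis"
  then obtain a b where "\<xi> = a *\<^sub>R d + b *\<^sub>R e" using two_dim_cases[OF assms(1,2)] by blast
  then have "\<xi> \<bullet> \<xi> = a * (\<xi> \<bullet> d) + b * (\<xi> \<bullet> e)" by (metis inner_add_right inner_scaleR_right)
  then show False using assms by simp
qed

text \<open>\<eta> is \<xi> divided by the gcd of its entries, u comes from Bezout's identity and v
  is \<eta> turned by a right angle. With u at hand, integrality of
  \<open>\<eta> \<bullet> p\<close> characterizes the points p of the line along v modulo the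
  lattice.\<close>

lemma two_dim_primitive_normal:
  fixes \<xi> :: "real ^ 'n::finite"
  assumes "CARD('n) = 2" "\<xi> \<in> int_vecs" "\<xi> \<noteq> 0"
  obtains \<eta> u v r where "\<eta> \<in> int_vecs" "u \<in> int_vecs" "v \<in> int_vecs" "\<eta> \<bullet> u = 1" "\<eta> \<bullet> v = 0" "v \<noteq> 0"
    "\<xi> = r *\<^sub>R \<eta>" "r \<noteq> 0"
proof -
  obtain i j :: 'n where ij: "UNIV = {i, j}" "i \<noteq> j" using assms(1) by (auto simp: card_2_iff)
  have all_iff: "(\<forall>k. P k) \<longleftrightarrow> P i \<and> P j" for P using ij(1) by (metis UNIV_I insertE singletonD)
  have inner: "x \<bullet> y = x $ i * y $ i + x $ j * y $ j" for x y :: "real ^ 'n"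
    unfolding inner_vec_def using ij by (simp add: ij(1))
  define mk :: "int \<Rightarrow> int \<Rightarrow> real ^ 'n" where "mk a b = (\<chi> k. of_int (if k = i then a else b))" for a b
  have mk: "mk a b $ i = of_int a" "mk a b $ j = of_int b" "mk a b \<in> int_vecs" for a b
    using ij(2) by (auto simp: mk_def int_vecs_def)
  obtain m n where mn: "\<xi> $ i = of_int m" "\<xi> $ j = of_int n"
    using assms(2) by (auto simp: int_vecs_def elim!: Ints_cases) (metis Ints_cases)
  have \<xi>: "\<xi> = mk m n" using mn by (simp add: vec_eq_iff all_iff mk)
  define g where "g = gcd m n"
  have mn0: "m \<noteq> 0 \<or> n \<noteq> 0" using assms(3) mn by (auto simp: vec_eq_iff all_iff)
  then have g: "g \<noteq> 0" by (simp add: g_def)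
  obtain m' n' where mn': "m = g * m'" "n = g * n'" unfolding g_def by (meson dvdE gcd_dvd1 gcd_dvd2)
  obtain a b where "a * m + b * n = g" using bezout_int[of m n] by (auto simp: g_def)
  then have "g * (a * m' + b * n') = g * 1" unfolding mn' by (simp add: algebra_simps)
  then have "a * m' + b * n' = 1" using g by (simp only: mult_cancel_left) simp
  then have bez: "real_of_int m' * of_int a + of_int n' * of_int b = 1"
    by (metis mult.commute of_int_1 of_int_add of_int_mult)
  show thesis
  proof (rule that[of "mk m' n'" "mk a b" "mk (- n') m'" "of_int g"])
    show "mk m' n' \<bullet> mk a b = 1" using bez by (simp add: inner mk)
    show "mk (- n') m' \<noteq> 0"
    proof
      assume "mk (- n') m' = 0"
      then have "m' = 0" "n' = 0" using mk[of "- n'" m'] by auto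
      then show False using mn0 mn' by simp
    qed
    show "\<xi> = of_int g *\<^sub>R mk m' n'" unfolding \<xi> by (simp add: vec_eq_iff all_iff mk mn')
  qed (use g in \<open>simp_all add: inner mk\<close>)
qed

text \<open>Representatives come from V itself: applied to the nonzero velocities, each direction
  then belongs to an actual tile.\<close>

lemma exists_direction_representatives:
  fixes V :: "'a::real_vector set"
  assumes "finite V" "0 \<notin> V"
  shows "\<exists>D\<subseteq>V. (\<forall>w\<in>V. \<exists>d\<in>D. \<exists>\<beta>. w = \<beta> *\<^sub>R d) \<and> (\<forall>d\<in>D. \<forall>e\<in>D. d \<noteq> e \<longrightarrow> (\<nexists>\<beta>. e = \<beta> *\<^sub>R d))"
  using assms
proof (induction V)
  case empty
  then show ?case by auto
next
  case (insert w V)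
  then obtain D where D: "D \<subseteq> V" "\<forall>w\<in>V. \<exists>d\<in>D. \<exists>\<beta>. w = \<beta> *\<^sub>R d"
    "\<forall>d\<in>D. \<forall>e\<in>D. d \<noteq> e \<longrightarrow> (\<nexists>\<beta>. e = \<beta> *\<^sub>R d)" by auto
  show ?case
  proof (cases "\<exists>d\<in>D. \<exists>\<beta>. w = \<beta> *\<^sub>R d")
    case True
    then show ?thesis using D by (intro exI[of _ D]) auto
  next
    case False
    have "d \<noteq> \<beta> *\<^sub>R w" if "d \<in> D" for d \<beta>
    proof
      assume d: "d = \<beta> *\<^sub>R w"
      have "d \<noteq> 0" using that D(1) insert.prems by auto
      then have "w = (1 / \<beta>) *\<^sub>R d" using d by auto
      then show False using False that by blast
    qed
    then have "\<forall>d\<in>insert w D. \<forall>e\<in>insert w D. d \<noteq> e \<longrightarrow> (\<nexists>\<beta>. e = \<beta> *\<^sub>R d)"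
      using D(3) False by (metis insertE)
    moreover have "\<forall>w'\<in>insert w V. \<exists>d\<in>insert w D. \<exists>\<beta>. w' = \<beta> *\<^sub>R d"
      using D(2) by (metis insert_iff scaleR_one)
    moreover have "insert w D \<subseteq> insert w V" using D(1) by auto
    ultimately show ?thesis by blast
  qed
qed

text \<open>All frequencies present in B are orthogonal to d, and their characters do not change
  along d.\<close>

lemma line_invariant_set_if_fourier:
  fixes B :: "('n::finite) torus set"
  assumes "B \<in> sets torus_lebesgue" "\<And>\<xi>. \<xi> \<in> int_vecs \<Longrightarrow> \<xi> \<bullet> d \<noteq> 0 \<Longrightarrow> fourier (indicator B) \<xi> = 0"
  shows "line_invariant d (\<lambda>x. x \<in> B)"
  unfolding line_invariant_def
proof
  fix t
  have "AE x in torus_lebesgue. indicator B (x - to_torus (t *\<^sub>R d)) = (indicator B x :: complex)"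
  proof (rule shift_invariant_if_fourier)
    fix \<xi> :: "real ^ 'n" assume \<xi>: "\<xi> \<in> int_vecs" "fourier (indicator B) \<xi> \<noteq> 0"
    then have "\<xi> \<bullet> d = 0" using assms(2) by blast
    then show "torus_char \<xi> (to_torus (t *\<^sub>R d)) = 1" using \<xi>(1) by (simp add: torus_char_to_torus)
  qed (use assms in simp)
  then show "AE x in torus_lebesgue. (x - to_torus (t *\<^sub>R d) \<in> B) = (x \<in> B)"
    by eventually_elim (auto simp: indicator_def split: if_splits)
qed

lemma line_invariant_comp: "line_invariant d g \<Longrightarrow> line_invariant d (\<lambda>x. h (g x))"
  unfolding line_invariant_def
proof (intro allI)
  fix t assume "\<forall>t. AE x in torus_lebesgue. g (x - to_torus (t *\<^sub>R d)) = g x"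
  then have "AE x in torus_lebesgue. g (x - to_torus (t *\<^sub>R d)) = g x" by blast
  then show "AE x in torus_lebesgue. h (g (x - to_torus (t *\<^sub>R d))) = h (g x)" by eventually_elim simp
qed

lemma line_invariant_scaleR: "line_invariant d g \<Longrightarrow> line_invariant (\<beta> *\<^sub>R d) g"
  by (simp add: line_invariant_def)

text \<open>With rational multiples the saturation is a countable union of translates, hence
  measurable and insensitive to null sets.\<close>

definition rat_sat :: "real ^ 'n \<Rightarrow> ('n::finite) torus set \<Rightarrow> 'n torus set"
  where "rat_sat d B = {x. \<exists>q\<in>\<rat>. x - to_torus (q *\<^sub>R d) \<in> B}"

lemma subset_rat_sat: "B \<subseteq> rat_sat d B"
  by (auto simp: rat_sat_def intro!: bexI[of _ 0])

lemma sets_rat_sat: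
  assumes "B \<in> sets torus_lebesgue"
  shows "rat_sat d B \<in> sets torus_lebesgue"
proof -
  have "rat_sat d B = (\<Union>q\<in>\<rat>. {x. x - to_torus (q *\<^sub>R d) \<in> B})" by (auto simp: rat_sat_def)
  then show ?thesis using assms by (auto intro!: sets.countable_UN' countable_rat sets_translate)
qed

lemma rat_sat_shift:
  assumes "q \<in> \<rat>"
  shows "x - to_torus (q *\<^sub>R d) \<in> rat_sat d B \<longleftrightarrow> x \<in> rat_sat d B"
proof -
  have "x - to_torus (q *\<^sub>R d) \<in> rat_sat d B" if x: "x \<in> rat_sat d B" and q: "q \<in> \<rat>" for x q
  proof -
    obtain r where "r \<in> \<rat>" "x - to_torus (r *\<^sub>R d) \<in> B" using x by (auto simp: rat_sat_def)
    then show ?thesis using q unfolding rat_sat_def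
      by (intro CollectI bexI[of _ "r - q"]) (auto simp: to_torus_diff scaleR_diff_left)
  qed
  from this[of x q] this[of "x - to_torus (q *\<^sub>R d)" "- q"] show ?thesis
    using assms by (auto simp: to_torus_minus)
qed

lemma fourier_rat_sat:
  assumes "B \<in> sets torus_lebesgue" "\<xi> \<in> int_vecs" "\<xi> \<bullet> d \<noteq> 0"
  shows "fourier (indicator (rat_sat d B)) \<xi> = 0"
  using assms by (intro fourier_0_if_rat_line_invariant[where v = d]) (auto simp: sets_rat_sat rat_sat_shift indicator_def)

lemma ex_if_not_AE:
  assumes "\<not> (AE x in M. P x)" "AE x in M. Q x"
  shows "\<exists>x. \<not> P x \<and> Q x"
proof (rule ccontr)
  assume neg: "\<nexists>x. \<not> P x \<and> Q x"
  from assms(2) have "AE x in M. P x" by eventually_elim (use neg in blast)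
  with assms(1) show False by simp
qed

lemma indicator_const_measure:
  fixes B :: "('n::finite) torus set"
  assumes "B \<in> sets torus_lebesgue" "AE x in torus_lebesgue. indicator B x = (c :: complex)"
  shows "measure torus_lebesgue B = 0 \<or> measure torus_lebesgue B = 1"
proof -
  obtain x0 where x0: "indicator B x0 = c" using AE_torus_ex[OF assms(2)] by blast
  have "AE x in torus_lebesgue. x \<in> B \<longleftrightarrow> x0 \<in> B"
    using assms(2) by eventually_elim (auto simp: x0[symmetric] indicator_def split: if_splits)
  then show ?thesis
    using torus.prob_eq_0[OF assms(1)] torus.prob_eq_1[OF assms(1)] by (cases "x0 \<in> B") auto
qed

section \<open>Unions of tiles, the static set and the common direction\<close>

context torus_tiling
begin

definition piece :: "nat set \<Rightarrow> 'n torus set"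
  where "piece S = {x. \<exists>i\<in>S. x - to_torus (f i) \<in> A}"

lemma sumset_eq_piece: "sumset (f ` S) A = piece S"
  by (force simp: sumset_def piece_def image_iff)

lemma piece_Un: "piece (S \<union> T) = piece S \<union> piece T"
  by (auto simp: piece_def)

lemma sets_piece: "S \<subseteq> I \<Longrightarrow> piece S \<in> sets torus_lebesgue"
proof -
  assume "S \<subseteq> I"
  then have "finite S" by (rule finite_subset) simp
  moreover have "piece S = (\<Union>i\<in>S. {x. x - to_torus (f i) \<in> A})" by (auto simp: piece_def)
  ultimately show ?thesis using sets_A by (auto intro!: sets_translate)
qed

lemma indicator_piece_AE:
  assumes "S \<subseteq> I"
  shows "AE x in torus_lebesgue. indicator (piece S) x = (\<Sum>i\<in>S. indicator A (x - to_torus (f i)) :: complex)"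
proof -
  have fin: "finite S" using assms by (rule finite_subset) simp
  have "AE x in torus_lebesgue. \<forall>i\<in>S. \<forall>j\<in>S. i \<noteq> j \<longrightarrow> \<not> (x - to_torus (f i) \<in> A \<and> x - to_torus (f j) \<in> A)"
  proof (intro AE_finite_allI fin)
    show "AE x in torus_lebesgue. i \<noteq> j \<longrightarrow> \<not> (x - to_torus (f i) \<in> A \<and> x - to_torus (f j) \<in> A)" if "i \<in> S" "j \<in> S" for i j
      using tile_family_disjoint[OF tile subsetD[OF assms that(1)] subsetD[OF assms that(2)]] by (cases "i = j") auto
  qed
  then show ?thesis
  proof eventually_elim
    case (elim x)
    show ?case
    proof (cases "\<exists>i\<in>S. x - to_torus (f i) \<in> A")
      case True
      then obtain i where i: "i \<in> S" "x - to_torus (f i) \<in> A" by blast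
      have "(\<Sum>j\<in>S. indicator A (x - to_torus (f j)) :: complex) = (\<Sum>j\<in>{i}. indicator A (x - to_torus (f j)))"
        using fin i elim by (intro sum.mono_neutral_right) (auto simp: indicator_def)
      moreover have "x \<in> piece S" using i by (auto simp: piece_def)
      ultimately show ?thesis using i by simp
    next
      case False
      then show ?thesis by (auto simp: piece_def intro!: sum.neutral[symmetric])
    qed
  qed
qed

lemma fourier_piece:
  assumes "S \<subseteq> I" "\<xi> \<in> int_vecs"
  shows "fourier (indicator (piece S)) \<xi> = (\<Sum>i\<in>S. torus_char \<xi> (to_torus (f i))) * fourier (indicator A) \<xi>"
proof -
  have "fourier (indicator (piece S)) \<xi> = fourier (\<lambda>x. \<Sum>i\<in>S. indicator A (x - to_torus (f i))) \<xi>"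
    using sets_piece[OF assms(1)] sets_A assms by (intro fourier_cong_AE indicator_piece_AE) auto
  then show ?thesis using fourier_shift_family[OF sets_A assms(2)] by simp
qed

lemma measure_piece:
  assumes "S \<subseteq> I"
  shows "measure torus_lebesgue (piece S) = real (card S) * measure torus_lebesgue A"
proof -
  have "complex_of_real (measure torus_lebesgue (piece S)) = complex_of_real (real (card S) * measure torus_lebesgue A)"
    using fourier_piece[OF assms int_vecs_0] sets_piece[OF assms] sets_A by (simp add: fourier_indicator_0)
  then show ?thesis by (simp only: of_real_eq_iff)
qed

lemma measure_A_pos: "measure torus_lebesgue A > 0"
  by (rule tile_family_measure_pos[OF tile sets_A])

lemma card_measure_A: "real n * measure torus_lebesgue A = 1"
  using tile unfolding tile_family_iff_fourier[OF sets_A] by simp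

lemma measure_piece_pos:
  assumes "S \<subseteq> I" "S \<noteq> {}"
  shows "measure torus_lebesgue (piece S) > 0"
proof -
  have "finite S" using assms(1) by (rule finite_subset) simp
  then show ?thesis using assms measure_A_pos by (simp add: measure_piece card_gt_0_iff)
qed

lemma measure_piece_less_1:
  assumes "S \<subset> I"
  shows "measure torus_lebesgue (piece S) < 1"
proof -
  have "card S < n" using psubset_card_mono[OF _ assms] by simp
  then have "real (card S) * measure torus_lebesgue A < real n * measure torus_lebesgue A"
    using measure_A_pos by simp
  then show ?thesis using assms card_measure_A by (simp add: measure_piece)
qed

text \<open>Within the index set, S is a union of level sets of
  \<open>\<xi> \<bullet> vel i\<close>, so its indicator is an admissible weight in the vanishing
  sums.\<close>

lemma fourier_piece_level:
  assumes S: "S \<subseteq> I" and \<xi>: "\<xi> \<in> int_vecs" "\<xi> \<noteq> 0"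
    and level: "\<And>i j. i \<in> S \<Longrightarrow> j \<in> I \<Longrightarrow> \<xi> \<bullet> vel i = \<xi> \<bullet> vel j \<Longrightarrow> j \<in> S"
  shows "fourier (indicator (piece S)) \<xi> = 0"
proof (cases "fourier (indicator A) \<xi> = 0")
  case False
  let ?g = "\<lambda>r. if \<exists>j\<in>S. \<xi> \<bullet> vel j = r then 1 else 0 :: complex"
  have iff: "(\<exists>j\<in>S. \<xi> \<bullet> vel j = \<xi> \<bullet> vel i) \<longleftrightarrow> i \<in> S" if "i \<in> I" for i using level that by blast
  have "0 = (\<Sum>i\<in>I. torus_char \<xi> (to_torus (f i)) * ?g (\<xi> \<bullet> vel i))"
    by (rule weighted_sum_zero[OF \<xi> False, symmetric])
  also have "\<dots> = (\<Sum>i\<in>I. if i \<in> S then torus_char \<xi> (to_torus (f i)) else 0)"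
    by (intro sum.cong refl) (simp add: iff)
  also have "\<dots> = (\<Sum>i\<in>S. torus_char \<xi> (to_torus (f i)))"
    using S by (simp add: sum.If_cases Int_absorb1)
  finally show ?thesis using fourier_piece[OF S \<xi>(1)] by simp
qed (simp add: fourier_piece[OF S \<xi>(1)])

text \<open>The two tiles are still almost disjoint at time t; a shift by t times the velocity of i
  gives the statement in the frame where i is at rest.\<close>

lemma moved_disjoint:
  assumes "i \<in> I" "j \<in> I" "i \<noteq> j"
  shows "AE x in torus_lebesgue. \<not> (x - to_torus (f i) \<in> A \<and> x - to_torus (t *\<^sub>R (vel j - vel i)) - to_torus (f j) \<in> A)"
  using AE_torus_shift[OF tile_family_disjoint[OF tile_motion[of t] assms], of "to_torus (t *\<^sub>R vel i)"]
  by eventually_elim (simp add: to_torus_add to_torus_diff scaleR_diff_right algebra_simps)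

definition "static = {i\<in>I. vel i = 0}"

text \<open>The multiple 0 is allowed, so the static tiles belong to \<open>parallel d\<close> for
  every d.\<close>

definition "parallel d = {i\<in>I. \<exists>\<beta>. vel i = \<beta> *\<^sub>R d}"

definition "moving d = {i\<in>I. vel i \<noteq> 0 \<and> (\<exists>\<beta>. vel i = \<beta> *\<^sub>R d)}"

lemma static_subset: "static \<subseteq> I" and parallel_subset: "parallel d \<subseteq> I" and moving_subset: "moving d \<subseteq> I"
  by (auto simp: static_def parallel_def moving_def)

lemma finite_static: "finite static" and finite_moving: "finite (moving d)"
  by (auto simp: static_def moving_def)

lemma parallel_eq: "parallel d = static \<union> moving d"
  by (auto simp: static_def parallel_def moving_def intro: exI[of _ 0])

text \<open>A tile with velocity \<beta> d is displaced by q d at time q / \<beta>, and is then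
  still disjoint from the static tiles; countably many q are treated at once.\<close>

lemma piece_static_disjoint_moving:
  "AE x in torus_lebesgue. x \<in> rat_sat d (piece static) \<longrightarrow> x \<notin> piece (moving d)"
proof -
  have 1: "AE x in torus_lebesgue. \<forall>i\<in>static. \<forall>j\<in>moving d.
      \<not> (x - to_torus (f i) \<in> A \<and> x - to_torus (q *\<^sub>R d) - to_torus (f j) \<in> A)" for q
  proof (intro AE_finite_allI finite_static finite_moving)
    fix i j assume ij': "i \<in> static" "j \<in> moving d"
    then obtain \<beta> where \<beta>: "vel j = \<beta> *\<^sub>R d" "\<beta> \<noteq> 0" by (auto simp: moving_def)
    have ij: "i \<in> I" "j \<in> I" "i \<noteq> j" "vel i = 0" using ij' by (auto simp: static_def moving_def)
    then have "(q / \<beta>) *\<^sub>R (vel j - vel i) = q *\<^sub>R d" using \<beta> by simp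
    then show "AE x in torus_lebesgue. \<not> (x - to_torus (f i) \<in> A \<and> x - to_torus (q *\<^sub>R d) - to_torus (f j) \<in> A)"
      using moved_disjoint[OF ij(1-3), of "q / \<beta>"] by simp
  qed
  have "AE x in torus_lebesgue. \<forall>q\<in>\<rat>. \<not> (x - to_torus (q *\<^sub>R d) \<in> piece static \<and> x \<in> piece (moving d))"
    unfolding AE_ball_countable[OF countable_rat]
  proof
    fix q :: real
    show "AE x in torus_lebesgue. \<not> (x - to_torus (q *\<^sub>R d) \<in> piece static \<and> x \<in> piece (moving d))"
      using AE_torus_shift_diff[OF 1[of "- q"], of "to_torus (q *\<^sub>R d)"]
      by eventually_elim (auto simp: piece_def to_torus_minus)
  qed
  then show ?thesis by eventually_elim (auto simp: rat_sat_def)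
qed

text \<open>Among the parallel tiles the saturation meets only the static ones, so the static
  indicator is a product. The saturation and the character at \<eta> are invariant along d, which
  lets the other factor be replaced by its mean.\<close>

lemma fourier_static_eq_sat:
  assumes dim: "CARD('n) = 2" and "d \<noteq> 0" and \<eta>: "\<eta> \<in> int_vecs" "\<eta> \<bullet> d = 0"
  shows "fourier (indicator (piece static)) \<eta> =
    complex_of_real (measure torus_lebesgue (piece (parallel d))) * fourier (indicator (rat_sat d (piece static))) \<eta>"
proof -
  let ?W = "rat_sat d (piece static)" and ?u = "indicator (piece (parallel d)) :: 'n torus \<Rightarrow> real"
  have [measurable]: "?W \<in> sets torus_lebesgue" by (intro sets_rat_sat sets_piece static_subset)
  have par: "piece (parallel d) \<in> sets torus_lebesgue" by (rule sets_piece[OF parallel_subset])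
  have st: "piece static \<in> sets torus_lebesgue" by (rule sets_piece[OF static_subset])
  have eq: "complex_of_real (indicator B x) = indicator B x" for B and x :: "'n torus" by (simp add: indicator_def)
  have "AE x in torus_lebesgue. indicator (piece static) x * torus_char \<eta> x = complex_of_real (?u x) * (indicator ?W x * torus_char \<eta> x)"
    using piece_static_disjoint_moving[of d]
    by eventually_elim (use subset_rat_sat[of "piece static" d] in \<open>auto simp: parallel_eq piece_Un indicator_def\<close>)
  then have "fourier (indicator (piece static)) \<eta> = (\<integral>x. complex_of_real (?u x) * (indicator ?W x * torus_char \<eta> x) \<partial>torus_lebesgue)"
    unfolding fourier_def using st par torus_char_measurable[OF \<eta>(1)] by (intro integral_cong_AE) auto
  also have "\<dots> = complex_of_real (integral\<^sup>L torus_lebesgue ?u) * (\<integral>x. indicator ?W x * torus_char \<eta> x \<partial>torus_lebesgue)"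
  proof (rule integral_mult_rat_line_invariant[where d = d and B = 1])
    show "integrable torus_lebesgue ?u" using par by (intro integrable_torus_bounded[where B = 1]) (auto simp: indicator_def)
    show "fourier (\<lambda>x. complex_of_real (?u x)) \<xi> = 0" if \<xi>: "\<xi> \<in> int_vecs" "\<xi> \<noteq> 0" "\<xi> \<bullet> d = 0" for \<xi>
      unfolding eq
    proof (rule fourier_piece_level[OF parallel_subset \<xi>(1,2)])
      \<comment> \<open>In the plane, for nonzero \<xi> orthogonal to d, the tiles with
        \<open>\<xi> \<bullet> vel j = 0\<close> are exactly the parallel ones.\<close>
      fix i j assume "i \<in> parallel d" "j \<in> I" "\<xi> \<bullet> vel i = \<xi> \<bullet> vel j"
      then have "\<xi> \<bullet> vel j = 0" using \<xi>(3) by (auto simp: parallel_def)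
      then show "j \<in> parallel d" using two_dim_orthogonal_parallel[OF dim \<open>d \<noteq> 0\<close> \<xi>(2,3)] \<open>j \<in> I\<close> by (auto simp: parallel_def)
    qed
    show "(\<lambda>x. indicator ?W x * torus_char \<eta> x) \<in> borel_measurable torus_lebesgue"
      using torus_char_measurable[OF \<eta>(1)] by (intro borel_measurable_times) auto
  qed (use torus_char_rat_line_invariant[OF \<eta>] in \<open>auto simp: indicator_def rat_sat_shift norm_mult\<close>)
  finally show ?thesis using par by (simp add: fourier_def)
qed

lemma static_line_invariant_rep:
  assumes dim: "CARD('n) = 2" and static: "static \<noteq> {}"
    and D: "D \<subseteq> vel ` I - {0}" "\<forall>w\<in>vel ` I - {0}. \<exists>d\<in>D. \<exists>\<beta>. w = \<beta> *\<^sub>R d"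
    "\<forall>d\<in>D. \<forall>e\<in>D. d \<noteq> e \<longrightarrow> (\<nexists>\<beta>. e = \<beta> *\<^sub>R d)" and d: "d \<in> D"
  shows "line_invariant d (\<lambda>x. x \<in> piece static)"
proof -
  let ?P = "piece static" and ?W = "\<lambda>d. rat_sat d (piece static)"
  define c where "c d = measure torus_lebesgue (piece (parallel d))" for d
  have finD: "finite D" using D(1) by (rule finite_subset) simp
  have P: "?P \<in> sets torus_lebesgue" by (rule sets_piece[OF static_subset])
  have W: "?W d \<in> sets torus_lebesgue" for d by (intro sets_rat_sat P)
  have D0: "e \<noteq> 0" if "e \<in> D" for e using D(1) that by auto
  have FW: "fourier (indicator ?P) \<eta> = c d * fourier (indicator (?W d)) \<eta>" if "d \<in> D" "\<eta> \<in> int_vecs" "\<eta> \<bullet> d = 0" for d \<eta>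
    unfolding c_def by (rule fourier_static_eq_sat[OF dim D0[OF that(1)] that(2,3)])
  have FW0: "fourier (indicator (?W d)) \<eta> = 0" if "\<eta> \<in> int_vecs" "\<eta> \<bullet> d \<noteq> 0" for d \<eta>
    by (rule fourier_rat_sat[OF P that])
  have Winv: "line_invariant d (\<lambda>x. x \<in> ?W d)" for d
    by (rule line_invariant_set_if_fourier[OF W FW0])
  let ?H = "\<lambda>e x. c e * indicator (?W e) x :: real"
  let ?g = "\<lambda>x. complex_of_real ((\<Sum>e\<in>D. ?H e x) - indicator ?P x)"
  have gi: "integrable torus_lebesgue ?g"
  proof -
    have "integrable torus_lebesgue (indicator B :: 'n torus \<Rightarrow> real)" if "B \<in> sets torus_lebesgue" for B
      using that by (intro integrable_torus_bounded[where B = 1]) (auto simp: indicator_def)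
    from this[OF W] this[OF P] show ?thesis by simp
  qed
  have of_real_ind: "complex_of_real (indicator B x) = indicator B x" for B and x :: "'n torus" by (simp add: indicator_def)
  have g_eq: "?g = (\<lambda>x. (\<Sum>e\<in>D. complex_of_real (c e) * indicator (?W e) x) - indicator ?P x)"
    by (simp add: of_real_ind)
  have "AE x in torus_lebesgue. ?g x = integral\<^sup>L torus_lebesgue ?g"
  proof (rule AE_const_if_fourier_0[OF gi])
    fix \<xi> :: "real ^ 'n" assume \<xi>: "\<xi> \<in> int_vecs" "\<xi> \<noteq> 0"
    have iS: "integrable torus_lebesgue (\<lambda>x. complex_of_real (c e) * indicator (?W e) x)" for e using W by simp
    have F: "fourier ?g \<xi> = (\<Sum>e\<in>D. c e * fourier (indicator (?W e)) \<xi>) - fourier (indicator ?P) \<xi>"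
      unfolding g_eq using iS P \<xi>(1)
      by (subst fourier_diff) (auto intro!: Bochner_Integration.integrable_sum simp: fourier_sum fourier_cmult)
    show "fourier ?g \<xi> = 0"
    proof (cases "\<exists>e\<in>D. \<xi> \<bullet> e = 0")
      \<comment> \<open>At most one direction of D is orthogonal to \<xi>; only its saturation
        contributes, and its share is that of the static set.\<close>
      case True
      then obtain e where e: "e \<in> D" "\<xi> \<bullet> e = 0" by blast
      have "\<xi> \<bullet> e' \<noteq> 0" if "e' \<in> D" "e' \<noteq> e" for e'
        using two_dim_orthogonal_parallel[OF dim D0[OF e(1)] \<xi>(2) e(2), of e'] D(3) e(1) that by auto
      then have "(\<Sum>e\<in>D. c e * fourier (indicator (?W e)) \<xi>) = (\<Sum>e\<in>{e}. c e * fourier (indicator (?W e)) \<xi>)"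
        using e(1) finD FW0[OF \<xi>(1)] by (intro sum.mono_neutral_right) auto
      then show ?thesis using F FW[OF e(1) \<xi>(1) e(2)] by simp
    next
      case False
      then have "(\<Sum>e\<in>D. c e * fourier (indicator (?W e)) \<xi>) = 0"
        using FW0[OF \<xi>(1)] by (intro sum.neutral) auto
      \<comment> \<open>When no direction is orthogonal to \<xi>, the static tiles form the whole
        level set of value 0.\<close>
      moreover have "fourier (indicator ?P) \<xi> = 0"
      proof (rule fourier_piece_level[OF static_subset \<xi>])
        fix i j assume ij: "i \<in> static" "j \<in> I" "\<xi> \<bullet> vel i = \<xi> \<bullet> vel j"
        show "j \<in> static"
        proof (rule ccontr)
          assume "j \<notin> static"
          then have vj: "vel j \<in> vel ` I - {0}" using ij(2) by (auto simp: static_def)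
          then obtain e \<beta> where e: "e \<in> D" "vel j = \<beta> *\<^sub>R e" using D(2) by blast
          then have "\<beta> \<noteq> 0" using vj by auto
          then have "\<xi> \<bullet> e = 0" using ij e by (auto simp: static_def)
          then show False using False e(1) by blast
        qed
      qed
      ultimately show ?thesis using F by simp
    qed
  qed
  then have "AE x in torus_lebesgue. (\<Sum>e\<in>D. ?H e x) - indicator ?P x = Re (integral\<^sup>L torus_lebesgue ?g)"
    by eventually_elim (metis Re_complex_of_real)
  then obtain k where k: "AE x in torus_lebesgue. (\<Sum>e\<in>D. ?H e x) - indicator ?P x = k" by blast
  have sum_eq: "(\<Sum>e\<in>D. ?H e x) = ?H d x + (\<Sum>e\<in>D - {d}. ?H e x)" for x
    by (rule sum.remove[OF finD d])
  \<comment> \<open>The indicator of the static set is integer valued, so modulo 1 the sum over the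
    directions is the constant k.\<close>
  have "\<exists>\<kappa>. AE x in torus_lebesgue. ?H d x - \<kappa> \<in> \<int>"
  proof (rule const_mod_1_of_sum[where K = "?H d" and D = "D - {d}" and H = ?H and d = d and R = "{0, c d}" and c = k])
    have inv: "line_invariant e (?H e)" for e
      using line_invariant_comp[OF Winv[of e], of "\<lambda>b. c e * of_bool b"] by (simp add: indicator_def of_bool_def)
    show "line_invariant d (?H d)" by (rule inv)
    show "line_invariant e (?H e)" if "e \<in> D - {d}" for e by (rule inv)
    show "\<exists>a b. h = a *\<^sub>R d + b *\<^sub>R e" if "e \<in> D - {d}" for e h
    proof -
      have e: "e \<in> D" "d \<noteq> e" using that by auto
      have "\<nexists>\<beta>. e = \<beta> *\<^sub>R d" using bspec[OF bspec[OF D(3) d] e(1)] e(2) by (rule mp)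
      with two_dim_cases[OF dim D0[OF d], of e] have "\<forall>h. \<exists>a b. h = a *\<^sub>R d + b *\<^sub>R e" by (simp only: simp_thms)
      then show ?thesis by (rule spec)
    qed
    show "AE x in torus_lebesgue. ?H d x + (\<Sum>e\<in>D - {d}. ?H e x) - k \<in> \<int>"
      using k
    proof eventually_elim
      case (elim x)
      have "?H d x + (\<Sum>e\<in>D - {d}. ?H e x) - k = indicator ?P x"
        using elim sum_eq[of x] by linarith
      then show ?case by (simp only:) (simp add: indicator_def)
    qed
  qed (use finD W in \<open>auto simp: indicator_def\<close>)
  then obtain \<kappa> where \<kappa>: "AE x in torus_lebesgue. ?H d x - \<kappa> \<in> \<int>" by blast
  have "d \<in> vel ` I - {0}" using d D(1) by (rule subsetD[rotated])
  then obtain m where m: "m \<in> I" "vel m = d" "d \<noteq> 0" by blast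
  have "vel m = 1 *\<^sub>R d" using m by simp
  then have "m \<in> moving d" unfolding moving_def using m by blast
  then have mov: "moving d \<noteq> {}" by blast
  \<comment> \<open>The tiles moving along d avoid the saturation, so it is not conull; containing
    the static set, it is not null. Hence \<open>?H d\<close> takes both values 0 and
    \<open>c d\<close> within one class modulo 1.\<close>
  have "\<not> (AE x in torus_lebesgue. x \<in> ?W d)"
  proof
    assume "AE x in torus_lebesgue. x \<in> ?W d"
    with piece_static_disjoint_moving[of d] have "AE x in torus_lebesgue. x \<notin> piece (moving d)" by eventually_elim simp
    moreover have "piece (moving d) \<in> sets torus_lebesgue" by (rule sets_piece[OF moving_subset])
    ultimately have "measure torus_lebesgue (piece (moving d)) = 0" by (simp add: torus.prob_eq_0)
    then show False using measure_piece_pos[OF moving_subset mov] by simp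
  qed
  from ex_if_not_AE[OF this \<kappa>] obtain x where x: "x \<notin> ?W d" "?H d x - \<kappa> \<in> \<int>" by blast
  have "\<not> (AE x in torus_lebesgue. x \<notin> ?W d)"
  proof
    assume "AE x in torus_lebesgue. x \<notin> ?W d"
    then have "AE x in torus_lebesgue. x \<notin> ?P" by eventually_elim (use subset_rat_sat in blast)
    then have "measure torus_lebesgue ?P = 0" using P by (simp add: torus.prob_eq_0)
    then show False using measure_piece_pos[OF static_subset static] by simp
  qed
  from ex_if_not_AE[OF this \<kappa>] obtain y where y: "y \<in> ?W d" "?H d y - \<kappa> \<in> \<int>" by blast
  have "?H d y - \<kappa> - (?H d x - \<kappa>) = c d" using x(1) y(1) by simp
  with Ints_diff[OF y(2) x(2)] have "c d \<in> \<int>" by simp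
  moreover have "0 < c d" unfolding c_def using mov parallel_eq by (intro measure_piece_pos parallel_subset) auto
  moreover have "c d \<le> 1" unfolding c_def by simp
  ultimately have c1: "c d = 1" by (auto elim!: Ints_cases)
  \<comment> \<open>With \<open>c d\<close> = 1 the identity at frequency 0 gives equal measures,
    and the static set lies in its saturation.\<close>
  have "measure torus_lebesgue ?P = measure torus_lebesgue (?W d)"
    using FW[OF d int_vecs_0] c1 P W by (simp add: fourier_indicator_0)
  then have "measure torus_lebesgue (?W d - ?P) = 0"
    using torus.finite_measure_Diff[OF W P subset_rat_sat] by simp
  moreover have "?W d - ?P \<in> sets torus_lebesgue" using W P by (rule sets.Diff)
  ultimately have "AE x in torus_lebesgue. x \<notin> ?W d - ?P" by (simp only: torus.prob_eq_0)
  then have eq: "AE x in torus_lebesgue. x \<in> ?W d \<longleftrightarrow> x \<in> ?P"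
    by eventually_elim (use subset_rat_sat in blast)
  show ?thesis
    unfolding line_invariant_def
  proof
    fix t
    show "AE x in torus_lebesgue. (x - to_torus (t *\<^sub>R d) \<in> ?P) = (x \<in> ?P)"
      using eq AE_torus_shift_diff[OF eq, of "to_torus (t *\<^sub>R d)"] line_invariantD[OF Winv[of d], of t]
      by eventually_elim simp
  qed
qed

lemma static_line_invariant:
  assumes "CARD('n) = 2" "static \<noteq> {}" "i \<in> I"
  shows "line_invariant (vel i) (\<lambda>x. x \<in> piece static)"
proof (cases "vel i = 0")
  case False
  obtain D where D: "D \<subseteq> vel ` I - {0}" "\<forall>w\<in>vel ` I - {0}. \<exists>d\<in>D. \<exists>\<beta>. w = \<beta> *\<^sub>R d"
    "\<forall>d\<in>D. \<forall>e\<in>D. d \<noteq> e \<longrightarrow> (\<nexists>\<beta>. e = \<beta> *\<^sub>R d)"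
    using exists_direction_representatives[of "vel ` I - {0}"] by auto
  obtain d \<beta> where "d \<in> D" "vel i = \<beta> *\<^sub>R d" using D(2) False assms(3) by blast
  then show ?thesis using line_invariant_scaleR[OF static_line_invariant_rep[OF assms(1,2) D]] by simp
qed (simp add: line_invariant_def)

lemma static_not_const:
  assumes "static \<noteq> {}" "static \<noteq> I"
  shows "\<not> (AE x in torus_lebesgue. indicator (piece static) x = (c :: complex))"
proof
  assume c: "AE x in torus_lebesgue. indicator (piece static) x = c"
  have "piece static \<in> sets torus_lebesgue" by (rule sets_piece[OF static_subset])
  moreover have "static \<subset> I" using assms(2) static_subset by blast
  ultimately show False
    using indicator_const_measure[OF _ c] measure_piece_pos[OF static_subset assms(1)] measure_piece_less_1[of static]
    by auto
qed

text \<open>The static set is neither null nor conull, so its indicator has a nonzero frequency;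
  invariance along every velocity makes this one frequency orthogonal to all of them.\<close>

theorem velocities_parallel:
  assumes dim: "CARD('n) = 2" and static: "static \<noteq> {}" "static \<noteq> I"
  obtains \<eta> u v where "\<eta> \<in> int_vecs" "u \<in> int_vecs" "v \<in> int_vecs" "\<eta> \<bullet> u = 1" "\<eta> \<bullet> v = 0" "v \<noteq> 0"
    "\<And>i. i \<in> I \<Longrightarrow> \<exists>\<beta>. vel i = \<beta> *\<^sub>R v"
proof -
  let ?P = "piece static"
  have P: "?P \<in> sets torus_lebesgue" by (rule sets_piece[OF static_subset])
  let ?ind = "indicator ?P :: 'n torus \<Rightarrow> complex"
  have inv: "line_invariant (vel i) ?ind" if "i \<in> I" for i
    using line_invariant_comp[OF static_line_invariant[OF dim static(1) that], of of_bool]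
    unfolding indicator_def[abs_def] .
  obtain \<xi> where \<xi>: "\<xi> \<in> int_vecs" "\<xi> \<noteq> 0" "fourier ?ind \<xi> \<noteq> 0"
    using AE_const_if_fourier_0[of ?ind] static_not_const[OF static] P by auto
  have orth: "\<xi> \<bullet> vel i = 0" if "i \<in> I" for i
    using fourier_0_if_rat_line_invariant[of ?ind \<xi> "vel i"] P \<xi> line_invariantD[OF inv[OF that]] by auto
  obtain \<eta> u v r where *: "\<eta> \<in> int_vecs" "u \<in> int_vecs" "v \<in> int_vecs" "\<eta> \<bullet> u = 1" "\<eta> \<bullet> v = 0" "v \<noteq> 0"
    "\<xi> = r *\<^sub>R \<eta>" "r \<noteq> 0" by (rule two_dim_primitive_normal[OF dim \<xi>(1,2)])
  have "\<exists>\<beta>. vel i = \<beta> *\<^sub>R v" if "i \<in> I" for i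
  proof (rule two_dim_orthogonal_parallel[OF dim *(6)])
    show "\<eta> \<noteq> 0" using *(4) by auto
    show "\<eta> \<bullet> vel i = 0" using orth[OF that] * by simp
  qed (rule *)
  with * that show thesis by blast
qed

text \<open>For \<xi> not orthogonal to v, the value \<open>\<xi> \<bullet> vel i\<close> determines
  the velocity, so a velocity class is closed under equality of these values.\<close>

lemma velocity_class_fourier:
  assumes "\<And>i. i \<in> I \<Longrightarrow> \<exists>\<beta>. vel i = \<beta> *\<^sub>R v" and \<xi>: "\<xi> \<in> int_vecs" "\<xi> \<bullet> v \<noteq> 0"
  shows "fourier (indicator (piece {i\<in>I. vel i = w})) \<xi> = 0"
proof (rule fourier_piece_level[OF _ \<xi>(1)])
  show "{i \<in> I. vel i = w} \<subseteq> I" by blast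
  fix i j assume ij: "i \<in> {i\<in>I. vel i = w}" "j \<in> I" "\<xi> \<bullet> vel i = \<xi> \<bullet> vel j"
  obtain \<beta> \<gamma> where "vel i = \<beta> *\<^sub>R v" "vel j = \<gamma> *\<^sub>R v" using assms(1) ij by blast
  moreover from this have "\<beta> = \<gamma>" using ij(3) \<xi>(2) by simp
  ultimately show "j \<in> {i\<in>I. vel i = w}" using ij by simp
qed (use \<xi>(2) in auto)

end

subsection \<open>Open connected tiles\<close>

lemma frac_eq_iff_Ints: "frac r = frac s \<longleftrightarrow> r - s \<in> \<int>" for r s :: real
proof
  assume "frac r = frac s"
  then have "r - s = of_int (\<lfloor>r\<rfloor> - \<lfloor>s\<rfloor>)" by (simp add: frac_def)
  then show "r - s \<in> \<int>" by (metis Ints_of_int)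
next
  assume "r - s \<in> \<int>"
  then show "frac r = frac s" using frac_add_int_right[of "r - s" s] by simp
qed

text \<open>The circle-valued coordinate along \<eta>, cut open at c and read in [0, 1); it jumps
  where the coordinate is c modulo 1.\<close>

definition torus_coord :: "real ^ 'n \<Rightarrow> real \<Rightarrow> ('n::finite) torus \<Rightarrow> real"
  where "torus_coord \<eta> c x = frac (\<eta> \<bullet> rep_torus x - c)"

lemma torus_coord_to_torus:
  assumes "\<eta> \<in> int_vecs"
  shows "torus_coord \<eta> c (to_torus p) = frac (\<eta> \<bullet> p - c)"
  using inner_int_vecs[OF assms rep_to_torus_diff[of p]]
  by (simp add: torus_coord_def frac_eq_iff_Ints inner_diff_right)

lemma torus_coord_nonneg: "0 \<le> torus_coord \<eta> c x" and torus_coord_less_1: "torus_coord \<eta> c x < 1"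
  by (simp_all add: torus_coord_def frac_lt_1)

lemma torus_coord_measurable:
  fixes \<eta> :: "real ^ 'n::finite"
  assumes "\<eta> \<in> int_vecs"
  shows "torus_coord \<eta> c \<in> borel_measurable torus_lebesgue"
proof (rule borel_measurable_torusI)
  have 1: "(\<lambda>p :: real ^ 'n. \<eta> \<bullet> p - c) \<in> borel_measurable borel"
    by (intro borel_measurable_continuous_onI continuous_intros)
  have 2: "(frac :: real \<Rightarrow> real) \<in> borel_measurable borel"
    unfolding frac_def[abs_def] by measurable
  have "(\<lambda>p :: real ^ 'n. frac (\<eta> \<bullet> p - c)) \<in> borel_measurable borel"
    using measurable_compose[OF 1 2] .
  then show "(\<lambda>p. torus_coord \<eta> c (to_torus p)) \<in> borel_measurable lebesgue"
    by (simp add: torus_coord_to_torus[OF assms] measurable_completion)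
qed

text \<open>Openness along the line replaces a real parameter by a rational one, so that for open
  sets \<open>rat_sat\<close> accounts for whole lines.\<close>

lemma open_torus_line_rat:
  fixes A :: "('n::finite) torus set"
  assumes "open A" "to_torus (p + t *\<^sub>R v) \<in> A"
  obtains q where "q \<in> \<rat>" "to_torus (p + q *\<^sub>R v) \<in> A"
proof -
  let ?O = "(\<lambda>t. p + t *\<^sub>R v) -` (to_torus -` A)"
  have "open (to_torus -` A)" using assms(1) by (simp add: open_torus_def)
  then have "open ?O" by (rule open_vimage) (intro continuous_intros)
  moreover have "t \<in> ?O" using assms(2) by simp
  ultimately obtain e where e: "e > 0" "\<And>s. dist s t < e \<Longrightarrow> s \<in> ?O" unfolding open_dist by blast
  obtain q where "q \<in> \<rat>" "t < q" "q < t + e" using Rats_dense_in_real[of t "t + e"] e(1) by auto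
  then show thesis using that e(2)[of q] by (auto simp: dist_real_def)
qed

text \<open>On a connected set, the difference of two lifts of the circle-valued coordinate is locally constant, hence constant.\<close>

lemma torus_coord_diff_const:
  fixes A :: "('n::finite) torus set"
  assumes A: "open A" "connected A" and \<eta>: "\<eta> \<in> int_vecs"
    and g: "\<And>p. to_torus p \<in> A \<Longrightarrow> \<eta> \<bullet> (p + g) - c \<notin> \<int>" and h: "\<And>p. to_torus p \<in> A \<Longrightarrow> \<eta> \<bullet> (p + h) - c \<notin> \<int>"
  shows "\<exists>k. \<forall>a\<in>A. torus_coord \<eta> c (a + to_torus g) = torus_coord \<eta> c (a + to_torus h) + k"
proof (cases "A = {}")
  case False
  then obtain p0 where p0: "to_torus p0 \<in> A" using surj_to_torus by (metis ex_in_conv surjE)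
  \<comment> \<open>Each floor depends on the representative p, but a lattice shift of p changes
    both equally, so m descends to the torus.\<close>
  define m where "m p = \<lfloor>\<eta> \<bullet> (p + g) - c\<rfloor> - \<lfloor>\<eta> \<bullet> (p + h) - c\<rfloor>" for p
  have m_per: "m p = m q" if pq: "to_torus p = to_torus q" for p q
  proof -
    obtain z where z: "\<eta> \<bullet> (p - q) = of_int z"
      using inner_int_vecs[OF \<eta>, of "p - q"] pq by (auto simp: to_torus_eq_iff elim: Ints_cases)
    have "\<eta> \<bullet> (p + r) - c = (\<eta> \<bullet> (q + r) - c) + of_int z" for r
      using z by (simp add: inner_diff_right inner_add_right)
    then have "\<lfloor>\<eta> \<bullet> (p + r) - c\<rfloor> = \<lfloor>\<eta> \<bullet> (q + r) - c\<rfloor> + z" for r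
      by (simp only: floor_add_int)
    then show ?thesis by (simp add: m_def)
  qed
  define U where "U Q = {a \<in> A. Q (m (rep_torus a))}" for Q
  have mem_U: "to_torus p \<in> U Q \<longleftrightarrow> to_torus p \<in> A \<and> Q (m p)" for p Q
    using m_per[of "rep_torus (to_torus p)" p] by (simp add: U_def)
  have "open (U Q)" for Q
    unfolding open_torus_def
  proof -
    \<comment> \<open>Open strips on which the floor equals k. Since the coordinates avoid c modulo
      1 on \<open>A\<close>, the strips for g and those for h each cover the lift of
      \<open>A\<close>.\<close>
    let ?B = "\<lambda>k r. {p. of_int k < \<eta> \<bullet> (p + r) - c} \<inter> {p. \<eta> \<bullet> (p + r) - c < of_int k + 1}"
    have fl: "p \<in> ?B \<lfloor>\<eta> \<bullet> (p + r) - c\<rfloor> r" if "\<eta> \<bullet> (p + r) - c \<notin> \<int>" for p r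
    proof -
      have "of_int \<lfloor>\<eta> \<bullet> (p + r) - c\<rfloor> \<noteq> \<eta> \<bullet> (p + r) - c" using that by (metis Ints_of_int)
      then have "of_int \<lfloor>\<eta> \<bullet> (p + r) - c\<rfloor> < \<eta> \<bullet> (p + r) - c"
        using of_int_floor_le[of "\<eta> \<bullet> (p + r) - c"] by (simp only: order_less_le simp_thms)
      then show ?thesis using floor_correct[of "\<eta> \<bullet> (p + r) - c"] by (intro IntI CollectI) auto
    qed
    have bf: "\<lfloor>\<eta> \<bullet> (p + r) - c\<rfloor> = k" if "p \<in> ?B k r" for p r k
      using that by (simp add: floor_eq_iff)
    have "to_torus -` U Q = to_torus -` A \<inter> (\<Union>(k, l)\<in>{(k, l). Q (k - l)}. ?B k g \<inter> ?B l h)" (is "?L = ?R")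
    proof
      show "?L \<subseteq> ?R"
      proof
        fix p assume "p \<in> ?L"
        then have p: "to_torus p \<in> A" "Q (m p)" by (auto simp: mem_U)
        show "p \<in> ?R" using fl[OF g[OF p(1)]] fl[OF h[OF p(1)]] p
          by (intro IntI UN_I[of "(\<lfloor>\<eta> \<bullet> (p + g) - c\<rfloor>, \<lfloor>\<eta> \<bullet> (p + h) - c\<rfloor>)"]) (auto simp: m_def)
      qed
      show "?R \<subseteq> ?L"
      proof
        fix p assume "p \<in> ?R"
        then obtain k l where "to_torus p \<in> A" "Q (k - l)" "p \<in> ?B k g" "p \<in> ?B l h" by auto
        then show "p \<in> ?L" using bf[of p k g] bf[of p l h] by (simp add: mem_U m_def)
      qed
    qed
    also have "open \<dots>"
      using A(1) by (intro open_Int open_UN) (auto simp: open_torus_def split_beta intro!: open_Int open_Collect_less continuous_intros)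
    finally show "open (to_torus -` U Q)" .
  qed
  from connectedD[OF A(2) this[of "\<lambda>z. z = m p0"] this[of "\<lambda>z. z \<noteq> m p0"]]
  have "U (\<lambda>z. z = m p0) \<inter> A = {} \<or> U (\<lambda>z. z \<noteq> m p0) \<inter> A = {}"
    by (auto simp: U_def)
  moreover have "to_torus p0 \<in> U (\<lambda>z. z = m p0) \<inter> A" using p0 by (simp add: mem_U)
  ultimately have empty: "U (\<lambda>z. z \<noteq> m p0) \<inter> A = {}" by blast
  have const: "m p = m p0" if "to_torus p \<in> A" for p
  proof (rule ccontr)
    assume "m p \<noteq> m p0"
    then have "to_torus p \<in> U (\<lambda>z. z \<noteq> m p0) \<inter> A" using that by (simp add: mem_U)
    then show False using empty by blast
  qed
  show ?thesis
  proof (intro exI[of _ "\<eta> \<bullet> (g - h) - of_int (m p0)"] ballI)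
    fix a assume a: "a \<in> A"
    obtain p where p: "a = to_torus p" by (rule torus_cases)
    have "of_int (m p) = of_int \<lfloor>\<eta> \<bullet> (p + g) - c\<rfloor> - (of_int \<lfloor>\<eta> \<bullet> (p + h) - c\<rfloor> :: real)" by (simp add: m_def)
    then show "torus_coord \<eta> c (a + to_torus g) = torus_coord \<eta> c (a + to_torus h) + (\<eta> \<bullet> (g - h) - of_int (m p0))"
      using const[of p] a by (simp add: p torus_coord_to_torus[OF \<eta>] frac_def inner_add_right inner_diff_right flip: to_torus_add)
  qed
qed simp

lemma integral_torus_half_turn:
  fixes h :: "('n::finite) torus \<Rightarrow> complex"
  assumes "h \<in> borel_measurable torus_lebesgue" "AE x in torus_lebesgue. h (x - a) = - h x"
  shows "integral\<^sup>L torus_lebesgue h = 0"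
proof -
  have "integral\<^sup>L torus_lebesgue h = (\<integral>x. h (x - a) \<partial>torus_lebesgue)"
    by (rule integral_torus_shift_diff[OF assms(1), symmetric])
  also have "\<dots> = (\<integral>x. - h x \<partial>torus_lebesgue)"
    using assms by (intro integral_cong_AE measurable_compose[OF measurable_torus_shift_diff]) auto
  also have "\<dots> = - integral\<^sup>L torus_lebesgue h" by simp
  finally show ?thesis by simp
qed

lemma norm_exp_minus_one_le:
  fixes r :: real
  assumes "0 \<le> r"
  shows "\<bar>exp (- r) - 1\<bar> \<le> r"
  using exp_ge_add_one_self[of "- r"] assms by (simp add: abs_le_iff)

section \<open>Tiles of equal velocity and equal transversal position\<close>

locale planar_connected_tiling = torus_tiling f n A \<pi>
  for f :: "nat \<Rightarrow> real ^ ('n :: finite)" and n A \<pi> +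
  fixes \<eta> u v :: "real ^ 'n"
  assumes dim: "CARD('n) = 2" and \<eta>_int: "\<eta> \<in> int_vecs" and u_int: "u \<in> int_vecs"
    and \<eta>_u: "\<eta> \<bullet> u = 1" and \<eta>_v: "\<eta> \<bullet> v = 0" and v_nonzero: "v \<noteq> 0"
    and vel_parallel: "i \<in> I \<Longrightarrow> \<exists>\<beta>. vel i = \<beta> *\<^sub>R v"
    and not_all: "\<exists>i\<in>I. vel i \<noteq> 0" and static_ne: "static \<noteq> {}"
    and open_A: "open A" and connected_A: "connected A"
begin

text \<open>Subtracting an integer multiple of the lattice vector u leaves a vector orthogonal to
  \<eta>, hence a multiple of v.\<close>

lemma Ints_normal_decomp:
  assumes "\<eta> \<bullet> p \<in> \<int>"
  obtains k t where "k \<in> int_vecs" "p = t *\<^sub>R v + k"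
proof -
  obtain z where z: "\<eta> \<bullet> p = of_int z" using assms by (auto elim: Ints_cases)
  have "\<eta> \<noteq> 0" using \<eta>_u by auto
  moreover have "\<eta> \<bullet> (p - of_int z *\<^sub>R u) = 0" using z \<eta>_u by (simp add: inner_diff_right)
  ultimately obtain t where "p - of_int z *\<^sub>R u = t *\<^sub>R v"
    using two_dim_orthogonal_parallel[OF dim v_nonzero _ \<eta>_v] by blast
  then have "p = t *\<^sub>R v + of_int z *\<^sub>R u" by (simp add: algebra_simps)
  moreover have "of_int z *\<^sub>R u \<in> int_vecs" using u_int by (auto simp: int_vecs_def)
  ultimately show thesis using that by blast
qed

definition vclass :: "real ^ 'n \<Rightarrow> nat set"
  where "vclass w = {i\<in>I. vel i = w}"

lemma vclass_subset: "vclass w \<subseteq> I"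
  by (auto simp: vclass_def)

text \<open>A static tile and a moving tile both exist, and no class contains both.\<close>

lemma vclass_psubset: "vclass w \<subset> I"
proof -
  obtain i j where "i \<in> I" "vel i = 0" "j \<in> I" "vel j \<noteq> 0" using not_all static_ne by (auto simp: static_def)
  then have "i \<notin> vclass w \<or> j \<notin> vclass w" "i \<in> I" "j \<in> I" by (auto simp: vclass_def)
  then show ?thesis using vclass_subset[of w] by blast
qed

lemma vclass_line_invariant: "line_invariant v (\<lambda>x. x \<in> piece (vclass w))"
  unfolding vclass_def
  by (rule line_invariant_set_if_fourier[OF sets_piece velocity_class_fourier[OF vel_parallel]]) auto

lemma rat_sat_subset_AE:
  assumes "line_invariant v (\<lambda>x. x \<in> B)"
  shows "AE x in torus_lebesgue. x \<in> rat_sat v B \<longrightarrow> x \<in> B"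
proof -
  have "AE x in torus_lebesgue. \<forall>q\<in>\<rat>. (x - to_torus (q *\<^sub>R v) \<in> B) = (x \<in> B)"
    unfolding AE_ball_countable[OF countable_rat] using line_invariantD[OF assms] by blast
  then show ?thesis by eventually_elim (auto simp: rat_sat_def)
qed

text \<open>The union of the class is invariant along v and not conull, so its rational saturation
  misses a point; as \<open>A\<close> is open, the entire real line through that point is missed.
  The transversal coordinate is cut at this line.\<close>

lemma exists_missed_line:
  obtains p0 where "\<And>t i. i \<in> vclass w \<Longrightarrow> to_torus (p0 + t *\<^sub>R v - f i) \<notin> A"
proof -
  let ?B = "piece (vclass w)"
  have B: "?B \<in> sets torus_lebesgue" by (rule sets_piece[OF vclass_subset])
  have "\<not> (AE x in torus_lebesgue. x \<in> rat_sat v ?B)"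
  proof
    assume "AE x in torus_lebesgue. x \<in> rat_sat v ?B"
    with rat_sat_subset_AE[OF vclass_line_invariant] have "AE x in torus_lebesgue. x \<in> ?B" by eventually_elim blast
    then have "measure torus_lebesgue ?B = 1" using torus.prob_eq_1[OF B] by simp
    then show False using measure_piece_less_1[OF vclass_psubset[of w]] by simp
  qed
  from ex_if_not_AE[OF this AE_I2[of _ "\<lambda>_. True"]] obtain x where x: "x \<notin> rat_sat v ?B" by blast
  obtain p0 where p0: "x = to_torus p0" by (rule torus_cases)
  have "to_torus (p0 + t *\<^sub>R v - f i) \<notin> A" if i: "i \<in> vclass w" for t i
  proof
    assume "to_torus (p0 + t *\<^sub>R v - f i) \<in> A"
    then have "to_torus ((p0 - f i) + t *\<^sub>R v) \<in> A" by (simp add: algebra_simps)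
    from open_torus_line_rat[OF open_A this] obtain q where q: "q \<in> \<rat>" "to_torus ((p0 - f i) + q *\<^sub>R v) \<in> A" .
    have "x - to_torus ((- q) *\<^sub>R v) \<in> ?B"
      using q(2) i unfolding piece_def p0 by (auto simp: to_torus_add to_torus_diff to_torus_minus algebra_simps)
    then have "x \<in> rat_sat v ?B" unfolding rat_sat_def using q(1) by (intro CollectI bexI[of _ "- q"]) auto
    then show False using x by blast
  qed
  then show thesis using that by blast
qed

text \<open>Integrality means equal position transversal to v: the translations differ by a multiple
  of v modulo the lattice.\<close>

definition sclass :: "nat \<Rightarrow> nat set"
  where "sclass i = {j\<in>I. vel j = vel i \<and> \<eta> \<bullet> (f j - f i) \<in> \<int>}"

lemma sclass_subset: "sclass i \<subseteq> I"
  by (auto simp: sclass_def)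

text \<open>The velocity class S by itself gives one vanishing sum. Weights that are constant along
  v keep the integral zero and bring the positions into the sum, through the constants
  \<open>c j\<close>.\<close>

lemma sclass_fourier:
  assumes i: "i \<in> I" and \<xi>: "\<xi> \<in> int_vecs" "\<xi> \<bullet> v \<noteq> 0"
  shows "fourier (indicator (piece (sclass i))) \<xi> = 0"
proof (cases "fourier (indicator A) \<xi> = 0")
  case False
  define S where "S = vclass (vel i)"
  have S: "S \<subseteq> I" "finite S" "i \<in> S" using i by (auto simp: S_def vclass_def)
  obtain p0 where p0: "\<And>t j. j \<in> S \<Longrightarrow> to_torus (p0 + t *\<^sub>R v - f j) \<notin> A"
    using exists_missed_line[of "vel i"] unfolding S_def by blast
  define Y where "Y = torus_coord \<eta> (\<eta> \<bullet> p0)"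
  \<comment> \<open>A point of tile j at which the coordinate jumps would lie on the missed
    line.\<close>
  have nonint: "\<eta> \<bullet> (p + f j) - \<eta> \<bullet> p0 \<notin> \<int>" if "to_torus p \<in> A" "j \<in> S" for p j
  proof
    assume "\<eta> \<bullet> (p + f j) - \<eta> \<bullet> p0 \<in> \<int>"
    then have "\<eta> \<bullet> (p + f j - p0) \<in> \<int>" by (simp add: inner_diff_right)
    then obtain k t where k: "k \<in> int_vecs" "p + f j - p0 = t *\<^sub>R v + k" by (rule Ints_normal_decomp)
    then have "p - (p0 + t *\<^sub>R v - f j) = k" by (simp add: algebra_simps)
    then have "to_torus p = to_torus (p0 + t *\<^sub>R v - f j)" using k(1) by (simp add: to_torus_eq_iff)
    then show False using that p0 by metis
  qed
  have "\<exists>k. \<forall>a\<in>A. Y (a + to_torus (f j)) = Y (a + to_torus (f i)) + k" if "j \<in> S" for j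
    unfolding Y_def by (rule torus_coord_diff_const[OF open_A connected_A \<eta>_int nonint nonint]) (use that S in auto)
  then obtain c where c: "\<And>j a. j \<in> S \<Longrightarrow> a \<in> A \<Longrightarrow> Y (a + to_torus (f j)) = Y (a + to_torus (f i)) + c j" by metis
  have [measurable]: "Y \<in> borel_measurable torus_lebesgue" unfolding Y_def by (rule torus_coord_measurable[OF \<eta>_int])
  have Y_bounds: "0 \<le> Y x" "Y x \<le> 1" for x
    using torus_coord_nonneg[of \<eta> "\<eta> \<bullet> p0" x] torus_coord_less_1[of \<eta> "\<eta> \<bullet> p0" x] by (simp_all add: Y_def)
  have Y_inv: "Y (x - to_torus (t *\<^sub>R v)) = Y x" for x t
    by (cases x rule: torus_cases)
      (simp add: Y_def torus_coord_to_torus[OF \<eta>_int] inner_diff_right \<eta>_v flip: to_torus_diff)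
  have [measurable]: "torus_char \<xi> \<in> borel_measurable torus_lebesgue" by (rule torus_char_measurable[OF \<xi>(1)])
  define E where "E l x = complex_of_real (exp (- l * Y x))" for l x
  have [measurable]: "E l \<in> borel_measurable torus_lebesgue" for l unfolding E_def[abs_def] by measurable
  have E_bound: "norm (E l x) \<le> 1" if "l \<ge> 0" for l x
    using that Y_bounds[of x] by (simp add: E_def)
  note [measurable] = sets_A
  have pS: "piece S \<in> sets torus_lebesgue" by (rule sets_piece[OF S(1)])
  \<comment> \<open>The contribution of tile i, pulled back to \<open>A\<close>; the other tiles of
    S give the same integral up to explicit factors.\<close>
  define \<Phi> where "\<Phi> l = (\<integral>x. indicator A x * torus_char \<xi> x * E l (x + to_torus (f i)) \<partial>torus_lebesgue)" for l
  have \<Phi>_int: "integrable torus_lebesgue (\<lambda>x. indicator A x * torus_char \<xi> x * E l (x + to_torus (f i)))" if "l \<ge> 0" for l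
    using E_bound[OF that]
    by (intro integrable_torus_bounded[where B = 1] borel_measurable_times measurable_compose[OF measurable_torus_shift])
       (auto simp: norm_mult indicator_def)
  have E0: "E 0 x = 1" for x by (simp add: E_def)
  have \<Phi>0: "\<Phi> 0 = fourier (indicator A) \<xi>" by (simp add: \<Phi>_def fourier_def E0)
  have \<Phi>_cont: "norm (\<Phi> l - \<Phi> 0) \<le> l" if "l \<ge> 0" for l
  proof -
    let ?F = "\<lambda>l x. indicator A x * torus_char \<xi> x * E l (x + to_torus (f i))"
    have "\<Phi> l - \<Phi> 0 = (\<integral>x. ?F l x - ?F 0 x \<partial>torus_lebesgue)"
      unfolding \<Phi>_def using \<Phi>_int[OF that] \<Phi>_int[of 0] by simp
    also have "norm \<dots> \<le> (\<integral>x. norm (?F l x - ?F 0 x) \<partial>torus_lebesgue)" by (rule integral_norm_bound)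
    also have "\<dots> \<le> (\<integral>x. l \<partial>(torus_lebesgue :: 'n torus measure))"
    proof (rule integral_mono)
      show "integrable torus_lebesgue (\<lambda>x. norm (?F l x - ?F 0 x))" using \<Phi>_int[OF that] \<Phi>_int[of 0] by simp
      fix x :: "'n torus"
      let ?y = "x + to_torus (f i)"
      have "norm (?F l x - ?F 0 x) = norm (indicator A x * torus_char \<xi> x) * norm (E l ?y - 1)"
        by (simp only: E0 right_diff_distrib[symmetric] norm_mult)
      also have "\<dots> \<le> 1 * norm (E l ?y - 1)"
        by (intro mult_right_mono) (auto simp: norm_mult indicator_def)
      also have "norm (E l ?y - 1) = \<bar>exp (- (l * Y ?y)) - 1\<bar>"
        unfolding E_def by (metis mult_minus_left norm_of_real of_real_1 of_real_diff real_norm_def)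
      also have "\<dots> \<le> l * Y ?y" using that Y_bounds[of ?y] by (intro norm_exp_minus_one_le) simp
      also have "\<dots> \<le> l" using that Y_bounds[of ?y] by (simp add: mult_left_le)
      finally show "norm (?F l x - ?F 0 x) \<le> l" by simp
    qed auto
    finally show ?thesis by (simp add: torus.prob_space[simplified])
  qed
  have key: "(\<Sum>j\<in>S. torus_char \<xi> (to_torus (f j)) * complex_of_real (exp (- l * c j))) * \<Phi> l = 0" if l: "l \<ge> 0" for l
  proof -
    let ?h = "\<lambda>x. indicator (piece S) x * torus_char \<xi> x * E l x"
    have hm: "?h \<in> borel_measurable torus_lebesgue"
      using pS by (intro borel_measurable_times) auto
    have "integral\<^sup>L torus_lebesgue ?h = 0"
    proof (rule integral_torus_half_turn[OF hm])
      \<comment> \<open>A half turn along v: it changes the sign of the character and preserves the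
        other two factors.\<close>
      let ?a = "to_torus ((1 / (2 * (\<xi> \<bullet> v))) *\<^sub>R v)"
      have ch: "torus_char \<xi> (x - ?a) = - torus_char \<xi> x" for x
      proof -
        have "torus_char \<xi> (x - ?a + ?a) = torus_char \<xi> (x - ?a) * -1"
          unfolding torus_char_add[OF \<xi>(1), of "x - ?a"] using \<xi> by (simp add: torus_char_to_torus)
        then show ?thesis by simp
      qed
      have Ea: "E l (x - ?a) = E l x" for x by (simp add: E_def Y_inv)
      show "AE x in torus_lebesgue. ?h (x - ?a) = - ?h x"
        using line_invariantD[OF vclass_line_invariant[of "vel i"], of "1 / (2 * (\<xi> \<bullet> v))"]
      proof eventually_elim
        case (elim x)
        then have "indicator (piece S) (x - ?a) = (indicator (piece S) x :: complex)"
          by (simp add: S_def indicator_def)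
        then show ?case by (simp only: ch Ea) simp
      qed
    qed
    also have "integral\<^sup>L torus_lebesgue ?h =
        (\<integral>x. (\<Sum>j\<in>S. indicator A (x - to_torus (f j)) * torus_char \<xi> x * E l x) \<partial>torus_lebesgue)"
    proof (rule integral_cong_AE[OF hm])
      show "(\<lambda>x. \<Sum>j\<in>S. indicator A (x - to_torus (f j)) * torus_char \<xi> x * E l x) \<in> borel_measurable torus_lebesgue"
        by (intro borel_measurable_sum borel_measurable_times measurable_compose[OF measurable_torus_shift_diff]) auto
      show "AE x in torus_lebesgue. ?h x = (\<Sum>j\<in>S. indicator A (x - to_torus (f j)) * torus_char \<xi> x * E l x)"
        using indicator_piece_AE[OF S(1)] by eventually_elim (simp add: sum_distrib_right)
    qed
    also have "\<dots> = (\<Sum>j\<in>S. \<integral>x. indicator A (x - to_torus (f j)) * torus_char \<xi> x * E l x \<partial>torus_lebesgue)"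
    proof (rule Bochner_Integration.integral_sum)
      show "integrable torus_lebesgue (\<lambda>x. indicator A (x - to_torus (f j)) * torus_char \<xi> x * E l x)" for j
        using E_bound[OF l]
        by (intro integrable_torus_bounded[where B = 1] borel_measurable_times measurable_compose[OF measurable_torus_shift_diff])
           (auto simp: norm_mult indicator_def)
    qed
    also have "\<dots> = (\<Sum>j\<in>S. torus_char \<xi> (to_torus (f j)) * complex_of_real (exp (- l * c j)) * \<Phi> l)"
    proof (intro sum.cong refl)
      fix j assume j: "j \<in> S"
      let ?b = "to_torus (f j)"
      let ?k = "\<lambda>x. indicator A x * torus_char \<xi> (x + ?b) * E l (x + ?b)"
      have km: "?k \<in> borel_measurable torus_lebesgue"
        by (intro borel_measurable_times measurable_compose[OF measurable_torus_shift]) auto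
      have kx: "?k x = torus_char \<xi> ?b * complex_of_real (exp (- l * c j)) * (indicator A x * torus_char \<xi> x * E l (x + to_torus (f i)))" for x
      proof (cases "x \<in> A")
        case True
        have "E l (x + ?b) = complex_of_real (exp (- l * c j)) * E l (x + to_torus (f i))"
          unfolding E_def c[OF j True] by (simp add: distrib_left exp_add[symmetric] flip: of_real_mult)
        then show ?thesis by (simp add: torus_char_add[OF \<xi>(1)])
      qed simp
      have "(\<integral>x. indicator A (x - ?b) * torus_char \<xi> x * E l x \<partial>torus_lebesgue) = integral\<^sup>L torus_lebesgue ?k"
        using integral_torus_shift_diff[OF km, of ?b] by simp
      also have "\<dots> = torus_char \<xi> ?b * complex_of_real (exp (- l * c j)) * \<Phi> l"
        unfolding kx \<Phi>_def by (rule integral_mult_right_zero)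
      finally show "(\<integral>x. indicator A (x - ?b) * torus_char \<xi> x * E l x \<partial>torus_lebesgue) =
          torus_char \<xi> ?b * complex_of_real (exp (- l * c j)) * \<Phi> l" .
    qed
    finally show ?thesis by (simp add: sum_distrib_right)
  qed
  \<comment> \<open>For k < card S the number k \<delta> stays below \<open>norm (\<Phi> 0)\<close>,
    so by \<open>\<Phi>_cont\<close> none of the integrals at l = k \<delta> vanishes.\<close>
  define \<delta> where "\<delta> = norm (\<Phi> 0) / (card S + 1)"
  have \<delta>: "\<delta> > 0" using False by (simp add: \<delta>_def \<Phi>0)
  have "(\<Sum>j | j \<in> S \<and> complex_of_real (exp (- \<delta> * c j)) = complex_of_real (exp (- \<delta> * c i)). torus_char \<xi> (to_torus (f j))) = 0"
  proof (rule power_sums_zero_class[OF S(2)])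
    fix k assume k: "k < card S"
    have "\<Phi> (real k * \<delta>) \<noteq> 0"
    proof
      assume "\<Phi> (real k * \<delta>) = 0"
      then have "norm (\<Phi> 0) \<le> real k * \<delta>" using \<Phi>_cont[of "real k * \<delta>"] \<delta> by simp
      also have "\<dots> < real (card S + 1) * \<delta>" using k \<delta> by simp
      also have "\<dots> = norm (\<Phi> 0)" by (simp add: \<delta>_def)
      finally show False by simp
    qed
    then have "(\<Sum>j\<in>S. torus_char \<xi> (to_torus (f j)) * complex_of_real (exp (- (real k * \<delta>) * c j))) = 0"
      using key[of "real k * \<delta>"] \<delta> by simp
    moreover have "complex_of_real (exp (- \<delta> * c j)) ^ k = complex_of_real (exp (- (real k * \<delta>) * c j))" for j
      by (simp add: exp_of_nat_mult[symmetric] mult.assoc flip: of_real_power)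
    ultimately show "(\<Sum>j\<in>S. torus_char \<xi> (to_torus (f j)) * complex_of_real (exp (- \<delta> * c j)) ^ k) = 0" by simp
  qed
  \<comment> \<open>The real exponential is injective, and a single point of \<open>A\<close> shows
    that \<open>c j = c i\<close> means equal position.\<close>
  also have "{j. j \<in> S \<and> complex_of_real (exp (- \<delta> * c j)) = complex_of_real (exp (- \<delta> * c i))} = sclass i"
  proof -
    obtain p where p: "to_torus p \<in> A"
      using measure_A_pos surj_to_torus by (metis ex_in_conv less_irrefl measure_empty surjE)
    have "c j = c i \<longleftrightarrow> \<eta> \<bullet> (f j - f i) \<in> \<int>" if j: "j \<in> S" for j
    proof -
      have "c j = c i \<longleftrightarrow> Y (to_torus p + to_torus (f j)) = Y (to_torus p + to_torus (f i))"
        using c[OF j p] c[OF S(3) p] by auto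
      also have "\<dots> \<longleftrightarrow> \<eta> \<bullet> (f j - f i) \<in> \<int>"
        by (simp add: Y_def torus_coord_to_torus[OF \<eta>_int] frac_eq_iff_Ints inner_add_right inner_diff_right flip: to_torus_add)
      finally show ?thesis .
    qed
    then show ?thesis using \<delta> by (auto simp: sclass_def S_def vclass_def)
  qed
  finally show ?thesis using fourier_piece[OF sclass_subset \<xi>(1)] by simp
qed (simp add: fourier_piece[OF sclass_subset \<xi>(1)])

lemma sclass_line_invariant: "i \<in> I \<Longrightarrow> line_invariant v (\<lambda>x. x \<in> piece (sclass i))"
  using sclass_fourier by (intro line_invariant_set_if_fourier sets_piece sclass_subset)

text \<open>The tiles of the class fill, up to a null set, the saturation of tile i along v, whose
  measure does not depend on i.\<close>

lemma card_sclass: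
  assumes i: "i \<in> I"
  shows "real (card (sclass i)) * measure torus_lebesgue A = measure torus_lebesgue (rat_sat v A)"
proof -
  let ?B = "piece (sclass i)" and ?C = "{x. x - to_torus (f i) \<in> rat_sat v A}"
  have B: "?B \<in> sets torus_lebesgue" by (rule sets_piece[OF sclass_subset])
  have s: "rat_sat v A \<in> sets torus_lebesgue" by (rule sets_rat_sat[OF sets_A])
  have C: "?C \<in> sets torus_lebesgue" by (rule sets_translate[OF s])
  have ii: "i \<in> sclass i" using i by (simp add: sclass_def)
  have "?B \<subseteq> ?C"
  proof
    fix x assume "x \<in> ?B"
    then obtain j where j: "j \<in> sclass i" "x - to_torus (f j) \<in> A" by (auto simp: piece_def)
    obtain p where p: "x = to_torus p" by (rule torus_cases)
    have "\<eta> \<bullet> (f j - f i) \<in> \<int>" using j(1) by (simp add: sclass_def)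
    then obtain k t where k: "k \<in> int_vecs" "f j - f i = t *\<^sub>R v + k" by (rule Ints_normal_decomp)
    have eq: "to_torus (p - f i + (- t) *\<^sub>R v) = to_torus (p - f j)"
      unfolding to_torus_eq_iff using k by (simp add: algebra_simps)
    have "to_torus (p - f i + (- t) *\<^sub>R v) \<in> A" unfolding eq using j(2) by (simp add: p to_torus_diff)
    from open_torus_line_rat[OF open_A this] obtain q where q: "q \<in> \<rat>" "to_torus (p - f i + q *\<^sub>R v) \<in> A" .
    then show "x \<in> ?C" unfolding rat_sat_def
      by (auto simp: p to_torus_add to_torus_diff to_torus_minus algebra_simps intro!: bexI[of _ "- q"])
  qed
  \<comment> \<open>Conversely, the saturation of tile i almost stays in the union of the class,
    which is invariant along v.\<close>
  moreover have "AE x in torus_lebesgue. x \<in> ?C \<longrightarrow> x \<in> ?B"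
    using rat_sat_subset_AE[OF sclass_line_invariant[OF i]]
  proof eventually_elim
    case (elim x)
    show ?case
    proof
      assume "x \<in> ?C"
      then obtain q where q: "q \<in> \<rat>" "x - to_torus (f i) - to_torus (q *\<^sub>R v) \<in> A" by (auto simp: rat_sat_def)
      then have "x - to_torus (q *\<^sub>R v) \<in> ?B" using ii by (auto simp: piece_def algebra_simps intro!: bexI[of _ i])
      then have "x \<in> rat_sat v ?B" using q(1) by (auto simp: rat_sat_def)
      then show "x \<in> ?B" using elim by blast
    qed
  qed
  ultimately have "AE x in torus_lebesgue. x \<in> ?B \<longleftrightarrow> x \<in> ?C" by (auto elim!: eventually_mono)
  then have "measure torus_lebesgue ?B = measure torus_lebesgue ?C"
    using B C by (intro measure_eq_AE) auto
  also have "\<dots> = measure torus_lebesgue (rat_sat v A)"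
    using emeasure_torus_shift[OF s, of "- to_torus (f i)"] by (simp add: measure_def vimage_def)
  finally show ?thesis by (simp add: measure_piece[OF sclass_subset])
qed

lemma card_sclass_eq:
  assumes "i \<in> I" "j \<in> I"
  shows "card (sclass i) = card (sclass j)"
  using card_sclass[OF assms(1)] card_sclass[OF assms(2)] measure_A_pos by (metis less_irrefl mult_right_cancel of_nat_eq_iff)

lemma sclass_line_coset:
  assumes "j \<in> sclass i"
  shows "to_torus (f j) \<in> line_coset (f i) v"
proof -
  have "\<eta> \<bullet> (f j - f i) \<in> \<int>" using assms by (simp add: sclass_def)
  then obtain k t where k: "k \<in> int_vecs" "f j - f i = t *\<^sub>R v + k" by (rule Ints_normal_decomp)
  then have "f j - (f i + t *\<^sub>R v) = k" by (simp add: algebra_simps)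
  then have "to_torus (f j) = to_torus (f i + t *\<^sub>R v)" using k(1) by (simp add: to_torus_eq_iff)
  then show ?thesis by (auto simp: line_coset_def to_torus_add)
qed

end

section \<open>Assembling the partition and the theorem\<close>

lemma partition_on_image_classes:
  assumes "inj_on f X" and cl: "\<And>i. i \<in> X \<Longrightarrow> cl i \<subseteq> X" "\<And>i. i \<in> X \<Longrightarrow> i \<in> cl i"
    and eq: "\<And>i j. i \<in> X \<Longrightarrow> j \<in> cl i \<Longrightarrow> cl j = cl i"
  shows "partition_on (f ` X) ((\<lambda>i. f ` cl i) ` X)"
proof (rule partition_onI)
  show "\<Union> ((\<lambda>i. f ` cl i) ` X) = f ` X" using cl by blast
  show "{} \<notin> (\<lambda>i. f ` cl i) ` X" using cl by blast
  fix p q assume "p \<in> (\<lambda>i. f ` cl i) ` X" "q \<in> (\<lambda>i. f ` cl i) ` X" "p \<noteq> q"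
  then obtain i j where ij: "i \<in> X" "j \<in> X" "p = f ` cl i" "q = f ` cl j" "cl i \<noteq> cl j" by auto
  have "cl i \<inter> cl j = {}"
  proof (rule ccontr)
    assume "cl i \<inter> cl j \<noteq> {}"
    then obtain k where "k \<in> cl i" "k \<in> cl j" by blast
    then show False using eq[OF ij(1)] eq[OF ij(2)] ij(5) by metis
  qed
  then show "disjnt p q"
    unfolding ij(3,4) disjnt_def using inj_on_image_Int[OF assms(1) cl(1)[OF ij(1)] cl(1)[OF ij(2)]] by simp
qed

context torus_tiling
begin

lemma inj_f: "inj_on f I"
  unfolding inj_on_def using tile_family_distinct[OF tile sets_A] by metis

lemma mem_image_class: "S \<subseteq> I \<Longrightarrow> i \<in> I \<Longrightarrow> f i \<in> f ` S \<longleftrightarrow> i \<in> S"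
  using inj_on_image_mem_iff[OF inj_f] by blast

lemma translate_sumset_ae_eq:
  assumes "line_invariant v (\<lambda>x. x \<in> piece S)"
  shows "translate (t *\<^sub>R v) (sumset (f ` S) A) =\<^sub>a\<^sub>e sumset (f ` S) A"
  using line_invariantD[OF assms, of t] by (simp add: ae_eq_def mem_translate sumset_eq_piece)

lemma planar_structure:
  assumes dim: "CARD('n) = 2" and z: "z \<in> I" "f z = 0"
  shows "\<exists>v \<in> int_vecs. \<exists>(\<alpha> :: nat \<Rightarrow> real) P.
        (\<forall>i\<in>I. f i - f0 i = \<alpha> i *\<^sub>R v) \<and>
        partition_on (f ` I) P \<and>
        (\<forall>S\<in>P.
          (\<forall>i\<in>I. \<forall>i'\<in>I. f i \<in> S \<and> f i' \<in> S \<longrightarrow>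
            f i - f0 i = f i' - f0 i' \<and> \<alpha> i = \<alpha> i') \<and>
          (\<forall>t :: real. translate (t *\<^sub>R v) (sumset S A) =\<^sub>a\<^sub>e sumset S A)) \<and>
        (open A \<and> connected A \<longrightarrow>
          (\<forall>i\<in>I. f i - f0 i = 0) \<or>
          (\<forall>S\<in>P. \<exists>x. to_torus ` S \<subseteq> line_coset x v) \<and>
          (\<forall>S\<in>P. \<forall>S'\<in>P. card S = card S'))"
proof -
  \<comment> \<open>The tile at the origin has velocity 0; this is how 0 in F makes the static set
    nonempty.\<close>
  have "f0 z = 0" by (simp add: f0_def z(2) \<pi>_0 vec_eq_iff)
  then have static_ne: "static \<noteq> {}" using z by (auto simp: static_def vel_def)
  show ?thesis
  proof (cases "static = I")
    case True
    have v0: "f i - f0 i = 0" if "i \<in> I" for i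
    proof -
      have "i \<in> static" using that True by blast
      then show ?thesis by (simp add: static_def vel_def)
    qed
    \<comment> \<open>When nothing moves, v = 0 and a single class will do.\<close>
    have "partition_on (f ` I) {f ` I}" using z(1) by (intro partition_on_space) auto
    moreover have "translate (t *\<^sub>R 0) (sumset (f ` I) A) =\<^sub>a\<^sub>e sumset (f ` I) A" for t
      by (rule translate_sumset_ae_eq) (simp add: line_invariant_def)
    ultimately show ?thesis
      using v0 by (intro bexI[of _ 0] exI[of _ "\<lambda>_. 0"] exI[of _ "{f ` I}"]) (auto simp: int_vecs_0)
  next
    case False
    obtain \<eta> u v where v: "\<eta> \<in> int_vecs" "u \<in> int_vecs" "v \<in> int_vecs" "\<eta> \<bullet> u = 1" "\<eta> \<bullet> v = 0" "v \<noteq> 0"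
      and par: "\<And>i. i \<in> I \<Longrightarrow> \<exists>\<beta>. vel i = \<beta> *\<^sub>R v"
      using velocities_parallel[OF dim static_ne False] by blast
    \<comment> \<open>A formula in \<open>vel i\<close> rather than a choice, so that equal
      velocities have equal coefficients.\<close>
    define \<alpha> where "\<alpha> i = (vel i \<bullet> v) / (v \<bullet> v)" for i
    have \<alpha>: "f i - f0 i = \<alpha> i *\<^sub>R v" if "i \<in> I" for i
      using par[OF that] v(6) by (auto simp: \<alpha>_def vel_def[symmetric])
    \<comment> \<open>The class function \<open>cl\<close> and the extra clause \<open>R\<close> are
      left open: open connected tiles are grouped by \<open>sclass\<close>, all others by velocity
      alone.\<close>
    have core: "\<exists>v \<in> int_vecs. \<exists>(\<alpha> :: nat \<Rightarrow> real) P.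
        (\<forall>i\<in>I. f i - f0 i = \<alpha> i *\<^sub>R v) \<and> partition_on (f ` I) P \<and>
        (\<forall>S\<in>P. (\<forall>i\<in>I. \<forall>i'\<in>I. f i \<in> S \<and> f i' \<in> S \<longrightarrow> f i - f0 i = f i' - f0 i' \<and> \<alpha> i = \<alpha> i') \<and>
          (\<forall>t :: real. translate (t *\<^sub>R v) (sumset S A) =\<^sub>a\<^sub>e sumset S A)) \<and> R v P"
      if cl: "\<And>i. i \<in> I \<Longrightarrow> cl i \<subseteq> I" "\<And>i. i \<in> I \<Longrightarrow> i \<in> cl i" "\<And>i j. i \<in> I \<Longrightarrow> j \<in> cl i \<Longrightarrow> cl j = cl i"
        "\<And>i j. i \<in> I \<Longrightarrow> j \<in> cl i \<Longrightarrow> vel j = vel i" "\<And>i. i \<in> I \<Longrightarrow> line_invariant v (\<lambda>x. x \<in> piece (cl i))"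
        "R v ((\<lambda>i. f ` cl i) ` I)"
      for cl and R :: "real ^ 'n \<Rightarrow> (real ^ 'n) set set \<Rightarrow> bool"
    proof (intro bexI[of _ v] exI[of _ \<alpha>] exI[of _ "(\<lambda>i. f ` cl i) ` I"] conjI ballI allI impI)
      show "partition_on (f ` I) ((\<lambda>i. f ` cl i) ` I)" by (rule partition_on_image_classes[OF inj_f cl(1-3)])
      fix S assume "S \<in> (\<lambda>i. f ` cl i) ` I"
      then obtain k where k: "k \<in> I" "S = f ` cl k" by blast
      show "translate (t *\<^sub>R v) (sumset S A) =\<^sub>a\<^sub>e sumset S A" for t
        unfolding k(2) by (rule translate_sumset_ae_eq[OF cl(5)[OF k(1)]])
      fix i j assume ij: "i \<in> I" "j \<in> I" "f i \<in> S \<and> f j \<in> S"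
      then have "i \<in> cl k" "j \<in> cl k" using mem_image_class[OF cl(1)[OF k(1)]] k(2) by simp_all
      then have "vel i = vel j" using cl(4)[OF k(1)] by simp
      then show "f i - f0 i = f j - f0 j" "\<alpha> i = \<alpha> j" by (simp_all add: vel_def[symmetric] \<alpha>_def)
    qed (use v \<alpha> cl(6) in auto)
    show ?thesis
    proof (cases "open A \<and> connected A")
      case True
      interpret planar_connected_tiling f n A \<pi> \<eta> u v
      proof unfold_locales
        show "\<exists>i\<in>I. vel i \<noteq> 0" using False by (auto simp: static_def)
      qed (use True v par dim static_ne in auto)
      show ?thesis
      proof (rule core[of sclass])
        show "i \<in> sclass i" if "i \<in> I" for i using that by (simp add: sclass_def)
        show "sclass j = sclass i" if "i \<in> I" "j \<in> sclass i" for i j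
        proof -
          have j: "vel j = vel i" "\<eta> \<bullet> (f j - f i) \<in> \<int>" using that(2) by (auto simp: sclass_def)
          have "\<eta> \<bullet> (f k - f j) \<in> \<int> \<longleftrightarrow> \<eta> \<bullet> (f k - f i) \<in> \<int>" for k
            using Ints_add[of "\<eta> \<bullet> (f k - f j)" "\<eta> \<bullet> (f j - f i)"] Ints_diff[of "\<eta> \<bullet> (f k - f i)" "\<eta> \<bullet> (f j - f i)"] j(2)
            by (auto simp: inner_diff_right)
          then show ?thesis using j(1) by (simp add: sclass_def)
        qed
        show "vel j = vel i" if "j \<in> sclass i" for i j using that by (simp add: sclass_def)
        have "to_torus ` f ` sclass i \<subseteq> line_coset (f i) v" for i using sclass_line_coset by auto
        then have cosets: "\<forall>S\<in>(\<lambda>i. f ` sclass i) ` I. \<exists>x. to_torus ` S \<subseteq> line_coset x v" by blast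
        have card_eq: "card (f ` sclass i) = card (sclass i)" for i
          by (rule card_image[OF inj_on_subset[OF inj_f sclass_subset]])
        have cards: "\<forall>S\<in>(\<lambda>i. f ` sclass i) ` I. \<forall>S'\<in>(\<lambda>i. f ` sclass i) ` I. card S = card S'"
        proof (intro ballI)
          fix S S' assume "S \<in> (\<lambda>i. f ` sclass i) ` I" "S' \<in> (\<lambda>i. f ` sclass i) ` I"
          then obtain i j where "i \<in> I" "j \<in> I" "S = f ` sclass i" "S' = f ` sclass j" by blast
          then show "card S = card S'" using card_sclass_eq[of i j] by (simp only: card_eq)
        qed
        show "open A \<and> connected A \<longrightarrow>
          (\<forall>i\<in>I. f i - f0 i = 0) \<or>
          (\<forall>S\<in>(\<lambda>i. f ` sclass i) ` I. \<exists>x. to_torus ` S \<subseteq> line_coset x v) \<and>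
          (\<forall>S\<in>(\<lambda>i. f ` sclass i) ` I. \<forall>S'\<in>(\<lambda>i. f ` sclass i) ` I. card S = card S')"
          using cosets cards by (intro impI disjI2 conjI)
      qed (rule sclass_subset, rule sclass_line_invariant)
    next
      case no: False
      have F: "fourier (indicator (piece {j \<in> I. vel j = vel i})) \<xi> = 0" if "\<xi> \<in> int_vecs" "\<xi> \<bullet> v \<noteq> 0" for i \<xi>
        by (rule velocity_class_fourier[OF par that])
      show ?thesis
      proof (rule core[of "\<lambda>i. {j\<in>I. vel j = vel i}"])
        show "line_invariant v (\<lambda>x. x \<in> piece {j \<in> I. vel j = vel i})" for i
          by (rule line_invariant_set_if_fourier[OF sets_piece F]) auto
      qed (use no in auto)
    qed
  qed
qed

end

theorem theorem1p7:
  fixes f :: "nat \<Rightarrow> real ^ ('n :: finite)" and n :: nat and A :: "'n torus set"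
  assumes "inj_on f {1..n}"
    and "tiling (f ` {1..n}) A"
  shows "\<exists>f0 :: nat \<Rightarrow> real ^ 'n.
    f0 ` {1..n} \<subseteq> rat_vecs \<and> rational_set (f0 ` {1..n}) \<and> tiling (f0 ` {1..n}) A \<and>
    (\<forall>t :: real. tiling ((\<lambda>i. f0 i + t *\<^sub>R (f i - f0 i)) ` {1..n}) A) \<and>
    (CARD('n) = 2 \<and> 0 \<in> f ` {1..n} \<longrightarrow>
      (\<exists>v \<in> int_vecs. \<exists>(\<alpha> :: nat \<Rightarrow> real) P.
        (\<forall>i\<in>{1..n}. f i - f0 i = \<alpha> i *\<^sub>R v) \<and>
        partition_on (f ` {1..n}) P \<and>
        (\<forall>S\<in>P.
          (\<forall>i\<in>{1..n}. \<forall>i'\<in>{1..n}. f i \<in> S \<and> f i' \<in> S \<longrightarrow>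
            f i - f0 i = f i' - f0 i' \<and> \<alpha> i = \<alpha> i') \<and>
          (\<forall>t :: real. translate (t *\<^sub>R v) (sumset S A) =\<^sub>a\<^sub>e sumset S A)) \<and>
        (open A \<and> connected A \<longrightarrow>
          (\<forall>i\<in>{1..n}. f i - f0 i = 0) \<or>
          (\<forall>S\<in>P. \<exists>x. to_torus ` S \<subseteq> line_coset x v) \<and>
          (\<forall>S\<in>P. \<forall>S'\<in>P. card S = card S')))) \<and>
    (CARD('n) = 1 \<longrightarrow>
      rational_set (f ` {1..n}) \<and>
      (\<exists>v :: real ^ 'n. f ` {1..n} = (\<lambda>x. x + v) ` f0 ` {1..n}))"
proof -
  obtain \<pi> :: "real \<Rightarrow> real" where \<pi>: "\<forall>x y. \<pi> (x + y) = \<pi> x + \<pi> y" "\<forall>q\<in>\<rat>. \<forall>x. \<pi> (q * x) = q * \<pi> x"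
    "range \<pi> \<subseteq> \<rat>" "\<pi> 1 = 1"
    using exists_rat_linear_retraction by blast
  interpret torus_tiling f n A \<pi>
    using tile_family_if_tiling[OF assms(2,1)] \<pi> by unfold_locales auto
  show ?thesis
  proof (intro exI[of _ f0] conjI allI impI)
    show "f0 ` {1..n} \<subseteq> rat_vecs" using f0_rat by auto
    show "rational_set (f0 ` {1..n})" using f0_diff_rat by (auto simp: rational_set_def)
    show "tiling (f0 ` {1..n}) A" using tiling_if_tile_family[OF tile_motion_f0[of 0] sets_A] by simp
    show "tiling ((\<lambda>i. f0 i + t *\<^sub>R (f i - f0 i)) ` {1..n}) A" for t
      by (rule tiling_if_tile_family[OF tile_motion_f0 sets_A])
  next
    assume "CARD('n) = 2 \<and> 0 \<in> f ` {1..n}"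
    then obtain z where "CARD('n) = 2" "z \<in> {1..n}" "f z = 0" by auto
    then show "\<exists>v \<in> int_vecs. \<exists>(\<alpha> :: nat \<Rightarrow> real) P.
        (\<forall>i\<in>{1..n}. f i - f0 i = \<alpha> i *\<^sub>R v) \<and>
        partition_on (f ` {1..n}) P \<and>
        (\<forall>S\<in>P.
          (\<forall>i\<in>{1..n}. \<forall>i'\<in>{1..n}. f i \<in> S \<and> f i' \<in> S \<longrightarrow>
            f i - f0 i = f i' - f0 i' \<and> \<alpha> i = \<alpha> i') \<and>
          (\<forall>t :: real. translate (t *\<^sub>R v) (sumset S A) =\<^sub>a\<^sub>e sumset S A)) \<and>
        (open A \<and> connected A \<longrightarrow>
          (\<forall>i\<in>{1..n}. f i - f0 i = 0) \<or>
          (\<forall>S\<in>P. \<exists>x. to_torus ` S \<subseteq> line_coset x v) \<and>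
          (\<forall>S\<in>P. \<forall>S'\<in>P. card S = card S'))"
      by (rule planar_structure)
  next
    assume "CARD('n) = 1"
    then have v: "vel i = vel 1" if "i \<in> {1..n}" for i
      using vel_eq_if_dim_1[of i 1] that by simp
    then have f: "f i = f0 i + vel 1" if "i \<in> {1..n}" for i
      using that by (metis add.commute diff_add_cancel vel_def)
    show "rational_set (f ` {1..n})"
      using f f0_diff_rat by (simp add: rational_set_def)
    show "\<exists>v :: real ^ 'n. f ` {1..n} = (\<lambda>x. x + v) ` f0 ` {1..n}"
      using f by (intro exI[of _ "vel 1"]) (force simp: image_image)
  qed
qed


end
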